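(* Let $(T,m)$ be a flow tree with flow Laplacian $\mathcal{L}$. Let $s>3/2$. Then there exists a positive constant $C_s$ such that, if $F\in L^2_s(\mathbb{R})$, then $F(\mathcal{L})$ is bounded on $L^p(m)$ for every $p\in[1,\infty]$ and $$\|F(\mathcal{L})\|_{L^p(m)\to L^p(m)}\le C_s\,\|F\|_{L^2_s}.$$
   Context: Trees. A tree $T$ is an infinite connected graph without cycles, locally finite, identified with its set of vertices and equipped with the graph distance $d$. A tree with root at infinity is such a tree with a fixed boundary point (end) $\omega_*\in\partial T$. For $x\in T$, the predecessor $\mathfrak{p}(x)$ is the neighbour of $x$ lying on the semi-infinite geodesic from $x$ to $\omega_*$; the remaining neighbours form the set $\mathfrak{s}(x)$ of successors. Flow trees. A flow measure on $T$ is a function $m:T\to(0,\infty)$ with $m(x)=\sum_{y\in\mathfrak{s}(x)}m(y)$ for all $x\in T$, identified with the measure of density $m$ with respect to counting measure; $(T,m)$ is then a flow tree. The flow gradient is $\nabla f(x)=f(x)-f(\mathfrak{p}(x))$, and the flow Laplacian is $\mathcal{L}=\frac12\nabla^*\nabla$ ($\nabla^*$ the adjoint on $L^2(m)$), i.e. $\mathcal{L}f(x)=f(x)-\frac12f(\mathfrak{p}(x))-\frac1{2m(x)}\sum_{y\in\mathfrak{s}(x)}f(y)m(y)$. It is bounded and selfadjoint on $L^2(m)$ with $L^2$ spectrum $[0,2]$; $F(\mathcal{L})$ is defined by the Borel functional calculus on $L^2(m)$. $L^2_s(\mathbb{R})$ is the standard inhomogeneous $L^2$ Sobolev space of order $s$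 (elements are identified with their continuous representatives). Boundedness on $L^p(m)$, $p<\infty$, means that the norm inequality holds on $L^2(m)\cap L^p(m)$, so the operator extends; for $p=\infty$, $F(\mathcal{L})$ is understood as the adjoint of $\overline{F}(\mathcal{L})$ on $L^1(m)$. *)

theory Defs
  imports "HOL-Probability.Essential_Supremum" "HOL-Analysis.Analysis"
begin

section \<open>Lebesgue spaces\<close>

definition Lp_space :: "'a measure \<Rightarrow> ennreal \<Rightarrow> ('a \<Rightarrow> complex) set" where
  "Lp_space M p =
     {f \<in> borel_measurable M.
        if p = top then esssup M (\<lambda>x. ennreal (cmod (f x))) < top
        else integrable M (\<lambda>x. cmod (f x) powr enn2real p)}"

text \<open>Only meaningful for members of the space: the Bochner integral of a non-integrable
  function is 0, so membership is always required separately below.\<close>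
definition Lp_norm :: "'a measure \<Rightarrow> ennreal \<Rightarrow> ('a \<Rightarrow> complex) \<Rightarrow> real" where
  "Lp_norm M p f =
     (if p = top then enn2real (esssup M (\<lambda>x. ennreal (cmod (f x))))
      else (LINT x|M. cmod (f x) powr enn2real p) powr (1 / enn2real p))"

definition pairing :: "'a measure \<Rightarrow> ('a \<Rightarrow> complex) \<Rightarrow> ('a \<Rightarrow> complex) \<Rightarrow> complex" where
  "pairing M f g = (LINT x|M. f x * cnj (g x))"

definition Lp_tendsto ::
  "'a measure \<Rightarrow> ennreal \<Rightarrow> ('i \<Rightarrow> 'a \<Rightarrow> complex) \<Rightarrow> ('a \<Rightarrow> complex) \<Rightarrow> 'i filter \<Rightarrow> bool" where
  "Lp_tendsto M p fs f F \<longleftrightarrow>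
     (\<forall>\<^sub>F i in F. (\<lambda>x. fs i x - f x) \<in> Lp_space M p) \<and>
     ((\<lambda>i. Lp_norm M p (\<lambda>x. fs i x - f x)) \<longlongrightarrow> 0) F"

section \<open>The Sobolev spaces on the real line\<close>

definition truncated_fourier :: "real \<Rightarrow> (real \<Rightarrow> complex) \<Rightarrow> real \<Rightarrow> complex" where
  "truncated_fourier R F \<xi> =
     complex_of_real (1 / sqrt (2 * pi)) *
     (CLINT x:{-R..R}|lborel. F x * exp (- \<i> * complex_of_real (x * \<xi>)))"

text \<open>\<open>G\<close> is the Fourier--Plancherel transform of \<open>F\<close> (unique up to null sets).\<close>
definition is_plancherel_transform :: "(real \<Rightarrow> complex) \<Rightarrow> (real \<Rightarrow> complex) \<Rightarrow> bool" where
  "is_plancherel_transform F G \<longleftrightarrow>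
     F \<in> Lp_space lborel 2 \<and> G \<in> Lp_space lborel 2 \<and>
     Lp_tendsto lborel 2 (\<lambda>R. truncated_fourier R F) G at_top"

definition bessel_weight :: "real \<Rightarrow> (real \<Rightarrow> complex) \<Rightarrow> real \<Rightarrow> complex" where
  "bessel_weight s G \<xi> = complex_of_real ((1 + \<xi>\<^sup>2) powr (s / 2)) * G \<xi>"

text \<open>For orders \<open>s \<ge> 0\<close> only: elements of negative order need not be functions.\<close>
definition sobolev :: "real \<Rightarrow> (real \<Rightarrow> complex) set" where
  "sobolev s =
     {F. \<exists>G. is_plancherel_transform F G \<and> bessel_weight s G \<in> Lp_space lborel 2}"

definition sobolev_norm :: "real \<Rightarrow> (real \<Rightarrow> complex) \<Rightarrow> real" where
  "sobolev_norm s F =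
     Lp_norm lborel 2 (bessel_weight s (SOME G. is_plancherel_transform F G))"

section \<open>Trees with root at infinity\<close>

text \<open>The tree is identified with its vertex set, which is the whole type; \<open>E\<close> is adjacency.\<close>
definition infinite_tree :: "('v \<Rightarrow> 'v \<Rightarrow> bool) \<Rightarrow> bool" where
  "infinite_tree E \<longleftrightarrow>
     infinite (UNIV :: 'v set) \<and>
     symp E \<and> irreflp E \<and>
     (\<forall>x. finite {y. E x y}) \<and>
     (\<forall>x y. E\<^sup>*\<^sup>* x y) \<and>
     \<not> (\<exists>xs. length xs \<ge> 3 \<and> distinct xs \<and> successively E xs \<and> E (last xs) (hd xs))"

definition graph_dist :: "('v \<Rightarrow> 'v \<Rightarrow> bool) \<Rightarrow> 'v \<Rightarrow> 'v \<Rightarrow> nat" where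
  "graph_dist E x y = (LEAST n. (E ^^ n) x y)"

definition geodesic_rays :: "('v \<Rightarrow> 'v \<Rightarrow> bool) \<Rightarrow> (nat \<Rightarrow> 'v) set" where
  "geodesic_rays E = {\<gamma>. \<forall>i k. graph_dist E (\<gamma> i) (\<gamma> (i + k)) = k}"

definition cofinal_rays :: "('v \<Rightarrow> 'v \<Rightarrow> bool) \<Rightarrow> ((nat \<Rightarrow> 'v) \<times> (nat \<Rightarrow> 'v)) set" where
  "cofinal_rays E =
     {(\<gamma>, \<gamma>'). \<gamma> \<in> geodesic_rays E \<and> \<gamma>' \<in> geodesic_rays E \<and> (\<exists>i j. \<forall>n. \<gamma> (i + n) = \<gamma>' (j + n))}"

definition tree_boundary :: "('v \<Rightarrow> 'v \<Rightarrow> bool) \<Rightarrow> (nat \<Rightarrow> 'v) set set" where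
  "tree_boundary E = geodesic_rays E // cofinal_rays E"

text \<open>A boundary point is a class of cofinal rays; the geodesic from \<open>x\<close> to \<open>\<omega>\<close> is its unique
  member starting at \<open>x\<close>.\<close>
definition predecessor :: "('v \<Rightarrow> 'v \<Rightarrow> bool) \<Rightarrow> (nat \<Rightarrow> 'v) set \<Rightarrow> 'v \<Rightarrow> 'v" where
  "predecessor E \<omega> x = (THE y. \<exists>\<gamma>\<in>\<omega>. \<gamma> 0 = x \<and> \<gamma> 1 = y)"

definition successors :: "('v \<Rightarrow> 'v \<Rightarrow> bool) \<Rightarrow> (nat \<Rightarrow> 'v) set \<Rightarrow> 'v \<Rightarrow> 'v set" where
  "successors E \<omega> x = {y. E x y} - {predecessor E \<omega> x}"

definition flow_tree :: "('v \<Rightarrow> 'v \<Rightarrow> bool) \<Rightarrow> (nat \<Rightarrow> 'v) set \<Rightarrow> ('v \<Rightarrow> real) \<Rightarrow> bool" where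
  "flow_tree E \<omega> m \<longleftrightarrow>
     infinite_tree E \<and> \<omega> \<in> tree_boundary E \<and>
     (\<forall>x. m x > 0) \<and> (\<forall>x. m x = (\<Sum>y\<in>successors E \<omega> x. m y))"

definition flow_measure :: "('v \<Rightarrow> real) \<Rightarrow> 'v measure" where
  "flow_measure m = point_measure UNIV (\<lambda>x. ennreal (m x))"

text \<open>On \<open>L\<^sup>2\<close> of the flow measure this is \<open>\<nabla>\<^sup>*\<nabla>/2\<close> for \<open>\<nabla>f(x) = f(x) - f(\<pp>(x))\<close>.\<close>
definition flow_laplacian ::
  "('v \<Rightarrow> 'v \<Rightarrow> bool) \<Rightarrow> (nat \<Rightarrow> 'v) set \<Rightarrow> ('v \<Rightarrow> real) \<Rightarrow> ('v \<Rightarrow> complex) \<Rightarrow> 'v \<Rightarrow> complex" where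
  "flow_laplacian E \<omega> m f x =
     f x - f (predecessor E \<omega> x) / 2
     - (\<Sum>y\<in>successors E \<omega> x. f y * complex_of_real (m y)) / complex_of_real (2 * m x)"

section \<open>Borel functional calculus\<close>

text \<open>Throughout, \<open>A\<close> is a bounded selfadjoint operator on \<open>L\<^sup>2(M)\<close>, and the only null set of
  \<open>M\<close> is empty, so that elements of Lebesgue spaces are functions and definite descriptions
  pick them out. The spectral measure of a vector \<open>f\<close> is the unique compactly supported finite
  Borel measure that represents the functional sending a polynomial \<open>q\<close> to
  \<open>\<langle>q(A)f, f\<rangle>\<close>.\<close>
definition spectral_measure ::
  "'a measure \<Rightarrow> (('a \<Rightarrow> complex) \<Rightarrow> 'a \<Rightarrow> complex) \<Rightarrow> ('a \<Rightarrow> complex) \<Rightarrow> real measure" where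
  "spectral_measure M A f =
     (THE \<mu>. sets \<mu> = sets borel \<and> finite_measure \<mu> \<and>
        (\<exists>R. AE t in \<mu>. \<bar>t\<bar> \<le> R) \<and>
        (\<forall>n. complex_of_real (LINT t|\<mu>. t ^ n) = pairing M ((A ^^ n) f) f))"

text \<open>The integral of \<open>F\<close> against the complex spectral measure of the pair \<open>f\<close>, \<open>h\<close>, obtained
  by polarization (forms are linear in the first argument).\<close>
definition spectral_form ::
  "'a measure \<Rightarrow> (('a \<Rightarrow> complex) \<Rightarrow> 'a \<Rightarrow> complex) \<Rightarrow> (real \<Rightarrow> complex) \<Rightarrow>
   ('a \<Rightarrow> complex) \<Rightarrow> ('a \<Rightarrow> complex) \<Rightarrow> complex" where
  "spectral_form M A F f h =
     (\<Sum>k<4. \<i> ^ k * (LINT t|spectral_measure M A (\<lambda>x. f x + \<i> ^ k * h x). F t)) / 4"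

definition borel_calculus ::
  "'a measure \<Rightarrow> (('a \<Rightarrow> complex) \<Rightarrow> 'a \<Rightarrow> complex) \<Rightarrow> (real \<Rightarrow> complex) \<Rightarrow>
   ('a \<Rightarrow> complex) \<Rightarrow> 'a \<Rightarrow> complex" where
  "borel_calculus M A F f =
     (THE g. g \<in> Lp_space M 2 \<and> (\<forall>h\<in>Lp_space M 2. pairing M g h = spectral_form M A F f h))"

section \<open>Boundedness on Lebesgue spaces\<close>

definition Lp_extension ::
  "'a measure \<Rightarrow> ennreal \<Rightarrow> (('a \<Rightarrow> complex) \<Rightarrow> 'a \<Rightarrow> complex) \<Rightarrow> ('a \<Rightarrow> complex) \<Rightarrow> 'a \<Rightarrow> complex" where
  "Lp_extension M p T f =
     (THE u. u \<in> Lp_space M p \<and>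
        (\<forall>fs :: nat \<Rightarrow> 'a \<Rightarrow> complex.
           (\<forall>n. fs n \<in> Lp_space M 2 \<inter> Lp_space M p) \<and> Lp_tendsto M p fs f sequentially \<longrightarrow>
           Lp_tendsto M p (\<lambda>n. T (fs n)) u sequentially))"

definition Linf_adjoint ::
  "'a measure \<Rightarrow> (('a \<Rightarrow> complex) \<Rightarrow> 'a \<Rightarrow> complex) \<Rightarrow> ('a \<Rightarrow> complex) \<Rightarrow> 'a \<Rightarrow> complex" where
  "Linf_adjoint M B f =
     (THE h. h \<in> Lp_space M top \<and> (\<forall>g\<in>Lp_space M 1. pairing M h g = pairing M f (B g)))"

definition mult_domain :: "'a measure \<Rightarrow> ennreal \<Rightarrow> ('a \<Rightarrow> complex) set" where
  "mult_domain M p = (if p = top then Lp_space M top else Lp_space M 2 \<inter> Lp_space M p)"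

text \<open>\<open>F(A)\<close> as an operator on \<open>L\<^sup>p\<close>: for finite \<open>p\<close> it is tested on \<open>L\<^sup>2 \<inter> L\<^sup>p\<close>; for
  \<open>p = \<infinity>\<close> it is the adjoint of the \<open>L\<^sup>1\<close> extension of the complex conjugate multiplier.\<close>
definition mult_operator ::
  "'a measure \<Rightarrow> (('a \<Rightarrow> complex) \<Rightarrow> 'a \<Rightarrow> complex) \<Rightarrow> (real \<Rightarrow> complex) \<Rightarrow> ennreal \<Rightarrow>
   ('a \<Rightarrow> complex) \<Rightarrow> 'a \<Rightarrow> complex" where
  "mult_operator M A F p =
     (if p = top then Linf_adjoint M (Lp_extension M 1 (borel_calculus M A (\<lambda>t. cnj (F t))))
      else borel_calculus M A F)"

definition mult_bounds ::
  "'a measure \<Rightarrow> (('a \<Rightarrow> complex) \<Rightarrow> 'a \<Rightarrow> complex) \<Rightarrow> (real \<Rightarrow> complex) \<Rightarrow> ennreal \<Rightarrow> real set" where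
  "mult_bounds M A F p =
     {K. 0 \<le> K \<and> (\<forall>f\<in>mult_domain M p.
           mult_operator M A F p f \<in> Lp_space M p \<and>
           Lp_norm M p (mult_operator M A F p f) \<le> K * Lp_norm M p f)}"

definition mult_bounded ::
  "'a measure \<Rightarrow> (('a \<Rightarrow> complex) \<Rightarrow> 'a \<Rightarrow> complex) \<Rightarrow> (real \<Rightarrow> complex) \<Rightarrow> ennreal \<Rightarrow> bool" where
  "mult_bounded M A F p \<longleftrightarrow> mult_bounds M A F p \<noteq> {}"

text \<open>The operator norm; to be used only together with boundedness.\<close>
definition mult_norm ::
  "'a measure \<Rightarrow> (('a \<Rightarrow> complex) \<Rightarrow> 'a \<Rightarrow> complex) \<Rightarrow> (real \<Rightarrow> complex) \<Rightarrow> ennreal \<Rightarrow> real" where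
  "mult_norm M A F p = Inf (mult_bounds M A F p)"

end

theory Submission
  imports Defs "HOL-Probability.Probability"
begin

text \<open>Write \<open>S f = f \<circ> p\<close>, where \<open>p\<close> is the predecessor map. The flow condition says that \<open>S\<^sup>* S = 1\<close>, so
  the Chebyshev polynomials of the second kind satisfy \<open>U\<^sub>n(1 - L) = \<Sum>k\<le>n. S\<^sup>k (S\<^sup>*)\<^sup>n\<^sup>-\<^sup>k\<close> for the flow
  Laplacian \<open>L = 1 - (S + S\<^sup>*) / 2\<close>. This operator has a symmetric nonnegative kernel of total mass
  \<open>n + 1\<close>, hence norm at most \<open>n + 1\<close> on every Lebesgue space by Schur's test. It remains to expand
  \<open>F (1 - cos \<theta>) = \<Sum>n. d\<^sub>n U\<^sub>n(cos \<theta>)\<close> with \<open>\<Sum>n. (n + 1) \<bar>d\<^sub>n\<bar>\<close> bounded by the Sobolev norm of \<open>F\<close>.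
  The \<open>d\<^sub>n\<close> are differences of cosine coefficients of \<open>F (1 - cos \<theta>)\<close>. On the block \<open>N \<le> n < 2 N\<close> these
  are estimated by Bessel's inequality, after one integration by parts for the frequencies of \<open>F\<close>
  above \<open>N\<close> and two for the others; the block contributes \<open>O(N\<^sup>3\<^sup>/\<^sup>2\<^sup>-\<^sup>s)\<close>, which is summable over dyadic
  \<open>N\<close> because \<open>s > 3/2\<close>. The spectral measures of \<open>L\<close>, which enter the functional calculus, come from the
  Hausdorff moment problem since \<open>0 \<le> L / 2 \<le> 1\<close>.\<close>

section \<open>Predecessors in a tree with root at infinity\<close>

text \<open>The exponent 3/2 is 1 + 1/2: the Schur bound n + 1 costs one derivative, and passing
  from square sums over a block to plain sums costs the other half. For s < 2 the second derivative
  of F need not be square integrable, hence the two frequency ranges. The substitution x = 1 - cos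
  \<theta> degenerates at both ends of [0, 2], where its Jacobian sin \<theta> vanishes. One
  differentiation of F (1 - cos \<theta>) produces a factor sin \<theta>, which pays for the
  Jacobian. Two of them leave a summand cos \<theta> F' (1 - cos \<theta>) without such a factor;
  there a uniform bound on F' takes over, available because low frequencies are controlled at order
  2. Only the values of F on [0, 2] matter, so a Gaussian-weighted inequality near that interval
  stands in for Plancherel's theorem on the line. The functional calculus and its extensions are
  given by definite descriptions, so at each stage uniqueness has to be shown along with
  existence.\<close>

fun nonbacktracking :: "('v \<Rightarrow> 'v \<Rightarrow> bool) \<Rightarrow> 'v list \<Rightarrow> bool" where
  "nonbacktracking E (x # y # z # zs) \<longleftrightarrow> E x y \<and> x \<noteq> z \<and> nonbacktracking E (y # z # zs)"
| "nonbacktracking E [x, y] \<longleftrightarrow> E x y"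
| "nonbacktracking E _ \<longleftrightarrow> True"

lemma nonbacktracking_successively: "nonbacktracking E xs \<Longrightarrow> successively E xs"
  by (induction E xs rule: nonbacktracking.induct) auto

lemma nonbacktracking_Cons: "nonbacktracking E (x # xs) \<Longrightarrow> nonbacktracking E xs"
  by (cases "(E, x # xs)" rule: nonbacktracking.cases) auto

lemma nonbacktracking_if_distinct:
  "distinct xs \<Longrightarrow> successively E xs \<Longrightarrow> nonbacktracking E xs"
  by (induction E xs rule: nonbacktracking.induct) auto

text \<open>The condition looks at three consecutive vertices only, so two walks that overlap in an
  edge can be glued along it.\<close>

lemma nonbacktracking_join:
  "nonbacktracking E (us @ [a, b]) \<Longrightarrow> nonbacktracking E (a # b # vs)
     \<Longrightarrow> nonbacktracking E (us @ a # b # vs)"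
proof (induction us)
  case (Cons u us)
  then have IH: "nonbacktracking E (us @ a # b # vs)"
    using nonbacktracking_Cons[of E u "us @ [a, b]"] by auto
  show ?case
  proof (cases us)
    case Nil
    then show ?thesis using Cons.prems by simp
  next
    case (Cons v ws)
    then show ?thesis using Cons.prems(1) IH \<open>us = v # ws\<close> by (cases ws) auto
  qed
qed simp

lemma nonbacktracking_upt:
  assumes "\<And>i. E (\<gamma> i) (\<gamma> (Suc i))" "\<And>i. \<gamma> (Suc (Suc i)) \<noteq> \<gamma> i"
  shows "nonbacktracking E (map \<gamma> [i..<i + n])"
proof (induction n arbitrary: i)
  case (Suc n)
  have *: "map \<gamma> [j..<j + Suc k] = \<gamma> j # map \<gamma> [Suc j..<Suc j + k]" for j k
    by (simp add: upt_conv_Cons del: upt_Suc)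
  consider "n = 0" | "n = 1" | k where "n = Suc (Suc k)"
    by (metis One_nat_def not0_implies_Suc)
  then show ?case
  proof cases
    case 3
    show ?thesis
      using Suc.IH[of "Suc i"] assms(1)[of i] assms(2)[of i, symmetric] unfolding 3 * by simp
  qed (use assms in simp_all)
qed simp

section \<open>Paths, distances and geodesic rays in a tree\<close>

locale tree =
  fixes E :: "'v \<Rightarrow> 'v \<Rightarrow> bool"
  assumes infinite_tree: "infinite_tree E"
begin

lemma E_sym: "E x y \<Longrightarrow> E y x" and E_irrefl: "\<not> E x x" and finite_nbhd: "finite {y. E x y}"
  and connected: "E\<^sup>*\<^sup>* x y"
  and acyclic: "\<lbrakk>length xs \<ge> 3; distinct xs; successively E xs\<rbrakk> \<Longrightarrow> \<not> E (last xs) (hd xs)"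
  using infinite_tree unfolding infinite_tree_def by (auto dest: sympD irreflpD)

text \<open>A first return to the initial vertex would close a cycle: the vertices before the return
  are distinct by induction, and there are at least three of them, because irreflexivity excludes a
  return after one step and the local condition excludes one after two.\<close>

lemma distinct_if_nonbacktracking: "nonbacktracking E xs \<Longrightarrow> distinct xs"
proof (induction xs)
  case (Cons x ys)
  then have dist: "distinct ys" and nb: "nonbacktracking E ys"
    by (auto dest: nonbacktracking_Cons)
  have succ: "successively E (x # ys)" using Cons.prems by (rule nonbacktracking_successively)
  have "x \<notin> set ys"
  proof
    assume "x \<in> set ys"
    then obtain us vs where ys: "ys = us @ x # vs" and x: "x \<notin> set us" by (meson split_list_first)
    have us: "us \<noteq> []" using succ ys E_irrefl by auto
    have len: "length us \<noteq> 1"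
      using Cons.prems ys by (auto simp: length_Suc_conv)
    have "length (x # us) \<ge> 3" using us len by (cases us) (auto simp: Suc_le_eq)
    moreover have "distinct (x # us)" using x dist ys by auto
    moreover have "successively E (x # us)" "E (last us) x"
      using succ us unfolding ys by (auto simp: successively_append_iff successively_Cons)
    ultimately show False using acyclic[of "x # us"] us by auto
  qed
  then show ?case using dist by simp
qed simp

text \<open>If the second vertices b and c differ, then running the first path backwards and the
  second one forwards is a walk that does not turn back at their common start. It would be distinct,
  although its two ends coincide.\<close>

lemma path_unique:
  assumes "distinct xs" "successively E xs" "distinct ys" "successively E ys"
    "xs \<noteq> []" "ys \<noteq> []" "hd xs = hd ys" "last xs = last ys"
  shows "xs = ys"
  using assms
proof (induction xs arbitrary: ys)
  case (Cons a xs)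
  then obtain ys' where ys: "ys = a # ys'" by (cases ys) auto
  show ?case
  proof (cases "xs = [] \<or> ys' = []")
    case True
    then show ?thesis using Cons.prems ys
      by (metis distinct.simps(2) last.simps last_in_set)
  next
    case False
    then obtain b xs' c ys'' where xs: "xs = b # xs'" and ys': "ys' = c # ys''"
      by (meson neq_Nil_conv)
    have "b = c"
    proof (rule ccontr)
      assume "b \<noteq> c"
      have "successively E (rev (a # xs))"
        using Cons.prems(2) E_sym by (subst successively_rev) (auto elim: successively_mono)
      then have "nonbacktracking E (rev xs' @ [b, a])"
        using Cons.prems(1) xs by (intro nonbacktracking_if_distinct) auto
      moreover have "nonbacktracking E (a # c # ys'')"
        using Cons.prems ys ys' by (intro nonbacktracking_if_distinct) auto
      then have "nonbacktracking E (b # a # c # ys'')"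
        using Cons.prems(2) xs \<open>b \<noteq> c\<close> E_sym by auto
      ultimately have "distinct (rev xs' @ b # a # c # ys'')"
        by (blast intro: distinct_if_nonbacktracking nonbacktracking_join[of _ _ b])
      moreover have "last (b # xs') = last (c # ys'')" using Cons.prems ys xs ys' by simp
      then have "last (c # ys'') \<in> set (b # xs')" by (metis last_in_set list.distinct(1))
      moreover have "last (c # ys'') \<in> set (c # ys'')" by (rule last_in_set) simp
      ultimately show False by auto
    qed
    then have "xs = ys'"
      using Cons.prems ys xs ys' by (intro Cons.IH) (auto simp: successively_Cons)
    then show ?thesis using ys by simp
  qed
qed simp

lemma relpowp_path:
  assumes "(E ^^ n) x y"
  shows "\<exists>xs. xs \<noteq> [] \<and> hd xs = x \<and> last xs = y \<and> distinct xs \<and> successively E xs \<and> length xs \<le> Suc n"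
  using assms
proof (induction n arbitrary: y)
  case 0
  then show ?case by (intro exI[of _ "[x]"]) auto
next
  case (Suc n)
  then obtain z where z: "(E ^^ n) x z" "E z y" by auto
  from Suc.IH[OF z(1)] obtain xs where xs: "xs \<noteq> []" "hd xs = x" "last xs = z" "distinct xs"
    "successively E xs" "length xs \<le> Suc n" by auto
  show ?case
  proof (cases "y \<in> set xs")
    case False
    then show ?thesis using xs z
      by (intro exI[of _ "xs @ [y]"]) (auto simp: successively_append_iff)
  next
    \<comment> \<open>The new vertex was visited before: cut the path off there, which only shortens
      it.\<close>
    case True
    then obtain us vs where *: "xs = (us @ [y]) @ vs" by (metis append.assoc append_Cons append_Nil split_list)
    have "successively E (us @ [y])" using xs(5) unfolding * successively_append_iff by blast
    then show ?thesis using xs * by (intro exI[of _ "us @ [y]"]) (auto simp: hd_append)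
  qed
qed

lemma path_relpowp:
  "successively E xs \<Longrightarrow> xs \<noteq> [] \<Longrightarrow> (E ^^ (length xs - 1)) (hd xs) (last xs)"
proof (induction xs)
  case (Cons x xs)
  show ?case
  proof (cases xs)
    case (Cons y ys)
    then show ?thesis using Cons.IH Cons.prems relpowp_Suc_I2[of E x y "length ys"]
      by (auto simp: successively_Cons)
  qed simp
qed simp

text \<open>Every walk between the two ends contracts to a path, which by uniqueness is this one; so
  no walk is shorter.\<close>

lemma graph_dist_path:
  assumes "distinct xs" "successively E xs" "xs \<noteq> []"
  shows "graph_dist E (hd xs) (last xs) = length xs - 1"
  unfolding graph_dist_def
proof (rule Least_equality)
  show "(E ^^ (length xs - 1)) (hd xs) (last xs)" using assms by (intro path_relpowp)
  fix n assume "(E ^^ n) (hd xs) (last xs)"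
  from relpowp_path[OF this] obtain ys where ys: "ys \<noteq> []" "hd ys = hd xs" "last ys = last xs"
    "distinct ys" "successively E ys" "length ys \<le> Suc n" by auto
  then have "xs = ys" using assms by (intro path_unique) auto
  then show "length xs - 1 \<le> n" using ys by simp
qed

lemma graph_dist_1: "graph_dist E x y = 1 \<Longrightarrow> E x y"
  using LeastI_ex[of "\<lambda>n. (E ^^ n) x y"] connected[of x y] unfolding graph_dist_def
  by (auto simp: rtranclp_power)

lemma graph_dist_self: "graph_dist E x x = 0"
  unfolding graph_dist_def by (rule Least_eq_0) simp

text \<open>In a tree the global distance condition becomes a local one, under which dropping or
  prepending a vertex is easily checked.\<close>

lemma geodesic_rays_iff:
  "\<gamma> \<in> geodesic_rays E \<longleftrightarrow> (\<forall>i. E (\<gamma> i) (\<gamma> (Suc i))) \<and> (\<forall>i. \<gamma> (Suc (Suc i)) \<noteq> \<gamma> i)"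
proof
  assume "\<gamma> \<in> geodesic_rays E"
  then have *: "graph_dist E (\<gamma> i) (\<gamma> (i + k)) = k" for i k by (simp add: geodesic_rays_def)
  show "(\<forall>i. E (\<gamma> i) (\<gamma> (Suc i))) \<and> (\<forall>i. \<gamma> (Suc (Suc i)) \<noteq> \<gamma> i)"
    using *[of _ 1] *[of _ 2] graph_dist_1 graph_dist_self by (metis Suc_eq_plus1 add_2_eq_Suc' zero_neq_numeral)
next
  assume *: "(\<forall>i. E (\<gamma> i) (\<gamma> (Suc i))) \<and> (\<forall>i. \<gamma> (Suc (Suc i)) \<noteq> \<gamma> i)"
  have "graph_dist E (\<gamma> i) (\<gamma> (i + k)) = k" for i k
  proof -
    have nb: "nonbacktracking E (map \<gamma> [i..<i + Suc k])" using * by (intro nonbacktracking_upt) auto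
    have "graph_dist E (hd (map \<gamma> [i..<i + Suc k])) (last (map \<gamma> [i..<i + Suc k])) = k"
      using graph_dist_path[OF distinct_if_nonbacktracking[OF nb] nonbacktracking_successively[OF nb]] by simp
    moreover have "hd (map \<gamma> [i..<i + Suc k]) = \<gamma> i" by (simp add: upt_conv_Cons hd_map del: upt_Suc)
    moreover have "last (map \<gamma> [i..<i + Suc k]) = \<gamma> (i + k)" by (simp add: last_map)
    ultimately show ?thesis by simp
  qed
  then show "\<gamma> \<in> geodesic_rays E" by (simp add: geodesic_rays_def)
qed

lemma ray_shift: "\<gamma> \<in> geodesic_rays E \<Longrightarrow> (\<lambda>i. \<gamma> (i + k)) \<in> geodesic_rays E"
  by (auto simp: geodesic_rays_iff)

lemma ray_cons:
  assumes "\<gamma> \<in> geodesic_rays E" "E y (\<gamma> 0)" "\<gamma> 1 \<noteq> y"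
  shows "case_nat y \<gamma> \<in> geodesic_rays E"
  using assms by (auto simp: geodesic_rays_iff split: nat.split)

text \<open>Uniqueness of the geodesic from a vertex to a boundary point: up to any index beyond the
  meeting point, the two rays are paths with the same ends.\<close>

lemma ray_eq:
  assumes "\<gamma> \<in> geodesic_rays E" "\<gamma>' \<in> geodesic_rays E" "\<gamma> 0 = \<gamma>' 0" "\<And>n. \<gamma> (i + n) = \<gamma>' (j + n)"
  shows "\<gamma> = \<gamma>'"
proof
  fix k
  have "graph_dist E (\<gamma> 0) (\<gamma> (0 + i)) = i" "graph_dist E (\<gamma>' 0) (\<gamma>' (0 + j)) = j"
    using assms(1,2) unfolding geodesic_rays_def by blast+
  \<comment> \<open>Both offsets are the distance from the common start to the common vertex reached
    at n = 0.\<close>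
  then have ij: "i = j" using assms(3) assms(4)[of 0] by simp
  have nb: "nonbacktracking E (map \<gamma> [0..<Suc (i + k)])" "nonbacktracking E (map \<gamma>' [0..<Suc (i + k)])"
    using nonbacktracking_upt[of E _ 0 "Suc (i + k)"] assms(1,2) by (auto simp: geodesic_rays_iff simp del: upt_Suc)
  have "map \<gamma> [0..<Suc (i + k)] = map \<gamma>' [0..<Suc (i + k)]"
  proof (rule path_unique)
    show "hd (map \<gamma> [0..<Suc (i + k)]) = hd (map \<gamma>' [0..<Suc (i + k)])"
      using assms(3) by (simp add: hd_map del: upt_Suc)
    show "last (map \<gamma> [0..<Suc (i + k)]) = last (map \<gamma>' [0..<Suc (i + k)])"
      using assms(4)[of k] ij by simp
  qed (use nb in \<open>auto dest: nonbacktracking_successively distinct_if_nonbacktracking simp del: upt_Suc\<close>)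
  then have "map \<gamma> [0..<Suc (i + k)] ! k = map \<gamma>' [0..<Suc (i + k)] ! k" by (rule arg_cong)
  then show "\<gamma> k = \<gamma>' k" by (simp del: upt_Suc)
qed

text \<open>Balls are finite by local finiteness and exhaust the tree. Countability makes the flow
  measure sigma-finite and its square discrete, so that Fubini's theorem applies freely.\<close>

lemma countable_vertices: "countable (UNIV :: 'v set)"
proof -
  fix x :: 'v
  have "finite {y. (E ^^ n) x y}" for n
  proof (induction n)
    case (Suc n)
    have "{y. (E ^^ Suc n) x y} = (\<Union>z\<in>{z. (E ^^ n) x z}. {y. E z y})" by auto
    then show ?case using Suc finite_nbhd by simp
  qed simp
  then have "countable (\<Union>n. {y. (E ^^ n) x y})" by (intro countable_UN) (auto intro: countable_finite)
  moreover have "(\<Union>n. {y. (E ^^ n) x y}) = UNIV" using connected[of x] by (auto simp: rtranclp_power)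
  ultimately show ?thesis by simp
qed

end

section \<open>Rays towards the fixed boundary point\<close>

locale rooted_tree = tree E for E :: "'v \<Rightarrow> 'v \<Rightarrow> bool" +
  fixes \<omega> :: "(nat \<Rightarrow> 'v) set"
  assumes boundary_point: "\<omega> \<in> tree_boundary E"
begin

text \<open>Membership is expressed relative to any member of the class, so that no fixed
  representative has to be carried along. The offsets of two cofinality relations simply add
  up.\<close>

lemma omega_cofinal:
  assumes "\<gamma> \<in> \<omega>"
  shows "\<gamma>' \<in> \<omega> \<longleftrightarrow> \<gamma>' \<in> geodesic_rays E \<and> (\<exists>i j. \<forall>n. \<gamma> (i + n) = \<gamma>' (j + n))"
proof -
  obtain \<gamma>0 where \<gamma>0: "\<omega> = cofinal_rays E `` {\<gamma>0}" "\<gamma>0 \<in> geodesic_rays E"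
    using boundary_point unfolding tree_boundary_def by (auto elim: quotientE)
  obtain i j where g: "\<gamma> \<in> geodesic_rays E" and ij: "\<And>n. \<gamma>0 (i + n) = \<gamma> (j + n)"
    using assms unfolding \<gamma>0(1) cofinal_rays_def by auto
  show ?thesis
  proof
    assume "\<gamma>' \<in> \<omega>"
    then obtain k l where g': "\<gamma>' \<in> geodesic_rays E" and kl: "\<And>n. \<gamma>0 (k + n) = \<gamma>' (l + n)"
      unfolding \<gamma>0(1) cofinal_rays_def by auto
    have "\<gamma> ((j + k) + n) = \<gamma>' ((l + i) + n)" for n
      using ij[of "k + n"] kl[of "i + n"] by (simp add: algebra_simps)
    then show "\<gamma>' \<in> geodesic_rays E \<and> (\<exists>i j. \<forall>n. \<gamma> (i + n) = \<gamma>' (j + n))" using g' by blast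
  next
    assume "\<gamma>' \<in> geodesic_rays E \<and> (\<exists>i j. \<forall>n. \<gamma> (i + n) = \<gamma>' (j + n))"
    then obtain k l where g': "\<gamma>' \<in> geodesic_rays E" and kl: "\<And>n. \<gamma> (k + n) = \<gamma>' (l + n)" by auto
    have "\<gamma>0 ((i + k) + n) = \<gamma>' ((l + j) + n)" for n
      using ij[of "k + n"] kl[of "j + n"] by (simp add: algebra_simps)
    then show "\<gamma>' \<in> \<omega>" using g' \<gamma>0 unfolding cofinal_rays_def by blast
  qed
qed

lemma omega_rays: "\<gamma> \<in> \<omega> \<Longrightarrow> \<gamma> \<in> geodesic_rays E"
  using omega_cofinal by blast

lemma omega_shift: 
  assumes "\<gamma> \<in> \<omega>"
  shows "(\<lambda>i. \<gamma> (i + k)) \<in> \<omega>"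
proof -
  have "\<forall>n. \<gamma> (k + n) = \<gamma> ((0 + n) + k)" by (simp add: add.commute)
  then show ?thesis
    unfolding omega_cofinal[OF assms] using ray_shift[OF omega_rays[OF assms]] by blast
qed

lemma omega_cons:
  assumes "\<gamma> \<in> \<omega>" "E y (\<gamma> 0)" "\<gamma> 1 \<noteq> y"
  shows "case_nat y \<gamma> \<in> \<omega>"
  unfolding omega_cofinal[OF assms(1)] using ray_cons[OF omega_rays[OF assms(1)] assms(2,3)]
  by (intro conjI exI[of _ 0] exI[of _ 1]) auto

text \<open>Move along a walk that leaves the start of some representative. For each edge, either
  the next vertex is already the second one of the ray, which is then shortened, or it can be
  prepended.\<close>

lemma ex_ray: "\<exists>\<gamma>\<in>\<omega>. \<gamma> 0 = x"
proof -
  obtain \<gamma>0 where "\<omega> = cofinal_rays E `` {\<gamma>0}" "\<gamma>0 \<in> geodesic_rays E"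
    using boundary_point unfolding tree_boundary_def by (auto elim: quotientE)
  then have \<gamma>0: "\<gamma>0 \<in> \<omega>" by (auto simp: cofinal_rays_def)
  show ?thesis using connected[of "\<gamma>0 0" x]
  proof (induction rule: rtranclp_induct)
    case base
    then show ?case using \<gamma>0 by auto
  next
    case (step y z)
    then obtain \<gamma> where \<gamma>: "\<gamma> \<in> \<omega>" "\<gamma> 0 = y" by auto
    show ?case
    proof (cases "\<gamma> 1 = z")
      case True
      then show ?thesis using omega_shift[OF \<gamma>(1), of 1] by force
    next
      case False
      then have "case_nat z \<gamma> \<in> \<omega>" using omega_cons[OF \<gamma>(1), of z] E_sym step(2) \<gamma> by simp
      then show ?thesis by (intro bexI[of _ "case_nat z \<gamma>"]) auto
    qed
  qed
qed

abbreviation p where "p \<equiv> predecessor E \<omega>"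

lemma predecessor_eq: 
  assumes "\<gamma> \<in> \<omega>"
  shows "p (\<gamma> 0) = \<gamma> 1"
  unfolding predecessor_def
proof (rule the_equality)
  fix y assume "\<exists>\<gamma>'\<in>\<omega>. \<gamma>' 0 = \<gamma> 0 \<and> \<gamma>' 1 = y"
  then obtain \<gamma>' where \<gamma>': "\<gamma>' \<in> \<omega>" "\<gamma> 0 = \<gamma>' 0" "\<gamma>' 1 = y" by auto
  from \<gamma>'(1) obtain i j where "\<And>n. \<gamma> (i + n) = \<gamma>' (j + n)" using omega_cofinal[OF assms] by blast
  then have "\<gamma> = \<gamma>'" using \<gamma>' assms omega_rays by (intro ray_eq) auto
  then show "y = \<gamma> 1" using \<gamma>' by simp
qed (use assms in auto)

text \<open>With this the graph disappears: successors are the fibres of the map \<open>p\<close>,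
  and the flow condition becomes a statement about \<open>p\<close> and m alone.\<close>

lemma successors_eq: "successors E \<omega> x = {y. p y = x}"
proof -
  obtain \<gamma> where \<gamma>: "\<gamma> \<in> \<omega>" "\<gamma> 0 = x" using ex_ray by blast
  have px: "p x = \<gamma> 1" using predecessor_eq \<gamma> by auto
  have "p y = x" if "E x y" "y \<noteq> p x" for y
    using predecessor_eq[OF omega_cons[OF \<gamma>(1), of y]] that \<gamma> px E_sym by auto
  moreover have "E x y" "y \<noteq> p x" if "p y = x" for y
  proof -
    obtain \<gamma>' where \<gamma>': "\<gamma>' \<in> \<omega>" "\<gamma>' 0 = y" using ex_ray by blast
    have "\<gamma>' 1 = x" using predecessor_eq[OF \<gamma>'(1)] \<gamma>'(2) that by simp
    \<comment> \<open>The ray from y passes through x and then through \<open>p x\<close>. As it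
      never turns back, y differs from \<open>p x\<close>.\<close>
    moreover have "p (\<gamma>' 1) = \<gamma>' 2"
      using predecessor_eq[OF omega_shift[OF \<gamma>'(1), of 1]] by (simp add: numeral_2_eq_2)
    moreover have "E (\<gamma>' 0) (\<gamma>' (Suc 0))" "\<gamma>' (Suc (Suc 0)) \<noteq> \<gamma>' 0"
      using omega_rays[OF \<gamma>'(1)] unfolding geodesic_rays_iff by blast+
    ultimately show "E x y" "y \<noteq> p x" using \<gamma>'(2) E_sym by (auto simp: numeral_2_eq_2)
  qed
  ultimately show ?thesis by (auto simp: successors_def)
qed

lemma finite_successors: "finite {y. p y = x}"
  using finite_subset[OF _ finite_nbhd[of x]] successors_eq[of x] by (auto simp: successors_def)

end

section \<open>Lebesgue spaces of a positive weight\<close>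

lemma Lp_space_2: "f \<in> Lp_space M 2 \<longleftrightarrow> f \<in> borel_measurable M \<and> integrable M (\<lambda>x. (cmod (f x))\<^sup>2)"
  and Lp_norm_2: "Lp_norm M 2 f = sqrt (LINT x|M. (cmod (f x))\<^sup>2)"
proof -
  have "(\<lambda>x. cmod (f x) powr 2) = (\<lambda>x. (cmod (f x))\<^sup>2)" by (auto simp: fun_eq_iff)
  then show "f \<in> Lp_space M 2 \<longleftrightarrow> f \<in> borel_measurable M \<and> integrable M (\<lambda>x. (cmod (f x))\<^sup>2)"
    "Lp_norm M 2 f = sqrt (LINT x|M. (cmod (f x))\<^sup>2)"
    by (simp_all add: Lp_space_def Lp_norm_def powr_half_sqrt integral_nonneg_AE)
qed

lemma mult_le_sum_squares: "0 \<le> a \<Longrightarrow> 0 \<le> b \<Longrightarrow> a * b \<le> a\<^sup>2 + (b::real)\<^sup>2"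
  using sum_squares_bound[of a b] mult_nonneg_nonneg[of a b] by linarith

text \<open>Every point has positive mass, so statements that hold almost everywhere hold
  everywhere, and a function is its own equivalence class.\<close>

locale positive_weight =
  fixes m :: "'v \<Rightarrow> real"
  assumes countable_UNIV: "countable (UNIV :: 'v set)" and m_pos [simp]: "m x > 0"
begin

abbreviation M where "M \<equiv> flow_measure m"

lemma m_nonneg [simp]: "m x \<ge> 0" and m_nonzero [simp]: "m x \<noteq> 0"
  using less_imp_le[OF m_pos] less_imp_neq[OF m_pos, of x] by auto

lemma space_M [simp]: "space M = UNIV" and sets_M [simp]: "sets M = UNIV"
  by (auto simp: flow_measure_def space_point_measure sets_point_measure)

lemma measurable_M [simp]: "f \<in> measurable M N \<longleftrightarrow> range f \<subseteq> space N"
  by (auto simp: measurable_def)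

lemma emeasure_singleton [simp]: "emeasure M {x} = m x"
  unfolding flow_measure_def by (subst emeasure_point_measure_finite2) auto

lemma measure_singleton [simp]: "measure M {x} = m x"
  by (simp add: measure_def)

lemma AE_M [simp]: "(AE x in M. P x) \<longleftrightarrow> (\<forall>x. P x)"
  unfolding flow_measure_def by (subst AE_point_measure) simp

sublocale sigma_finite_measure M
proof
  show "\<exists>A. countable A \<and> A \<subseteq> sets M \<and> \<Union> A = space M \<and> (\<forall>a\<in>A. emeasure M a \<noteq> \<infinity>)"
    using countable_UNIV by (intro exI[of _ "range (\<lambda>x. {x})"]) auto
qed

sublocale pair: pair_sigma_finite M M ..

text \<open>Every subset of the square is measurable, so kernels need no measurability
  argument.\<close>

lemma sets_pair [simp]: "sets (M \<Otimes>\<^sub>M M) = UNIV"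
proof -
  have "sets (M \<Otimes>\<^sub>M M) = sets (count_space UNIV \<Otimes>\<^sub>M count_space UNIV)"
    by (intro sets_pair_measure_cong) auto
  also have "\<dots> = UNIV" using countable_UNIV by (subst pair_measure_countable) auto
  finally show ?thesis .
qed

lemma measurable_pair [simp]: "f \<in> measurable (M \<Otimes>\<^sub>M M) N \<longleftrightarrow> range f \<subseteq> space N"
  by (auto simp: measurable_def space_pair_measure)

text \<open>Integrals control point values. This bounds the entries of a kernel by its row masses
  and turns convergence in the mean into pointwise convergence.\<close>

lemma integral_ge_point:
  fixes f :: "'v \<Rightarrow> real"
  assumes "integrable M f" "\<And>x. f x \<ge> 0"
  shows "f x * m x \<le> (LINT x|M. f x)"
proof -
  have "f x * m x = (LINT y|M. f x * indicator {x} y)" by simp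
  also have "\<dots> \<le> (LINT x|M. f x)"
  proof (rule integral_mono)
    show "integrable M (\<lambda>y. f x * indicator {x} y)"
      by (intro integrable_mult_right integrable_real_indicator) auto
  qed (use assms in \<open>auto simp: indicator_def\<close>)
  finally show ?thesis .
qed

lemma integral_singleton_support:
  fixes f :: "'v \<Rightarrow> complex"
  shows "(LINT y|M. f y * indicator {x} y) = f x * m x"
proof -
  have "(LINT y|M. f y * indicator {x} y) = (LINT y|M. indicator {x} y *\<^sub>R f x)"
    by (intro Bochner_Integration.integral_cong) (auto simp: indicator_def)
  then show ?thesis by (simp add: scaleR_conv_of_real)
qed

section \<open>Lebesgue norms and the pairing\<close>

lemma Lp_finite_iff:
  "0 \<le> r \<Longrightarrow> f \<in> Lp_space M (ennreal r) \<longleftrightarrow> integrable M (\<lambda>x. cmod (f x) powr r)"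
  by (simp add: Lp_space_def)

lemma Lp_norm_finite:
  "0 \<le> r \<Longrightarrow> Lp_norm M (ennreal r) f = (LINT x|M. cmod (f x) powr r) powr (1 / r)"
  by (simp add: Lp_norm_def)

lemma Lp_norm_nonneg [simp]: "Lp_norm N p f \<ge> 0"
  by (simp add: Lp_norm_def)

lemma Linf_I:
  assumes "\<And>x. cmod (f x) \<le> c"
  shows "f \<in> Lp_space M top" "Lp_norm M top f \<le> c"
proof -
  have "0 \<le> c" using assms[of undefined] by (meson norm_ge_zero order_trans)
  have *: "esssup M (\<lambda>x. ennreal (cmod (f x))) \<le> ennreal c"
    using assms by (intro esssup_I) (auto intro: ennreal_leI)
  show "f \<in> Lp_space M top" using le_less_trans[OF *] by (simp add: Lp_space_def)
  have "enn2real (esssup M (\<lambda>x. ennreal (cmod (f x)))) \<le> enn2real (ennreal c)"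
    using * by (intro enn2real_mono) auto
  then show "Lp_norm M top f \<le> c" using \<open>0 \<le> c\<close> by (simp add: Lp_norm_def)
qed

lemma Linf_bound:
  assumes "f \<in> Lp_space M top"
  shows "cmod (f x) \<le> Lp_norm M top f"
proof -
  have *: "esssup M (\<lambda>x. ennreal (cmod (f x))) < top" using assms by (simp add: Lp_space_def)
  have "ennreal (cmod (f x)) \<le> esssup M (\<lambda>x. ennreal (cmod (f x)))"
    using esssup_AE[where M = M and f = "\<lambda>x. ennreal (cmod (f x))"] by simp
  then have "enn2real (ennreal (cmod (f x))) \<le> enn2real (esssup M (\<lambda>x. ennreal (cmod (f x))))"
    using * by (intro enn2real_mono) auto
  then show ?thesis by (simp add: Lp_norm_def)
qed

lemma L2_iff: "f \<in> Lp_space M 2 \<longleftrightarrow> integrable M (\<lambda>x. (cmod (f x))\<^sup>2)"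
  by (simp add: Lp_space_2)

lemma L1_iff: "f \<in> Lp_space M 1 \<longleftrightarrow> integrable M f"
  using Lp_finite_iff[of 1 f] integrable_norm_iff[of f M] by simp

lemma L1_norm: "Lp_norm M 1 f = (LINT x|M. cmod (f x))"
proof -
  have "Lp_norm M 1 f = \<bar>LINT x|M. cmod (f x)\<bar>"
    using Lp_norm_finite[of 1 f] by simp
  then show ?thesis by simp
qed

lemma integrable_L2_mult:
  assumes "f \<in> Lp_space M 2" "g \<in> Lp_space M 2"
  shows "integrable M (\<lambda>x. f x * cnj (g x))"
proof (rule Bochner_Integration.integrable_bound)
  show "integrable M (\<lambda>x. (cmod (f x))\<^sup>2 + (cmod (g x))\<^sup>2)"
    using assms by (simp add: L2_iff)
  have "cmod (f x) * cmod (g x) \<le> (cmod (f x))\<^sup>2 + (cmod (g x))\<^sup>2" for x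
    by (rule mult_le_sum_squares) auto
  then show "AE x in M. norm (f x * cnj (g x)) \<le> norm ((cmod (f x))\<^sup>2 + (cmod (g x))\<^sup>2)"
    by (simp add: norm_mult)
qed simp

lemma L2_add: 
  assumes "f \<in> Lp_space M 2" "g \<in> Lp_space M 2"
  shows "(\<lambda>x. f x + g x) \<in> Lp_space M 2"
  unfolding L2_iff
proof (rule Bochner_Integration.integrable_bound)
  show "integrable M (\<lambda>x. 2 * (cmod (f x))\<^sup>2 + 2 * (cmod (g x))\<^sup>2)"
    using assms by (simp add: L2_iff)
  have "(cmod (f x + g x))\<^sup>2 \<le> 2 * (cmod (f x))\<^sup>2 + 2 * (cmod (g x))\<^sup>2" for x
  proof -
    have "(cmod (f x + g x))\<^sup>2 \<le> (cmod (f x) + cmod (g x))\<^sup>2"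
      by (intro power_mono norm_triangle_ineq) auto
    also have "\<dots> \<le> 2 * (cmod (f x))\<^sup>2 + 2 * (cmod (g x))\<^sup>2"
      using sum_squares_bound[of "cmod (f x)" "cmod (g x)"] by (simp add: power2_sum)
    finally show ?thesis .
  qed
  then show "AE x in M. norm ((cmod (f x + g x))\<^sup>2) \<le> norm (2 * (cmod (f x))\<^sup>2 + 2 * (cmod (g x))\<^sup>2)"
    by simp
qed simp

lemma L2_cmult: "f \<in> Lp_space M 2 \<Longrightarrow> (\<lambda>x. c * f x) \<in> Lp_space M 2"
  by (simp add: L2_iff norm_mult power_mult_distrib)

lemma L2_diff: "f \<in> Lp_space M 2 \<Longrightarrow> g \<in> Lp_space M 2 \<Longrightarrow> (\<lambda>x. f x - g x) \<in> Lp_space M 2"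
  using L2_add[of f "\<lambda>x. (-1) * g x"] L2_cmult[of g "-1"] by simp

lemma pairing_self: "pairing M f f = of_real ((Lp_norm M 2 f)\<^sup>2)"
proof -
  have "pairing M f f = (LINT x|M. complex_of_real ((cmod (f x))\<^sup>2))"
    unfolding pairing_def by (simp add: complex_norm_square del: of_real_power)
  then show ?thesis by (simp add: Lp_norm_2 del: of_real_power)
qed

lemma pairing_cnj: "cnj (pairing M f g) = pairing M g f"
  unfolding pairing_def by (subst Bochner_Integration.integral_cnj [symmetric]) (simp add: mult.commute)

lemma pairing_add_left:
  "f \<in> Lp_space M 2 \<Longrightarrow> g \<in> Lp_space M 2 \<Longrightarrow> h \<in> Lp_space M 2 \<Longrightarrow>
     pairing M (\<lambda>x. f x + g x) h = pairing M f h + pairing M g h"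
  unfolding pairing_def using integrable_L2_mult[of f h] integrable_L2_mult[of g h]
  by (simp add: distrib_right)

lemma pairing_cmult_left: "pairing M (\<lambda>x. c * f x) h = c * pairing M f h"
  unfolding pairing_def by (simp add: mult.assoc)

lemma pairing_diff_left:
  "f \<in> Lp_space M 2 \<Longrightarrow> g \<in> Lp_space M 2 \<Longrightarrow> h \<in> Lp_space M 2 \<Longrightarrow>
     pairing M (\<lambda>x. f x - g x) h = pairing M f h - pairing M g h"
  unfolding pairing_def using integrable_L2_mult[of f h] integrable_L2_mult[of g h]
  by (simp add: left_diff_distrib)

lemma pairing_add_right:
  "f \<in> Lp_space M 2 \<Longrightarrow> g \<in> Lp_space M 2 \<Longrightarrow> h \<in> Lp_space M 2 \<Longrightarrow>
     pairing M h (\<lambda>x. f x + g x) = pairing M h f + pairing M h g"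
  using pairing_add_left[of f g h] pairing_cnj by (metis complex_cnj_add)

lemma pairing_cmult_right: "pairing M h (\<lambda>x. c * f x) = cnj c * pairing M h f"
  using pairing_cmult_left[of c f h] pairing_cnj by (metis complex_cnj_mult)

text \<open>Arithmetic and geometric means in place of the Cauchy-Schwarz inequality. The factor 1/2
  is just good enough to place the spectrum of the Laplacian in [0, 2].\<close>

lemma pairing_bound:
  assumes "f \<in> Lp_space M 2" "g \<in> Lp_space M 2"
  shows "cmod (pairing M f g) \<le> ((Lp_norm M 2 f)\<^sup>2 + (Lp_norm M 2 g)\<^sup>2) / 2"
proof -
  have i: "integrable M (\<lambda>x. (cmod (f x))\<^sup>2)" "integrable M (\<lambda>x. (cmod (g x))\<^sup>2)"
    using assms by (simp_all add: L2_iff)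
  have "cmod (pairing M f g) \<le> (LINT x|M. cmod (f x * cnj (g x)))"
    unfolding pairing_def by (rule integral_norm_bound)
  also have "\<dots> \<le> (LINT x|M. ((cmod (f x))\<^sup>2 + (cmod (g x))\<^sup>2) / 2)"
  proof (rule integral_mono)
    show "integrable M (\<lambda>x. cmod (f x * cnj (g x)))"
      using integrable_L2_mult[OF assms] by (rule integrable_norm)
    show "cmod (f x * cnj (g x)) \<le> ((cmod (f x))\<^sup>2 + (cmod (g x))\<^sup>2) / 2" for x
      using sum_squares_bound[of "cmod (f x)" "cmod (g x)"] by (simp add: norm_mult)
  qed (use i in auto)
  also have "\<dots> = ((Lp_norm M 2 f)\<^sup>2 + (Lp_norm M 2 g)\<^sup>2) / 2"
    using i by (simp add: Lp_norm_2)
  finally show ?thesis .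
qed

lemma delta_Lp: "0 < r \<Longrightarrow> indicator {x} \<in> Lp_space M (ennreal r)"
proof (subst Lp_finite_iff)
  assume "0 < r"
  then have "(\<lambda>y. cmod (indicator {x} y) powr r) = indicator {x}" by (auto simp: indicator_def)
  then show "integrable M (\<lambda>y. cmod (indicator {x} y) powr r)" by simp
qed simp

text \<open>Testing against point masses recovers a function; this gives uniqueness in the definite
  descriptions of the functional calculus and of the adjoint.\<close>

lemma pairing_delta: "pairing M f (indicator {x}) = f x * m x"
proof -
  have "pairing M f (indicator {x}) = (LINT y|M. f y * indicator {x} y)"
    unfolding pairing_def by (intro Bochner_Integration.integral_cong) (auto simp: indicator_def)
  then show ?thesis by (simp add: integral_singleton_support)
qed

end

section \<open>Symmetric kernels\<close>

text \<open>A convex power lies above its tangent at c. This is Young's inequality for the exponents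
  r and r / (r - 1).\<close>

lemma powr_tangent:
  fixes t c r :: real
  assumes "r \<ge> 1" "t \<ge> 0" "c > 0"
  shows "r * c powr (r - 1) * t \<le> t powr r + (r - 1) * c powr r"
proof (cases "r = 1")
  case False
  define q where "q = r / (r - 1)"
  have r: "r > 1" and q: "q > 1" "1 / r + 1 / q = 1"
    using assms False by (auto simp: q_def field_simps)
  have "t * c powr (r - 1) \<le> t powr r / r + (c powr (r - 1)) powr q / q"
    using Youngs_inequality[of r q t "c powr (r - 1)"] r q assms by auto
  also have "(c powr (r - 1)) powr q = c powr r" using r by (simp add: powr_powr q_def)
  finally have "r * (t * c powr (r - 1)) \<le> r * (t powr r / r + c powr r / q)"
    using r by (intro mult_left_mono) auto
  also have "\<dots> = t powr r + (r - 1) * c powr r" using r by (simp add: q_def field_simps)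
  finally show ?thesis by (simp add: mult_ac)
qed (use assms in simp)

section \<open>Schur's test\<close>

context positive_weight
begin

definition kernel_op :: "('v \<Rightarrow> 'v \<Rightarrow> complex) \<Rightarrow> ('v \<Rightarrow> complex) \<Rightarrow> 'v \<Rightarrow> complex" where
  "kernel_op k f x = (LINT y|M. k x y * f y)"

text \<open>Symmetry turns the row bound into a column bound, so a single constant serves all
  exponents. It is symmetry without conjugation: the adjoint operator has the conjugate
  kernel.\<close>

definition schur_kernel :: "real \<Rightarrow> ('v \<Rightarrow> 'v \<Rightarrow> complex) \<Rightarrow> bool" where
  "schur_kernel B k \<longleftrightarrow> (\<forall>x y. k x y = k y x) \<and> 0 \<le> B \<and>
     (\<forall>x. (\<integral>\<^sup>+y. cmod (k x y) \<partial>M) \<le> ennreal B)"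

lemma schur_kernelD:
  assumes "schur_kernel B k"
  shows "k x y = k y x" "0 \<le> B" "(\<integral>\<^sup>+y. cmod (k x y) \<partial>M) \<le> ennreal B"
    "integrable M (k x)" "(LINT y|M. cmod (k x y)) \<le> B" "cmod (k x y) \<le> B / m x"
proof -
  show 1: "0 \<le> B" and *: "(\<integral>\<^sup>+y. cmod (k x y) \<partial>M) \<le> ennreal B" and sym: "k x y = k y x" for x y
    using assms by (auto simp: schur_kernel_def)
  show i: "integrable M (k x)" for x
    using le_less_trans[OF *[of x]] by (intro integrableI_bounded) auto
  show i2: "(LINT y|M. cmod (k x y)) \<le> B" for x
    using nn_integral_eq_integral[OF integrable_norm[OF i[of x]]] *[of x] 1 by simp
  have "cmod (k y x) * m x \<le> B"
    using integral_ge_point[OF integrable_norm[OF i], of y x] i2[of y] by simp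
  then show "cmod (k x y) \<le> B / m x" by (simp add: field_simps sym[of x y])
qed

lemma kernel_op_Linf:
  assumes "schur_kernel B k" "f \<in> Lp_space M top"
  shows "integrable M (\<lambda>y. k x y * f y)"
    and "kernel_op k f \<in> Lp_space M top" and "Lp_norm M top (kernel_op k f) \<le> B * Lp_norm M top f"
proof -
  note k = schur_kernelD[OF assms(1)] and b = Linf_bound[OF assms(2)]
  let ?N = "Lp_norm M top f"
  have bound: "cmod (k x y * f y) \<le> ?N * cmod (k x y)" for x y
    using b[of y] by (simp add: norm_mult mult.commute[of ?N] mult_left_mono)
  show i: "integrable M (\<lambda>y. k x y * f y)" for x
    by (rule Bochner_Integration.integrable_bound[of _ "\<lambda>y. ?N * cmod (k x y)"])
       (use k(4)[of x] bound in \<open>auto simp: abs_mult\<close>)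
  have *: "cmod (kernel_op k f x) \<le> B * ?N" for x
  proof -
    have "cmod (kernel_op k f x) \<le> (LINT y|M. cmod (k x y * f y))"
      unfolding kernel_op_def by (rule integral_norm_bound)
    also have "\<dots> \<le> (LINT y|M. ?N * cmod (k x y))"
      by (intro integral_mono integrable_norm i) (use k(4)[of x] bound in auto)
    also have "\<dots> \<le> ?N * B" using k(5)[of x] by (simp add: mult_left_mono)
    finally show ?thesis by (simp add: mult.commute)
  qed
  from Linf_I[OF *] show "kernel_op k f \<in> Lp_space M top" and "Lp_norm M top (kernel_op k f) \<le> B * ?N"
    by auto
qed

text \<open>Jensen's inequality for the measures \<open>\<bar>k x y\<bar> dM(y)\<close>, obtained by integrating \<open>powr_tangent\<close> at
  the mean value; integration in \<open>x\<close> then gives Schur's test.\<close>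
lemma schur_kernel_pointwise:
  assumes k: "schur_kernel B k" and r: "r \<ge> 1" and f: "f \<in> Lp_space M (ennreal r)"
  shows "integrable M (\<lambda>y. k x y * f y)"
    and "integrable M (\<lambda>y. cmod (k x y) * cmod (f y) powr r)"
    and "cmod (kernel_op k f x) powr r \<le> B powr (r - 1) * (LINT y|M. cmod (k x y) * cmod (f y) powr r)"
proof -
  note kD = schur_kernelD[OF k]
  have f': "integrable M (\<lambda>y. cmod (f y) powr r)" using f r by (simp add: Lp_finite_iff)
  show J: "integrable M (\<lambda>y. cmod (k x y) * cmod (f y) powr r)"
  proof (rule Bochner_Integration.integrable_bound)
    show "integrable M (\<lambda>y. B / m x * cmod (f y) powr r)" using f' by simp
    show "AE y in M. norm (cmod (k x y) * cmod (f y) powr r) \<le> norm (B / m x * cmod (f y) powr r)"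
    proof -
      have "cmod (k x y) * cmod (f y) powr r \<le> B / m x * cmod (f y) powr r" for y
        using kD(6)[of x] by (intro mult_right_mono) auto
      then show ?thesis using kD(2) by (simp add: abs_mult)
    qed
  qed simp
  show I: "integrable M (\<lambda>y. k x y * f y)"
  proof (rule Bochner_Integration.integrable_bound)
    show "integrable M (\<lambda>y. cmod (k x y) + cmod (k x y) * cmod (f y) powr r)"
      using J kD(4)[of x] by simp
    have "t \<le> 1 + t powr r" if "t \<ge> 0" for t :: real
    proof (cases "t \<le> 1")
      case False
      then have "t powr 1 \<le> t powr r" using r by (intro powr_mono) auto
      then show ?thesis using False by simp
    qed (use add_increasing2[of "t powr r" t 1] in auto)
    then have "cmod (k x y) * cmod (f y) \<le> cmod (k x y) * (1 + cmod (f y) powr r)" for y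
      by (intro mult_left_mono) auto
    then show "AE y in M. norm (k x y * f y) \<le> norm (cmod (k x y) + cmod (k x y) * cmod (f y) powr r)"
      by (simp add: norm_mult distrib_left)
  qed simp
  define a where "a = (LINT y|M. cmod (k x y) * cmod (f y))"
  define b where "b = (LINT y|M. cmod (k x y) * cmod (f y) powr r)"
  have a0: "a \<ge> 0" unfolding a_def by (rule integral_nonneg_AE) auto
  have le: "cmod (kernel_op k f x) \<le> a"
    unfolding kernel_op_def a_def
    by (rule order_trans[OF integral_norm_bound]) (simp add: norm_mult)
  have "a powr r \<le> B powr (r - 1) * b"
  proof (cases "a = 0 \<or> B = 0")
    case True
    have "a = 0"
    proof (cases "a = 0")
      case False
      then have "k x y = 0" for y using True kD(6)[of x y] by auto
      then show ?thesis by (simp add: a_def)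
    qed
    then show ?thesis using r by (auto simp: b_def intro!: mult_nonneg_nonneg integral_nonneg_AE)
  next
    case False
    then have a: "a > 0" and B: "B > 0" using a0 kD(2) by auto
    \<comment> \<open>B is only an upper bound for the mass of the row, so this is the mean value up
      to a factor. The mass enters the last term of the tangent inequality with a nonnegative
      coefficient, so replacing it by B is harmless.\<close>
    define c where "c = a / B"
    have c: "c > 0" using a B by (simp add: c_def)
    have "r * c powr (r - 1) * a = (LINT y|M. r * c powr (r - 1) * (cmod (k x y) * cmod (f y)))"
      by (simp add: a_def)
    also have "\<dots> \<le> (LINT y|M. cmod (k x y) * cmod (f y) powr r + (r - 1) * c powr r * cmod (k x y))"
    proof (rule integral_mono)
      show "integrable M (\<lambda>y. r * c powr (r - 1) * (cmod (k x y) * cmod (f y)))"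
        using integrable_norm[OF I] by (simp add: norm_mult)
      show "integrable M (\<lambda>y. cmod (k x y) * cmod (f y) powr r + (r - 1) * c powr r * cmod (k x y))"
        using J kD(4)[of x] by auto
      show "r * c powr (r - 1) * (cmod (k x y) * cmod (f y))
          \<le> cmod (k x y) * cmod (f y) powr r + (r - 1) * c powr r * cmod (k x y)" for y
        using mult_left_mono[OF powr_tangent[OF r _ c, of "cmod (f y)"], of "cmod (k x y)"]
        by (simp add: algebra_simps)
    qed
    also have "\<dots> = b + (r - 1) * c powr r * (LINT y|M. cmod (k x y))"
      using J kD(4)[of x] by (simp add: b_def)
    also have "\<dots> \<le> b + (r - 1) * c powr r * B"
      using kD(5)[of x] r by (intro add_left_mono mult_left_mono) auto
    finally have "r * c powr (r - 1) * a \<le> b + (r - 1) * c powr r * B" .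
    moreover have "c powr (r - 1) * a = c powr r * B"
      using c B by (simp add: powr_diff c_def field_simps)
    then have "r * c powr (r - 1) * a = r * (c powr r * B)" by (simp add: mult.assoc)
    ultimately have "r * (c powr r * B) \<le> b + (r - 1) * c powr r * B" by simp
    then have "c powr r * B \<le> b" by (simp add: algebra_simps)
    moreover have "a powr r = B powr (r - 1) * (c powr r * B)"
      using a B by (simp add: c_def powr_divide powr_diff)
    ultimately show ?thesis by (simp add: mult_left_mono)
  qed
  then show "cmod (kernel_op k f x) powr r \<le> B powr (r - 1) * (LINT y|M. cmod (k x y) * cmod (f y) powr r)"
    using powr_mono2[of r, OF _ _ le] r unfolding b_def by simp
qed

lemma schur_kernel_nn:
  assumes k: "schur_kernel B k"
  shows "(\<integral>\<^sup>+x. \<integral>\<^sup>+y. ennreal (cmod (k x y)) * g y \<partial>M \<partial>M) \<le> ennreal B * (\<integral>\<^sup>+y. g y \<partial>M)"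
proof -
  note kD = schur_kernelD[OF k]
  have "(\<integral>\<^sup>+x. \<integral>\<^sup>+y. ennreal (cmod (k x y)) * g y \<partial>M \<partial>M) 
     = (\<integral>\<^sup>+y. \<integral>\<^sup>+x. ennreal (cmod (k x y)) * g y \<partial>M \<partial>M)"
    using pair.Fubini'[of "\<lambda>x y. ennreal (cmod (k x y)) * g y"] by simp
  also have "\<dots> = (\<integral>\<^sup>+y. (\<integral>\<^sup>+x. ennreal (cmod (k y x)) \<partial>M) * g y \<partial>M)"
    by (simp add: nn_integral_multc kD(1)[of _ y for y])
  also have "\<dots> \<le> (\<integral>\<^sup>+y. ennreal B * g y \<partial>M)"
    using kD(3) by (intro nn_integral_mono mult_right_mono) auto
  also have "\<dots> = ennreal B * (\<integral>\<^sup>+y. g y \<partial>M)" by (simp add: nn_integral_cmult)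
  finally show ?thesis .
qed

lemma kernel_op_Lp:
  assumes k: "schur_kernel B k" and r: "r \<ge> 1" and f: "f \<in> Lp_space M (ennreal r)"
  shows "kernel_op k f \<in> Lp_space M (ennreal r)"
    and "Lp_norm M (ennreal r) (kernel_op k f) \<le> B * Lp_norm M (ennreal r) f"
proof -
  note kD = schur_kernelD[OF k] and P = schur_kernel_pointwise[OF k r f]
  define I where "I = (LINT y|M. cmod (f y) powr r)"
  have f': "integrable M (\<lambda>y. cmod (f y) powr r)" using f r by (simp add: Lp_finite_iff)
  have I: "I \<ge> 0" "(\<integral>\<^sup>+y. cmod (f y) powr r \<partial>M) = ennreal I"
    using nn_integral_eq_integral[OF f'] by (auto simp: I_def intro!: integral_nonneg_AE)
  have "(\<integral>\<^sup>+x. cmod (kernel_op k f x) powr r \<partial>M)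
     \<le> (\<integral>\<^sup>+x. ennreal (B powr (r - 1)) * (\<integral>\<^sup>+y. ennreal (cmod (k x y)) * ennreal (cmod (f y) powr r) \<partial>M) \<partial>M)"
  proof (intro nn_integral_mono)
    fix x
    have "(\<integral>\<^sup>+y. ennreal (cmod (k x y)) * ennreal (cmod (f y) powr r) \<partial>M)
        = ennreal (LINT y|M. cmod (k x y) * cmod (f y) powr r)"
      using nn_integral_eq_integral[OF P(2)[of x]] by (simp add: ennreal_mult)
    then show "ennreal (cmod (kernel_op k f x) powr r)
       \<le> ennreal (B powr (r - 1)) * (\<integral>\<^sup>+y. ennreal (cmod (k x y)) * ennreal (cmod (f y) powr r) \<partial>M)"
      using P(3)[of x] by (simp add: ennreal_mult'[symmetric] ennreal_leI)
  qed
  also have "\<dots> \<le> ennreal (B powr (r - 1)) * (ennreal B * ennreal I)"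
    by (subst nn_integral_cmult) (auto intro!: mult_left_mono schur_kernel_nn[OF k, THEN order_trans] simp: I)
  also have "\<dots> = ennreal (B powr r * I)"
  proof (cases "B = 0")
    case False
    then have "B powr (r - 1) * B = B powr r" using kD(2) by (simp add: powr_diff)
    then show ?thesis using I kD(2) by (simp add: ennreal_mult'[symmetric] mult.assoc[symmetric])
  qed simp
  finally have *: "(\<integral>\<^sup>+x. cmod (kernel_op k f x) powr r \<partial>M) \<le> ennreal (B powr r * I)" .
  then have i: "integrable M (\<lambda>x. cmod (kernel_op k f x) powr r)"
    using le_less_trans[OF *] by (intro integrableI_bounded) auto
  then show "kernel_op k f \<in> Lp_space M (ennreal r)" using r by (simp add: Lp_finite_iff)
  have "(LINT x|M. cmod (kernel_op k f x) powr r) \<le> B powr r * I"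
    using * I nn_integral_eq_integral[OF i] by simp
  then have "(LINT x|M. cmod (kernel_op k f x) powr r) powr (1 / r) \<le> (B powr r * I) powr (1 / r)"
    using r by (intro powr_mono2) (auto intro!: integral_nonneg_AE)
  also have "\<dots> = B * I powr (1 / r)"
    using r I kD(2) by (simp add: powr_mult powr_powr)
  finally show "Lp_norm M (ennreal r) (kernel_op k f) \<le> B * Lp_norm M (ennreal r) f"
    using r by (simp add: Lp_norm_finite I_def)
qed

text \<open>Fubini's theorem under absolute convergence of the double integral; square integrable
  pairs and bounded-integrable pairs supply that hypothesis in different ways.\<close>

lemma kernel_op_swap:
  assumes k: "schur_kernel B k"
    and fin: "(\<integral>\<^sup>+x. \<integral>\<^sup>+y. ennreal (cmod (k x y)) * ennreal (cmod (f y) * cmod (g x)) \<partial>M \<partial>M) < \<infinity>"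
  shows "pairing M (kernel_op k f) g = pairing M f (kernel_op (\<lambda>x y. cnj (k x y)) g)"
proof -
  note kD = schur_kernelD[OF k]
  have int: "integrable (M \<Otimes>\<^sub>M M) (\<lambda>(x, y). k x y * f y * cnj (g x))"
  proof (rule integrableI_bounded)
    have "(\<integral>\<^sup>+z. ennreal (norm (case z of (x, y) \<Rightarrow> k x y * f y * cnj (g x))) \<partial>(M \<Otimes>\<^sub>M M))
       = (\<integral>\<^sup>+x. \<integral>\<^sup>+y. ennreal (cmod (k x y)) * ennreal (cmod (f y) * cmod (g x)) \<partial>M \<partial>M)"
      by (subst nn_integral_fst[symmetric]) (auto simp: norm_mult ennreal_mult mult.assoc)
    then show "(\<integral>\<^sup>+z. ennreal (norm (case z of (x, y) \<Rightarrow> k x y * f y * cnj (g x))) \<partial>(M \<Otimes>\<^sub>M M)) < \<infinity>"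
      using fin by simp
  qed simp
  have "pairing M (kernel_op k f) g = (LINT x|M. LINT y|M. k x y * f y * cnj (g x))"
    unfolding pairing_def kernel_op_def by simp
  also have "\<dots> = (LINT y|M. LINT x|M. k x y * f y * cnj (g x))"
    using pair.Fubini_integral[OF int] by simp
  also have "\<dots> = (LINT y|M. f y * (LINT x|M. k y x * cnj (g x)))"
  proof (intro Bochner_Integration.integral_cong refl)
    fix y
    have "(LINT x|M. k x y * f y * cnj (g x)) = (LINT x|M. f y * (k y x * cnj (g x)))"
      by (intro Bochner_Integration.integral_cong refl) (simp add: kD(1)[of _ y])
    then show "(LINT x|M. k x y * f y * cnj (g x)) = f y * (LINT x|M. k y x * cnj (g x))"
      by simp
  qed
  also have "\<dots> = pairing M f (kernel_op (\<lambda>x y. cnj (k x y)) g)"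
  proof -
    have "cnj (LINT x|M. cnj (k y x) * g x) = (LINT x|M. k y x * cnj (g x))" for y
      by (subst Bochner_Integration.integral_cnj [symmetric]) simp
    then show ?thesis unfolding pairing_def kernel_op_def by simp
  qed
  finally show ?thesis .
qed

text \<open>For absolute convergence the product of the two functions is replaced by the sum of
  their squares; one square meets the columns of the kernel, the other its rows.\<close>

lemma kernel_op_adjoint_L2:
  assumes k: "schur_kernel B k" and f: "f \<in> Lp_space M 2" and g: "g \<in> Lp_space M 2"
  shows "pairing M (kernel_op k f) g = pairing M f (kernel_op (\<lambda>x y. cnj (k x y)) g)"
proof (rule kernel_op_swap[OF k])
  note kD = schur_kernelD[OF k]
  have fg: "(\<integral>\<^sup>+x. ennreal ((cmod (h x))\<^sup>2) \<partial>M) < \<infinity>" if "h \<in> Lp_space M 2" for h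
    using that nn_integral_eq_integral[of M "\<lambda>x. (cmod (h x))\<^sup>2"] by (simp add: L2_iff)
  have "(\<integral>\<^sup>+x. \<integral>\<^sup>+y. ennreal (cmod (k x y)) * ennreal (cmod (f y) * cmod (g x)) \<partial>M \<partial>M)
    \<le> (\<integral>\<^sup>+x. \<integral>\<^sup>+y. ennreal (cmod (k x y)) * ennreal ((cmod (f y))\<^sup>2)
          + ennreal (cmod (k x y)) * ennreal ((cmod (g x))\<^sup>2) \<partial>M \<partial>M)"
  proof (intro nn_integral_mono)
    fix x y
    have "cmod (f y) * cmod (g x) \<le> (cmod (f y))\<^sup>2 + (cmod (g x))\<^sup>2"
      by (rule mult_le_sum_squares) auto
    then show "ennreal (cmod (k x y)) * ennreal (cmod (f y) * cmod (g x))
      \<le> ennreal (cmod (k x y)) * ennreal ((cmod (f y))\<^sup>2) + ennreal (cmod (k x y)) * ennreal ((cmod (g x))\<^sup>2)"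
      unfolding distrib_left[symmetric]
      by (intro mult_left_mono) (auto simp: ennreal_plus[symmetric] simp del: ennreal_plus intro!: ennreal_leI)
  qed
  also have "\<dots> = (\<integral>\<^sup>+x. \<integral>\<^sup>+y. ennreal (cmod (k x y)) * ennreal ((cmod (f y))\<^sup>2) \<partial>M \<partial>M)
     + (\<integral>\<^sup>+x. (\<integral>\<^sup>+y. ennreal (cmod (k x y)) \<partial>M) * ennreal ((cmod (g x))\<^sup>2) \<partial>M)"
    by (simp add: nn_integral_add nn_integral_multc)
  also have "\<dots> \<le> ennreal B * (\<integral>\<^sup>+y. ennreal ((cmod (f y))\<^sup>2) \<partial>M) + (\<integral>\<^sup>+x. ennreal B * ennreal ((cmod (g x))\<^sup>2) \<partial>M)"
    using kD(3) by (intro add_mono schur_kernel_nn[OF k] nn_integral_mono mult_right_mono) auto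
  also have "\<dots> < \<infinity>"
    using fg[OF f] fg[OF g] by (simp add: nn_integral_cmult ennreal_mult_less_top)
  finally show "(\<integral>\<^sup>+x. \<integral>\<^sup>+y. ennreal (cmod (k x y)) * ennreal (cmod (f y) * cmod (g x)) \<partial>M \<partial>M) < \<infinity>" .
qed

lemma kernel_op_adjoint_L1:
  assumes k: "schur_kernel B k" and f: "f \<in> Lp_space M top" and g: "g \<in> Lp_space M 1"
  shows "pairing M (kernel_op k f) g = pairing M f (kernel_op (\<lambda>x y. cnj (k x y)) g)"
proof (rule kernel_op_swap[OF k])
  note kD = schur_kernelD[OF k]
  let ?N = "Lp_norm M top f"
  have g: "(\<integral>\<^sup>+x. ennreal (cmod (g x)) \<partial>M) < \<infinity>"
    using g nn_integral_eq_integral[of M "\<lambda>x. cmod (g x)"] by (simp add: L1_iff)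
  have "(\<integral>\<^sup>+x. \<integral>\<^sup>+y. ennreal (cmod (k x y)) * ennreal (cmod (f y) * cmod (g x)) \<partial>M \<partial>M)
    \<le> (\<integral>\<^sup>+x. \<integral>\<^sup>+y. ennreal (cmod (k x y)) * ennreal (?N * cmod (g x)) \<partial>M \<partial>M)"
    using Linf_bound[OF f] by (intro nn_integral_mono mult_left_mono ennreal_leI mult_right_mono) auto
  also have "\<dots> = (\<integral>\<^sup>+x. (\<integral>\<^sup>+y. ennreal (cmod (k x y)) \<partial>M) * ennreal (?N * cmod (g x)) \<partial>M)"
    by (simp add: nn_integral_multc)
  also have "\<dots> \<le> (\<integral>\<^sup>+x. ennreal B * (ennreal ?N * ennreal (cmod (g x))) \<partial>M)"
    using kD(3) by (intro nn_integral_mono) (auto simp: ennreal_mult intro!: mult_right_mono)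
  also have "\<dots> < \<infinity>"
    using g by (simp add: nn_integral_cmult ennreal_mult_less_top)
  finally show "(\<integral>\<^sup>+x. \<integral>\<^sup>+y. ennreal (cmod (k x y)) * ennreal (cmod (f y) * cmod (g x)) \<partial>M \<partial>M) < \<infinity>" .
qed

end

section \<open>Chebyshev polynomials of the averaging operator\<close>

text \<open>What remains of a flow tree: the operator theory uses only the predecessor map and the
  flow equation.\<close>

locale flow = positive_weight m for m :: "'v \<Rightarrow> real" +
  fixes p :: "'v \<Rightarrow> 'v"
  assumes finite_fibre: "finite {y. p y = x}" and flow_eq: "m x = (\<Sum>y | p y = x. m y)"
begin

definition fibre :: "nat \<Rightarrow> 'v \<Rightarrow> 'v set" where
  "fibre l x = {y. (p ^^ l) y = x}"

lemma fibre_Suc: "fibre (Suc l) x = (\<Union>y\<in>{y. p y = x}. fibre l y)"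
  by (auto simp: fibre_def)

lemma finite_fibre' [simp]: "finite (fibre l x)"
proof (induction l arbitrary: x)
  case 0
  have "fibre 0 x = {x}" by (auto simp: fibre_def)
  then show ?case by simp
next
  case (Suc l)
  then show ?case unfolding fibre_Suc by (intro finite_UN_I finite_fibre)
qed

lemma sum_fibre_Suc:
  fixes g :: "'v \<Rightarrow> 'b::comm_monoid_add"
  shows "(\<Sum>y\<in>fibre (Suc l) x. g y) = (\<Sum>y | p y = x. \<Sum>z\<in>fibre l y. g z)"
proof -
  have "fibre l y \<inter> fibre l z = {}" if "y \<noteq> z" for y z using that by (auto simp: fibre_def)
  then show ?thesis unfolding fibre_Suc by (subst sum.UNION_disjoint) (auto simp: finite_fibre)
qed

lemma sum_fibre: "(\<Sum>y\<in>fibre l x. m y) = m x"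
proof (induction l arbitrary: x)
  case 0
  have "fibre 0 x = {x}" by (auto simp: fibre_def)
  then show ?case by simp
next
  case (Suc l)
  then show ?case using flow_eq[of x] by (simp add: sum_fibre_Suc)
qed

text \<open>The l-th power of the adjoint of S on the weighted square integrable functions.\<close>

definition average :: "nat \<Rightarrow> ('v \<Rightarrow> complex) \<Rightarrow> 'v \<Rightarrow> complex" where
  "average l f x = (\<Sum>y\<in>fibre l x. f y * m y) / m x"

definition laplacian :: "('v \<Rightarrow> complex) \<Rightarrow> 'v \<Rightarrow> complex" where
  "laplacian f x = f x - f (p x) / 2 - average 1 f x / 2"

definition cheb_op :: "nat \<Rightarrow> ('v \<Rightarrow> complex) \<Rightarrow> 'v \<Rightarrow> complex" where
  "cheb_op n f x = (\<Sum>k\<le>n. average (n - k) f ((p ^^ k) x))"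

text \<open>The k-th summand is the kernel of the k-th power of S after the (n - k)-th power of its
  adjoint. It links x and y if the k-th ancestor of x is the (n - k)-th ancestor of y, and weighs
  the link by the reciprocal mass of that common ancestor.\<close>

definition cheb_kernel :: "nat \<Rightarrow> 'v \<Rightarrow> 'v \<Rightarrow> real" where
  "cheb_kernel n x y = (\<Sum>k\<le>n. if y \<in> fibre (n - k) ((p ^^ k) x) then 1 / m ((p ^^ k) x) else 0)"

lemma average_0 [simp]: "average 0 f x = f x"
proof -
  have "fibre 0 x = {x}" by (auto simp: fibre_def)
  then show ?thesis by (simp add: average_def)
qed

lemma fibre_1: "fibre 1 x = {y. p y = x}"
  by (auto simp: fibre_def)

lemma average_sum: "average l (\<lambda>y. \<Sum>k\<in>A. g k y) x = (\<Sum>k\<in>A. average l (g k) x)"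
  unfolding average_def by (subst sum_divide_distrib[symmetric], subst sum.swap) (simp add: sum_distrib_right)

text \<open>This is \<open>S\<^sup>* S = 1\<close>; the three-term recursion uses the flow condition
  only through it.\<close>

lemma average_comp_pred: "average 1 (\<lambda>y. g (p y)) x = g x"
proof -
  have "(\<Sum>y | p y = x. g (p y) * m y) = (\<Sum>y | p y = x. g x * m y)" by (intro sum.cong) auto
  also have "\<dots> = g x * m x"
    by (subst (2) flow_eq) (simp add: sum_distrib_left)
  finally show ?thesis unfolding average_def fibre_1 by simp
qed

lemma average_average: "average 1 (average l f) x = average (Suc l) f x"
  unfolding average_def fibre_1 sum_fibre_Suc by simp

lemma cheb_op_0: "cheb_op 0 f x = f x"
  by (simp add: cheb_op_def)

lemma cheb_op_1: "cheb_op 1 f x = 2 * f x - 2 * laplacian f x"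
  by (simp add: cheb_op_def laplacian_def)

text \<open>With \<open>S f = f \<circ> p\<close> the operator \<open>cheb_op n\<close> is \<open>\<Sum>k\<le>n. S\<^sup>k (S\<^sup>*)\<^sup>n\<^sup>-\<^sup>k\<close>; the three-term recursion
  of the Chebyshev polynomials of the second kind follows from \<open>S\<^sup>* S = 1\<close>.\<close>
lemma cheb_op_Suc_Suc:
  "cheb_op (Suc (Suc n)) f x = 2 * cheb_op (Suc n) f x - 2 * laplacian (cheb_op (Suc n) f) x - cheb_op n f x"
proof -
  have 1: "cheb_op (Suc (Suc n)) f x = average (Suc (Suc n)) f x + cheb_op (Suc n) f (p x)"
    unfolding cheb_op_def by (subst sum.atMost_Suc_shift) (simp add: funpow_swap1)
  have "average 1 (cheb_op (Suc n) f) x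
      = (\<Sum>k\<le>Suc n. average 1 (\<lambda>y. average (Suc n - k) f ((p ^^ k) y)) x)"
    unfolding cheb_op_def by (rule average_sum)
  \<comment> \<open>The summand k = 0 has no predecessor map in front and gains one more average; in
    every other summand the new average cancels one predecessor map.\<close>
  also have "\<dots> = average 1 (average (Suc n) f) x
      + (\<Sum>k\<le>n. average 1 (\<lambda>y. average (n - k) f ((p ^^ k) (p y))) x)"
    by (subst sum.atMost_Suc_shift) (simp add: funpow_swap1)
  also have "\<dots> = average (Suc (Suc n)) f x + cheb_op n f x"
    unfolding average_average cheb_op_def
    by (intro arg_cong2[where f = "(+)"] sum.cong refl average_comp_pred)
  finally show ?thesis unfolding laplacian_def 1 by (simp add: algebra_simps)
qed

section \<open>Kernels of the Chebyshev operators\<close>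

lemma has_integral_finite_support:
  fixes g :: "'v \<Rightarrow> 'b::{banach, second_countable_topology}"
  assumes "finite S"
  shows "has_bochner_integral M (\<lambda>y. if y \<in> S then g y else 0) (\<Sum>y\<in>S. m y *\<^sub>R g y)"
proof -
  have "has_bochner_integral M (\<lambda>y. \<Sum>z\<in>S. indicator {z} y *\<^sub>R g z) (\<Sum>z\<in>S. m z *\<^sub>R g z)"
  proof (intro has_bochner_integral_sum)
    fix z
    have "has_bochner_integral M (indicator {z}) (measure M {z})"
      by (intro has_bochner_integral_real_indicator) auto
    then show "has_bochner_integral M (\<lambda>y. indicator {z} y *\<^sub>R g z) (m z *\<^sub>R g z)"
      by (intro has_bochner_integral_scaleR_left) auto
  qed
  moreover have "(\<lambda>y. \<Sum>z\<in>S. indicator {z} y *\<^sub>R g z) = (\<lambda>y. if y \<in> S then g y else 0)"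
  proof
    fix y
    have "(\<Sum>z\<in>S. indicator {z} y *\<^sub>R g z) = (\<Sum>z\<in>S. if z = y then g z else 0)"
      by (intro sum.cong) auto
    then show "(\<Sum>z\<in>S. indicator {z} y *\<^sub>R g z) = (if y \<in> S then g y else 0)"
      using assms by simp
  qed
  ultimately show ?thesis by simp
qed

lemma cheb_kernel_nonneg [simp]: "cheb_kernel n x y \<ge> 0"
  unfolding cheb_kernel_def by (intro sum_nonneg) auto

text \<open>Reversing the order of summation exchanges the roles of x and y, and the weight is
  unchanged because it is taken at the common ancestor.\<close>

lemma cheb_kernel_sym: "cheb_kernel n x y = cheb_kernel n y x"
proof -
  have "cheb_kernel n y x = (\<Sum>k\<le>n. if (p ^^ (n - k)) x = (p ^^ k) y then 1 / m ((p ^^ k) y) else 0)"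
    by (simp add: cheb_kernel_def fibre_def)
  also have "\<dots> = (\<Sum>k\<le>n. if (p ^^ k) x = (p ^^ (n - k)) y then 1 / m ((p ^^ (n - k)) y) else 0)"
    by (rule sum.reindex_bij_witness[of _ "\<lambda>k. n - k" "\<lambda>k. n - k"]) auto
  also have "\<dots> = cheb_kernel n x y"
    unfolding cheb_kernel_def by (intro sum.cong) (auto simp: fibre_def)
  finally show ?thesis ..
qed

text \<open>Each of the n + 1 summands has integral 1, since the descendants of a vertex in a given
  generation together carry its mass.\<close>

lemma cheb_kernel_integral: "has_bochner_integral M (cheb_kernel n x) (real n + 1)"
proof -
  have "has_bochner_integral M (cheb_kernel n x)
    (\<Sum>k\<le>n. \<Sum>y\<in>fibre (n - k) ((p ^^ k) x). m y *\<^sub>R (1 / m ((p ^^ k) x)))"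
    unfolding cheb_kernel_def
    by (intro has_bochner_integral_sum has_integral_finite_support) auto
  also have "(\<Sum>k\<le>n. \<Sum>y\<in>fibre (n - k) ((p ^^ k) x). m y *\<^sub>R (1 / m ((p ^^ k) x)))
    = (\<Sum>k\<le>n. (\<Sum>y\<in>fibre (n - k) ((p ^^ k) x). m y) / m ((p ^^ k) x))"
    by (simp add: sum_divide_distrib)
  also have "\<dots> = real n + 1" by (simp add: sum_fibre)
  finally show ?thesis .
qed

lemma cheb_kernel_schur: "schur_kernel (real n + 1) (\<lambda>x y. of_real (cheb_kernel n x y))"
  unfolding schur_kernel_def
proof (intro conjI allI)
  fix x
  have "(\<integral>\<^sup>+y. ennreal (cheb_kernel n x y) \<partial>M) = ennreal (LINT y|M. cheb_kernel n x y)"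
    using cheb_kernel_integral[of n x] by (intro nn_integral_eq_integral) (auto simp: has_bochner_integral_iff)
  also have "\<dots> = ennreal (real n + 1)"
    using cheb_kernel_integral[of n x] by (auto simp: has_bochner_integral_iff)
  finally show "(\<integral>\<^sup>+y. ennreal (cmod (of_real (cheb_kernel n x y))) \<partial>M) \<le> ennreal (real n + 1)" by simp
qed (auto simp: cheb_kernel_sym[of n])

lemma cheb_op_kernel: "kernel_op (\<lambda>x y. of_real (cheb_kernel n x y)) f = cheb_op n f"
proof
  fix x
  have "has_bochner_integral M
     (\<lambda>y. \<Sum>k\<le>n. if y \<in> fibre (n - k) ((p ^^ k) x) then f y / m ((p ^^ k) x) else 0)
     (\<Sum>k\<le>n. \<Sum>y\<in>fibre (n - k) ((p ^^ k) x). m y *\<^sub>R (f y / m ((p ^^ k) x)))"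
    by (intro has_bochner_integral_sum has_integral_finite_support) auto
  also have "(\<lambda>y. \<Sum>k\<le>n. if y \<in> fibre (n - k) ((p ^^ k) x) then f y / m ((p ^^ k) x) else 0)
     = (\<lambda>y. of_real (cheb_kernel n x y) * f y)"
    unfolding cheb_kernel_def of_real_sum sum_distrib_right by (intro ext sum.cong) auto
  also have "(\<Sum>k\<le>n. \<Sum>y\<in>fibre (n - k) ((p ^^ k) x). m y *\<^sub>R (f y / m ((p ^^ k) x))) = cheb_op n f x"
    unfolding cheb_op_def average_def sum_divide_distrib
    by (intro sum.cong) (auto simp: scaleR_conv_of_real mult.commute)
  finally show "kernel_op (\<lambda>x y. of_real (cheb_kernel n x y)) f x = cheb_op n f x"
    by (simp add: kernel_op_def has_bochner_integral_iff)
qed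

lemma cheb_kernel_le: "cheb_kernel n x y \<le> (real n + 1) / m x"
  using schur_kernelD(6)[OF cheb_kernel_schur, of n x y] by simp

end

section \<open>The Hausdorff moment problem\<close>

lemma pascal_sum:
  fixes f :: "nat \<Rightarrow> real"
  shows "(\<Sum>l\<le>Suc r. of_nat (Suc r choose l) * f l) = (\<Sum>l\<le>r. of_nat (r choose l) * (f l + f (Suc l)))"
proof -
  have "(\<Sum>l\<le>Suc r. of_nat (Suc r choose l) * f l)
     = f 0 + (\<Sum>l\<le>r. of_nat (r choose Suc l) * f (Suc l)) + (\<Sum>l\<le>r. of_nat (r choose l) * f (Suc l))"
    by (subst sum.atMost_Suc_shift) (simp add: distrib_right sum.distrib)
  also have "f 0 + (\<Sum>l\<le>r. of_nat (r choose Suc l) * f (Suc l)) = (\<Sum>l\<le>Suc r. of_nat (r choose l) * f l)"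
    by (subst sum.atMost_Suc_shift) simp
  also have "\<dots> = (\<Sum>l\<le>r. of_nat (r choose l) * f l)" by simp
  finally show ?thesis by (simp add: distrib_left sum.distrib)
qed

lemma prod_shifted_ratio:
  assumes "j \<le> n"
  shows "(\<Prod>i<j. (real k - real i) / (real n - real i)) = real (k choose j) / real (n choose j)"
proof -
  have *: "(\<Prod>i<j. real k - real i) = fact j * real (k choose j)" for k
    using gbinomial_mult_fact[of j "real k"] by (simp add: binomial_gbinomial atLeast0LessThan)
  show ?thesis unfolding prod_dividef * by simp
qed

text \<open>Both sides are products of j factors of modulus at most 1, so the difference is at most
  the sum of the j differences of factors. Each of these is at most 2 j / n, because i < j and 2 j
  \<le> n keep the denominator n - i above n / 2.\<close>

lemma hausdorff_moment_approx:
  fixes n k j :: nat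
  assumes "k \<le> n" "2 * j \<le> n" "0 < n"
  shows "\<bar>(real k / real n) ^ j - real (k choose j) / real (n choose j)\<bar> \<le> 2 * (real j)\<^sup>2 / real n"
proof -
  have fac: "\<bar>(real k - real i) / (real n - real i)\<bar> \<le> 1 \<and>
      \<bar>real k / real n - (real k - real i) / (real n - real i)\<bar> \<le> 2 * real j / real n" if "i < j" for i
  proof
    have i: "real n - real i > 0" "real n - real i \<ge> real n / 2" "real n - real i \<ge> real i"
      using that assms by linarith+
    show "\<bar>(real k - real i) / (real n - real i)\<bar> \<le> 1"
      using i assms by (simp add: divide_le_eq abs_le_iff)
    have "real k / real n - (real k - real i) / (real n - real i)
        = real i * ((real n - real k) / real n) / (real n - real i)"
      using i assms by (simp add: field_simps)
    then have "\<bar>real k / real n - (real k - real i) / (real n - real i)\<bar>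
        = real i * ((real n - real k) / real n) / (real n - real i)"
      using i assms by simp
    also have "\<dots> \<le> real j * 1 / (real n / 2)"
      using i assms that by (intro frac_le mult_mono) (auto simp: field_simps)
    finally show "\<bar>real k / real n - (real k - real i) / (real n - real i)\<bar> \<le> 2 * real j / real n"
      by (simp add: mult.commute)
  qed
  have "\<bar>(\<Prod>i<j. real k / real n) - (\<Prod>i<j. (real k - real i) / (real n - real i))\<bar>
     \<le> (\<Sum>i<j. \<bar>real k / real n - (real k - real i) / (real n - real i)\<bar>)"
    using norm_prod_diff[of "{..<j}" "\<lambda>_. real k / real n" "\<lambda>i. (real k - real i) / (real n - real i)"]
      assms fac by auto
  also have "\<dots> \<le> (\<Sum>i<j. 2 * real j / real n)" using fac by (intro sum_mono) auto
  also have "\<dots> = 2 * (real j)\<^sup>2 / real n" by (simp add: power2_eq_square)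
  finally show ?thesis using assms by (simp add: prod_shifted_ratio)
qed

text \<open>\<open>b n k\<close> plays the role of the integral of \<open>t\<^sup>k (1 - t)\<^sup>n\<^sup>-\<^sup>k\<close>; the measure is a weak limit of
  the measures giving mass \<open>(n choose k) b n k\<close> to the points \<open>k / n\<close>.\<close>
locale hausdorff_array =
  fixes b :: "nat \<Rightarrow> nat \<Rightarrow> real"
  assumes nonneg: "k \<le> n \<Longrightarrow> 0 \<le> b n k"
    and rec: "k \<le> n \<Longrightarrow> b n k = b (Suc n) k + b (Suc n) (Suc k)"
begin

lemma expand: "i \<le> j \<Longrightarrow> b j i = (\<Sum>l\<le>r. of_nat (r choose l) * b (j + r) (i + l))"
proof (induction r)
  case (Suc r)
  have "b j i = (\<Sum>l\<le>r. of_nat (r choose l) * (b (j + Suc r) (i + l) + b (j + Suc r) (i + Suc l)))"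
    unfolding Suc.IH[OF Suc.prems] using rec[of "i + _" "j + r"] Suc.prems by (intro sum.cong) auto
  then show ?case unfolding pascal_sum by simp
qed simp

text \<open>The discrete measures have the right factorial moments exactly, for every n: the product
  of the binomials (n over k) and (k over j) equals that of (n over j) and (n - j over k - j), which
  leaves the expansion of \<open>b j j\<close>. Power moments are then correct in the limit.\<close>

lemma factorial_moment:
  assumes "j \<le> n"
  shows "(\<Sum>k\<le>n. of_nat (n choose k) * b n k * (of_nat (k choose j) / of_nat (n choose j))) = b j j"
proof -
  have "b j j = (\<Sum>l\<le>n - j. of_nat (n - j choose l) * b n (j + l))"
    using expand[of j j "n - j"] assms by simp
  also have "\<dots> = (\<Sum>k\<in>{j..n}. of_nat (n - j choose (k - j)) * b n k)"
    by (rule sum.reindex_bij_witness[of _ "\<lambda>k. k - j" "\<lambda>l. j + l"]) (use assms in auto)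
  also have "\<dots> = (\<Sum>k\<in>{j..n}. of_nat (n choose k) * b n k * (of_nat (k choose j) / of_nat (n choose j)))"
  proof (intro sum.cong refl)
    fix k assume "k \<in> {j..n}"
    then have "real (n choose k) * real (k choose j) = real (n choose j) * real (n - j choose (k - j))"
      using choose_mult[of j k n] by (metis atLeastAtMost_iff of_nat_mult)
    moreover have "real (n choose j) \<noteq> 0" using assms by simp
    ultimately show "of_nat (n - j choose (k - j)) * b n k
        = of_nat (n choose k) * b n k * (of_nat (k choose j) / of_nat (n choose j))"
      by (simp add: field_simps)
  qed
  also have "\<dots> = (\<Sum>k\<le>n. of_nat (n choose k) * b n k * (of_nat (k choose j) / of_nat (n choose j)))"
    by (intro sum.mono_neutral_left) (auto simp: binomial_eq_0)
  finally show ?thesis ..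
qed

lemma moments_tendsto:
  "(\<lambda>n. \<Sum>k\<le>n. of_nat (n choose k) * b n k * (real k / real n) ^ j) \<longlonglongrightarrow> b j j"
proof (rule Lim_transform)
  show "(\<lambda>n. b j j) \<longlonglongrightarrow> b j j" by simp
  have le: "norm ((\<Sum>k\<le>n. of_nat (n choose k) * b n k * (real k / real n) ^ j) - b j j)
     \<le> 2 * (real j)\<^sup>2 * b 0 0 * inverse (real n)" if "n \<ge> Suc (2 * j)" for n
  proof -
    have "(\<Sum>k\<le>n. of_nat (n choose k) * b n k * (real k / real n) ^ j) - b j j
       = (\<Sum>k\<le>n. of_nat (n choose k) * b n k
            * ((real k / real n) ^ j - of_nat (k choose j) / of_nat (n choose j)))"
      using that by (subst factorial_moment[of j n, symmetric])
        (auto simp: sum_subtractf[symmetric] right_diff_distrib)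
    also have "norm \<dots> \<le> (\<Sum>k\<le>n. of_nat (n choose k) * b n k * (2 * (real j)\<^sup>2 / real n))"
      unfolding real_norm_def abs_mult
      by (rule order_trans[OF sum_abs], rule sum_mono, unfold abs_mult, rule mult_mono)
         (use that nonneg hausdorff_moment_approx in auto)
    also have "\<dots> = (\<Sum>k\<le>n. of_nat (n choose k) * b n k) * (2 * (real j)\<^sup>2 / real n)"
      by (rule sum_distrib_right[symmetric])
    also have "(\<Sum>k\<le>n. of_nat (n choose k) * b n k) = b 0 0"
      using factorial_moment[of 0 n] by simp
    finally show ?thesis by (simp add: divide_inverse mult_ac)
  qed
  have "(\<lambda>n. 2 * (real j)\<^sup>2 * b 0 0 * inverse (real n)) \<longlonglongrightarrow> 2 * (real j)\<^sup>2 * b 0 0 * 0"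
    by (intro tendsto_intros lim_inverse_n)
  then have lim: "(\<lambda>n. 2 * (real j)\<^sup>2 * b 0 0 * inverse (real n)) \<longlonglongrightarrow> 0" by simp
  have "(\<lambda>n. (\<Sum>k\<le>n. of_nat (n choose k) * b n k * (real k / real n) ^ j) - b j j) \<longlonglongrightarrow> 0"
  proof (rule tendsto_0_le[OF lim, of _ 1], rule eventually_sequentiallyI[of "Suc (2 * j)"])
    fix n assume "n \<ge> Suc (2 * j)"
    from le[OF this] show "norm ((\<Sum>k\<le>n. of_nat (n choose k) * b n k * (real k / real n) ^ j) - b j j)
      \<le> norm (2 * (real j)\<^sup>2 * b 0 0 * inverse (real n)) * 1" by simp
  qed
  then show "(\<lambda>n. (\<Sum>k\<le>n. of_nat (n choose k) * b n k * (real k / real n) ^ j) - b j j) \<longlonglongrightarrow> 0" .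
qed

text \<open>Helly's selection theorem: the discrete measures live on [0, 1], hence are tight, and a
  subsequence converges weakly. It remains to see that support and moments pass to the
  limit.\<close>

theorem hausdorff_moment_pos:
  assumes "b 0 0 = 1"
  shows "\<exists>\<mu>. real_distribution \<mu> \<and> (AE t in \<mu>. 0 \<le> t \<and> t \<le> 1) \<and> (\<forall>j. (LINT t|\<mu>. t ^ j) = b j j)"
proof -
  define P where "P n = point_measure {..n} (\<lambda>k. ennreal (of_nat (n choose k) * b n k))" for n
  define D where "D n = distr (P n) borel (\<lambda>k. real k / real n)" for n
  have emP: "emeasure (P n) {..n} = 1" for n
  proof -
    have "emeasure (P n) {..n} = (\<Sum>k\<le>n. ennreal (of_nat (n choose k) * b n k))"
      unfolding P_def by (subst emeasure_point_measure_finite2) auto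
    also have "\<dots> = ennreal (\<Sum>k\<le>n. of_nat (n choose k) * b n k)"
      using nonneg by (intro sum_ennreal) auto
    also have "\<dots> = 1" using factorial_moment[of 0 n] assms by simp
    finally show ?thesis .
  qed
  have meas [simp]: "f \<in> measurable (P n) borel" for f :: "nat \<Rightarrow> real" and n
    by (simp add: P_def)
  have prob: "prob_space (P n)" for n
    by (intro prob_spaceI) (simp add: P_def space_point_measure emP[unfolded P_def])
  have D: "real_distribution (D n)" for n
    unfolding D_def using prob_space.prob_space_distr[OF prob[of n] meas]
    by (auto simp: real_distribution_def real_distribution_axioms_def)
  have intD: "(LINT t|D n. f t) = (\<Sum>k\<le>n. of_nat (n choose k) * b n k * f (real k / real n))"
    if [measurable]: "f \<in> borel_measurable borel" for f :: "real \<Rightarrow> real" and n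
  proof -
    have "(LINT t|D n. f t) = (LINT k|P n. f (real k / real n))"
      unfolding D_def by (intro integral_distr) auto
    also have "\<dots> = (\<Sum>k\<le>n. (of_nat (n choose k) * b n k) *\<^sub>R f (real k / real n))"
      unfolding P_def using nonneg by (intro lebesgue_integral_point_measure_finite) auto
    finally show ?thesis by simp
  qed
  have tight: "tight D"
    unfolding tight_def
  proof (intro conjI allI impI D)
    fix \<epsilon> :: real assume "\<epsilon> > 0"
    have "measure (D n) {-1<..1} = 1" for n
    proof -
      have "measure (D n) {-1<..1} = (LINT t|D n. indicator {-1<..1} t)"
        using D[of n] by (simp add: real_distribution_def real_distribution_axioms_def)
      also have "\<dots> = (\<Sum>k\<le>n. of_nat (n choose k) * b n k)"
        by (subst intD) (auto intro!: sum.cong simp: indicator_def divide_le_eq less_le_trans[of _ 0])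
      finally show ?thesis using factorial_moment[of 0 n] assms by simp
    qed
    then show "\<exists>a b. a < b \<and> (\<forall>n. 1 - \<epsilon> < measure (D n) {a<..b})"
      using \<open>\<epsilon> > 0\<close> by (intro exI[of _ "-1"] exI[of _ 1]) auto
  qed
  obtain r \<mu> where r: "strict_mono r" and \<mu>: "real_distribution \<mu>" and weak: "weak_conv_m (D \<circ> id \<circ> r) \<mu>"
    using tight_imp_convergent_subsubsequence[OF tight, of id] by (auto simp: strict_mono_def)
  interpret \<mu>: real_distribution \<mu> by fact
  have conv: "(\<lambda>n. LINT t|D (r n). f t) \<longlonglongrightarrow> (LINT t|\<mu>. f t)"
    if "continuous_on UNIV f" "\<And>t. \<bar>f t\<bar> \<le> B" for f :: "real \<Rightarrow> real" and B
    using weak_conv_imp_integral_bdd_continuous_conv[OF _ \<mu> weak, of f B] that D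
    by (auto simp: o_def continuous_on_eq_continuous_at)
  \<comment> \<open>Clipping to [0, 1] makes powers bounded and continuous on the whole line, as
    weak convergence demands, and changes nothing at the points k / n.\<close>
  define c :: "real \<Rightarrow> real" where "c t = max 0 (min 1 t)" for t
  have c: "continuous_on UNIV c" "c t \<in> {0..1}" for t
    unfolding c_def by (auto intro!: continuous_intros)
  have ck: "c (real k / real n) = real k / real n" if "k \<le> n" for k n
  proof -
    have "real k / real n \<le> 1" using that by (simp add: divide_le_eq)
    then show ?thesis by (simp add: c_def)
  qed
  have mc: "f \<in> borel_measurable borel" if "continuous_on UNIV f" for f :: "real \<Rightarrow> real"
    using that by (rule borel_measurable_continuous_onI)
  have supp: "AE t in \<mu>. c t = t"
  proof -
    \<comment> \<open>A bounded continuous function that vanishes exactly on [0, 1]. Its integrals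
      against the discrete measures are 0, so the limit measure is carried by [0, 1].\<close>
    define g where "g t = min 1 \<bar>t - c t\<bar>" for t
    have g: "continuous_on UNIV g" "\<bar>g t\<bar> \<le> 1" "0 \<le> g t" for t
      unfolding g_def using c(1) by (auto intro!: continuous_intros)
    have "(LINT t|D (r n). g t) = 0" for n
      by (subst intD[OF mc[OF g(1)]]) (auto intro!: sum.neutral simp: g_def ck)
    then have "(LINT t|\<mu>. g t) = 0"
      using conv[OF g(1,2)] by (simp add: LIMSEQ_const_iff)
    moreover have "integrable \<mu> g"
      by (rule \<mu>.integrable_const_bound[of _ 1]) (use g mc[OF g(1)] in auto)
    ultimately have "AE t in \<mu>. g t = 0"
      using integral_nonneg_eq_0_iff_AE[of \<mu> g] g by auto
    then show ?thesis by eventually_elim (auto simp: g_def min_def split: if_splits)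
  qed
  have "(LINT t|\<mu>. t ^ j) = b j j" for j
  proof -
    have cj: "continuous_on UNIV (\<lambda>t. c t ^ j)" "\<bar>c t ^ j\<bar> \<le> 1" for t
      using c(2)[of t] by (auto intro!: continuous_intros c power_le_one)
    have "(LINT t|\<mu>. t ^ j) = (LINT t|\<mu>. c t ^ j)"
      by (rule integral_cong_AE) (use supp mc[OF cj(1)] in auto)
    moreover have "(LINT t|D n. c t ^ j) = (\<Sum>k\<le>n. of_nat (n choose k) * b n k * (real k / real n) ^ j)" for n
      by (subst intD[OF mc[OF cj(1)]]) (auto intro!: sum.cong simp: ck)
    then have "(\<lambda>n. LINT t|D (r n). c t ^ j) \<longlonglongrightarrow> b j j"
      using LIMSEQ_subseq_LIMSEQ[OF moments_tendsto[of j] r] by (simp add: o_def)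
    from LIMSEQ_unique[OF conv[OF cj] this] have "(LINT t|\<mu>. c t ^ j) = b j j" .
    ultimately show ?thesis by simp
  qed
  moreover have "AE t in \<mu>. 0 \<le> t \<and> t \<le> 1"
    using supp by eventually_elim (use c(2) in \<open>metis atLeastAtMost_iff\<close>)
  ultimately show ?thesis using \<mu> by blast
qed

end

text \<open>Normalise by the total mass \<open>b 0 0\<close>. If that is 0, the diagonal vanishes,
  being nonnegative and decreasing, and the null measure does.\<close>

theorem hausdorff_moment:
  assumes "hausdorff_array b"
  shows "\<exists>\<mu>. sets \<mu> = sets borel \<and> finite_measure \<mu> \<and> (AE t in \<mu>. 0 \<le> t \<and> t \<le> 1) \<and>
     (\<forall>j. (LINT t|\<mu>. t ^ j) = b j j)"
proof -
  interpret hausdorff_array b by fact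
  have le: "0 \<le> b j j \<and> b j j \<le> b 0 0" for j
  proof (induction j)
    case (Suc j)
    then show ?case using rec[of j j] nonneg[of j "Suc j"] nonneg[of "Suc j" "Suc j"] by simp
  qed (use nonneg in auto)
  show ?thesis
  proof (cases "b 0 0 = 0")
    case True
    then have "b j j = 0" for j using le[of j] by simp
    then show ?thesis
      by (intro exI[of _ "null_measure borel"])
         (auto intro!: finite_measureI simp: AE_iff_null null_sets_def integral_null_measure)
  next
    case False
    then have c: "b 0 0 > 0" using le[of 0] by simp
    interpret N: hausdorff_array "\<lambda>n k. b n k / b 0 0"
    proof
      show "b n k / b 0 0 = b (Suc n) k / b 0 0 + b (Suc n) (Suc k) / b 0 0" if "k \<le> n" for n k
        using rec[OF that] by (simp add: add_divide_distrib)
    qed (use c nonneg in auto)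
    obtain \<nu> where \<nu>: "real_distribution \<nu>" "AE t in \<nu>. 0 \<le> t \<and> t \<le> 1"
      "\<And>j. (LINT t|\<nu>. t ^ j) = b j j / b 0 0"
      using N.hausdorff_moment_pos c by auto
    interpret \<nu>: real_distribution \<nu> by fact
    let ?\<mu> = "density \<nu> (\<lambda>_. ennreal (b 0 0))"
    have "(LINT t|?\<mu>. t ^ j) = b j j" for j
      by (subst integral_density) (use c \<nu>(3) in auto)
    moreover have "finite_measure ?\<mu>"
      by (intro finite_measureI) (auto simp: emeasure_density nn_integral_cmult_indicator ennreal_mult_less_top \<nu>.emeasure_space_1 ennreal_mult_eq_top_iff)
    moreover have "AE t in ?\<mu>. 0 \<le> t \<and> t \<le> 1"
      using \<nu>(2) by (subst AE_density) auto
    ultimately show ?thesis by (intro exI[of _ ?\<mu>]) auto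
  qed
qed

text \<open>On a bounded set the exponential series may be integrated term by term, dominated by exp
  (\<bar>u\<bar> R); so the moments determine the characteristic function and thereby the
  distribution.\<close>

lemma moments_determine_distribution:
  assumes \<mu>: "real_distribution \<mu>" "AE t in \<mu>. \<bar>t\<bar> \<le> R" and \<nu>: "real_distribution \<nu>" "AE t in \<nu>. \<bar>t\<bar> \<le> R"
    and eq: "\<And>n. (LINT t|\<mu>. t ^ n) = (LINT t|\<nu>. t ^ n)"
  shows "\<mu> = \<nu>"
proof (rule Levy_uniqueness[OF \<mu>(1) \<nu>(1)], rule ext)
  fix u :: real
  have lim: "(\<lambda>N. \<Sum>k<N. (\<i> * u) ^ k /\<^sub>R fact k * of_real (LINT t|\<mu>. t ^ k)) \<longlonglongrightarrow> char \<mu> u"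
    if \<mu>: "real_distribution \<mu>" "AE t in \<mu>. \<bar>t\<bar> \<le> R" for \<mu>
  proof -
    interpret real_distribution \<mu> by fact
    have tint: "integrable \<mu> (\<lambda>t. complex_of_real (t ^ k))" for k
      by (rule integrable_const_bound[of _ "R ^ k"])
         (use \<mu>(2) in \<open>auto elim!: eventually_mono intro!: power_mono simp: norm_power\<close>)
    have "(\<lambda>N. LINT t|\<mu>. (\<Sum>k<N. (\<i> * (u * t)) ^ k /\<^sub>R fact k)) \<longlonglongrightarrow> (LINT t|\<mu>. iexp (u * t))"
    proof (rule integral_dominated_convergence[where w = "\<lambda>_. exp (\<bar>u\<bar> * R)"])
      show "AE t in \<mu>. (\<lambda>N. \<Sum>k<N. (\<i> * (u * t)) ^ k /\<^sub>R fact k) \<longlonglongrightarrow> iexp (u * t)"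
        using exp_converges[of "\<i> * complex_of_real (u * t)" for t] by (intro AE_I2) (simp add: sums_def)
      show "AE t in \<mu>. norm (\<Sum>k<N. (\<i> * (u * t)) ^ k /\<^sub>R fact k) \<le> exp (\<bar>u\<bar> * R)" for N
        using \<mu>(2)
      proof eventually_elim
        case (elim t)
        have "norm (\<Sum>k<N. (\<i> * (u * t)) ^ k /\<^sub>R fact k) \<le> (\<Sum>k<N. \<bar>u * t\<bar> ^ k /\<^sub>R fact k)"
          by (rule order_trans[OF norm_sum]) (simp add: norm_power norm_mult abs_mult)
        also have "\<dots> \<le> exp \<bar>u * t\<bar>"
          using exp_converges[of "\<bar>u * t\<bar>"]
          by (metis (no_types, lifting) divide_nonneg_nonneg fact_ge_zero real_scaleR_def inverse_nonnegative_iff_nonnegative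
             zero_le_power abs_ge_zero mult_nonneg_nonneg sum_le_suminf finite_lessThan sums_iff)
        also have "\<dots> \<le> exp (\<bar>u\<bar> * R)" using elim by (simp add: abs_mult mult_left_mono)
        finally show ?case .
      qed
    qed auto
    moreover have "(LINT t|\<mu>. (\<Sum>k<N. (\<i> * (u * t)) ^ k /\<^sub>R fact k))
       = (\<Sum>k<N. (\<i> * u) ^ k /\<^sub>R fact k * of_real (LINT t|\<mu>. t ^ k))" for N
    proof -
      have "(\<lambda>t. \<Sum>k<N. (\<i> * (u * t)) ^ k /\<^sub>R fact k)
        = (\<lambda>t. \<Sum>k<N. ((\<i> * u) ^ k /\<^sub>R fact k) * complex_of_real (t ^ k))"
        by (simp add: power_mult_distrib mult_ac scaleR_conv_of_real)
      then show ?thesis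
        using tint by (simp add: Bochner_Integration.integral_sum del: of_real_power)
    qed
    ultimately show ?thesis unfolding char_def by simp
  qed
  show "char \<mu> u = char \<nu> u"
    using LIMSEQ_unique[OF lim[OF \<mu>] lim[OF \<nu>, folded eq]] .
qed

text \<open>The moment of order 0 is the total mass. If it is positive, both measures are rescaled
  to probability measures by the same factor, and the two bounds R and R' are replaced by their
  maximum.\<close>

lemma moments_determine_measure:
  fixes \<mu> \<nu> :: "real measure"
  assumes \<mu>: "sets \<mu> = sets borel" "finite_measure \<mu>" "AE t in \<mu>. \<bar>t\<bar> \<le> R"
    and \<nu>: "sets \<nu> = sets borel" "finite_measure \<nu>" "AE t in \<nu>. \<bar>t\<bar> \<le> R'"
    and eq: "\<And>n. (LINT t|\<mu>. t ^ n) = (LINT t|\<nu>. t ^ n)"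
  shows "\<mu> = \<nu>"
proof -
  interpret \<mu>: finite_measure \<mu> by fact
  interpret \<nu>: finite_measure \<nu> by fact
  define c where "c = measure \<mu> (space \<mu>)"
  have "measure \<nu> (space \<nu>) = (LINT t|\<nu>. t ^ 0)" by simp
  also have "\<dots> = (LINT t|\<mu>. t ^ 0)" by (rule eq[symmetric])
  also have "\<dots> = c" by (simp add: c_def)
  finally have c: "measure \<nu> (space \<nu>) = c" .
  have em: "emeasure \<mu> (space \<mu>) = ennreal c" "emeasure \<nu> (space \<nu>) = ennreal c"
    using \<mu>.emeasure_eq_measure \<nu>.emeasure_eq_measure c by (auto simp: c_def)
  show ?thesis
  proof (cases "c = 0")
    case True
    have "emeasure \<mu> A = 0" "emeasure \<nu> A = 0" for A
      using emeasure_space[of \<mu> A] emeasure_space[of \<nu> A] em True by auto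
    then show ?thesis using \<mu>(1) \<nu>(1) by (intro measure_eqI) auto
  next
    case False
    then have c0: "c > 0" using measure_nonneg[of \<mu> "space \<mu>"] c_def by linarith
    let ?d = "\<lambda>\<mu>. density \<mu> (\<lambda>_. ennreal (1 / c))"
    have rd: "real_distribution (?d \<mu>)" if "sets \<mu> = sets borel" "emeasure \<mu> (space \<mu>) = ennreal c" for \<mu>
    proof -
      have "emeasure (?d \<mu>) (space (?d \<mu>)) = 1"
        using that c0 emeasure_density_const[OF sets.top, of \<mu> "ennreal (1 / c)"]
        by (simp add: ennreal_mult'[symmetric])
      then show ?thesis using that by (auto simp: real_distribution_def real_distribution_axioms_def intro!: prob_spaceI)
    qed
    have ae: "AE t in ?d \<mu>. \<bar>t\<bar> \<le> max R R'" if "sets \<mu> = sets borel" "AE t in \<mu>. \<bar>t\<bar> \<le> R''" "R'' \<le> max R R'" for \<mu> R''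
      by (subst AE_density) (use that in \<open>auto elim!: eventually_mono\<close>)
    have mom: "(LINT t|?d \<mu>. t ^ n) = (LINT t|\<mu>. t ^ n) / c" if "sets \<mu> = sets borel" for \<mu> n
      by (subst integral_density) (use that c0 in \<open>auto simp: measurable_cong_sets[OF that refl]\<close>)
    have "?d \<mu> = ?d \<nu>"
      by (intro moments_determine_distribution[of _ "max R R'"] rd ae[OF _ \<mu>(3)] ae[OF _ \<nu>(3)])
         (use \<mu> \<nu> em mom eq in auto)
    then have "emeasure (?d \<mu>) A = emeasure (?d \<nu>) A" for A by simp
    then have *: "ennreal (1 / c) * emeasure \<mu> A = ennreal (1 / c) * emeasure \<nu> A" if "A \<in> sets borel" for A
      using that \<mu>(1) \<nu>(1) emeasure_density_const[of A \<mu>] emeasure_density_const[of A \<nu>] by metis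
    have "emeasure \<mu> A = emeasure \<nu> A" if "A \<in> sets borel" for A
      using *[OF that] c0 by (subst (asm) ennreal_mult_cancel_left) auto
    then show ?thesis using \<mu>(1) \<nu>(1) by (intro measure_eqI) auto
  qed
qed

section \<open>Spectral measures\<close>

text \<open>To be applied to half the Laplacian. Compatibility with differences is the form of
  linearity that makes B commute with 1 - B.\<close>

locale unit_interval_operator = positive_weight m for m :: "'v \<Rightarrow> real" +
  fixes B :: "('v \<Rightarrow> complex) \<Rightarrow> 'v \<Rightarrow> complex"
  assumes B_L2: "f \<in> Lp_space M 2 \<Longrightarrow> B f \<in> Lp_space M 2"
    and B_diff: "B (\<lambda>x. f x - g x) = (\<lambda>x. B f x - B g x)"
    and B_sym: "f \<in> Lp_space M 2 \<Longrightarrow> g \<in> Lp_space M 2 \<Longrightarrow> pairing M (B f) g = pairing M f (B g)"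
    and B_nonneg: "f \<in> Lp_space M 2 \<Longrightarrow> 0 \<le> Re (pairing M (B f) f)"
    and B_le: "f \<in> Lp_space M 2 \<Longrightarrow> Re (pairing M (B f) f) \<le> Re (pairing M f f)"
begin

definition C :: "('v \<Rightarrow> complex) \<Rightarrow> 'v \<Rightarrow> complex" where
  "C f = (\<lambda>x. f x - B f x)"

lemma C_L2: "f \<in> Lp_space M 2 \<Longrightarrow> C f \<in> Lp_space M 2"
  unfolding C_def by (intro L2_diff B_L2)

lemma BC: "B (C f) = C (B f)"
  unfolding C_def by (rule B_diff)

lemma B_pow_L2: "f \<in> Lp_space M 2 \<Longrightarrow> (B ^^ n) f \<in> Lp_space M 2"
  by (induction n) (auto intro: B_L2)

lemma C_pow_L2: "f \<in> Lp_space M 2 \<Longrightarrow> (C ^^ n) f \<in> Lp_space M 2"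
  by (induction n) (auto intro: C_L2)

lemma C_sym:
  assumes "f \<in> Lp_space M 2" "g \<in> Lp_space M 2"
  shows "pairing M (C f) g = pairing M f (C g)"
proof -
  have "pairing M (C f) g = pairing M f g - pairing M f (B g)"
    using assms B_sym unfolding C_def by (simp add: pairing_diff_left B_L2)
  also have "\<dots> = cnj (pairing M (C g) f)"
    using assms unfolding C_def by (simp add: pairing_diff_left B_L2 pairing_cnj)
  finally show ?thesis by (simp add: pairing_cnj)
qed

lemma B_split: 
  assumes "f \<in> Lp_space M 2" "g \<in> Lp_space M 2"
  shows "pairing M f g = pairing M (B f) g + pairing M (C f) g"
  using assms unfolding C_def by (simp add: pairing_diff_left B_L2)

lemma C_nonneg: "f \<in> Lp_space M 2 \<Longrightarrow> 0 \<le> Re (pairing M (C f) f)"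
  using B_split[of f f] B_le[of f] by simp

lemma B_C_pow: "B ((C ^^ j) f) = (C ^^ j) (B f)"
  by (induction j) (auto simp: BC)

lemma B_pow_C: "(B ^^ i) (C f) = C ((B ^^ i) f)"
  by (induction i) (auto simp: BC)

text \<open>An even power of \<open>B\<close> or \<open>C = 1 - B\<close> can be split between the two arguments of the form;
  \<open>BC = BCB + CBC\<close> covers the remaining mixed case.\<close>
lemma BC_pow_nonneg: "f \<in> Lp_space M 2 \<Longrightarrow> 0 \<le> Re (pairing M ((B ^^ i) ((C ^^ j) f)) f)"
proof (induction "i + j" arbitrary: i j f rule: less_induct)
  case less
  note f = less.prems
  consider i' where "i = Suc (Suc i')" | j' where "j = Suc (Suc j')" | "i \<le> 1" "j \<le> 1"
    by (metis One_nat_def Suc_le_mono le0 not0_implies_Suc)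
  then show ?case
  proof cases
    case 1
    have "pairing M ((B ^^ i) ((C ^^ j) f)) f = pairing M (B ((B ^^ i') ((C ^^ j) (B f)))) f"
      using 1 by (simp add: funpow_swap1 B_C_pow)
    also have "\<dots> = pairing M ((B ^^ i') ((C ^^ j) (B f))) (B f)"
      using f by (intro B_sym B_pow_L2 C_pow_L2 B_L2)
    finally show ?thesis using less.hyps[of i' j "B f"] 1 B_L2 f by simp
  next
    case 2
    have "pairing M ((B ^^ i) ((C ^^ j) f)) f = pairing M (C ((B ^^ i) ((C ^^ j') (C f)))) f"
      using 2 by (simp add: funpow_swap1 B_pow_C[symmetric])
    also have "\<dots> = pairing M ((B ^^ i) ((C ^^ j') (C f))) (C f)"
      using f by (intro C_sym B_pow_L2 C_pow_L2 C_L2)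
    finally show ?thesis using less.hyps[of i j' "C f"] 2 C_L2 f by simp
  next
    case 3
    have "0 \<le> Re (pairing M (B (C f)) f)"
    proof -
      have "pairing M (B (C f)) f = pairing M (B (B (C f))) f + pairing M (C (B (C f))) f"
        using f by (intro B_split B_L2 C_L2)
      also have "\<dots> = pairing M (C (B f)) (B f) + pairing M (B (C f)) (C f)"
        using f B_sym[of "B (C f)" f] C_sym[of "B (C f)" f] by (simp add: B_L2 C_L2 BC)
      finally show ?thesis using f C_nonneg[of "B f"] B_nonneg[of "C f"] by (simp add: B_L2 C_L2)
    qed
    moreover have "0 \<le> Re (pairing M f f)" by (simp add: pairing_self)
    moreover have "i = 0 \<or> i = 1" "j = 0 \<or> j = 1" using 3 by auto
    ultimately show ?thesis using B_nonneg[OF f] C_nonneg[OF f] by auto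
  qed
qed

text \<open>The array \<open>b n k\<close> is the form of \<open>(B ^^ k) ((C ^^ (n - k)) f)\<close>
  at f; its recursion expresses B + C = 1, and its diagonal consists of the moments sought.\<close>

lemma ex_spectral_measure:
  assumes f: "f \<in> Lp_space M 2"
  shows "\<exists>\<mu>. sets \<mu> = sets borel \<and> finite_measure \<mu> \<and> (AE t in \<mu>. 0 \<le> t \<and> t \<le> 1) \<and>
    (\<forall>n. (LINT t|\<mu>. t ^ n) = Re (pairing M ((B ^^ n) f) f))"
proof -
  have "hausdorff_array (\<lambda>n k. Re (pairing M ((B ^^ k) ((C ^^ (n - k)) f)) f))"
  proof
    fix n k :: nat assume "k \<le> n"
    then have k: "Suc n - k = Suc (n - k)" "Suc n - Suc k = n - k" by auto
    show "Re (pairing M ((B ^^ k) ((C ^^ (n - k)) f)) f)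
       = Re (pairing M ((B ^^ k) ((C ^^ (Suc n - k)) f)) f) + Re (pairing M ((B ^^ Suc k) ((C ^^ (Suc n - Suc k)) f)) f)"
      unfolding k using B_split[of "(B ^^ k) ((C ^^ (n - k)) f)" f] f
      by (simp add: B_pow_L2 C_pow_L2 B_pow_C)
  qed (use BC_pow_nonneg f in auto)
  from hausdorff_moment[OF this] show ?thesis by simp
qed

end

section \<open>The flow Laplacian as a symmetric operator with form between 0 and 2\<close>

context flow
begin

lemma laplacian_cheb: "laplacian f x = f x - cheb_op 1 f x / 2"
  unfolding cheb_op_1 by (simp add: diff_divide_distrib)

lemma cheb_op_L2: "f \<in> Lp_space M 2 \<Longrightarrow> cheb_op n f \<in> Lp_space M 2"
  using kernel_op_Lp(1)[OF cheb_kernel_schur[of n], of 2 f] by (simp add: cheb_op_kernel)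

lemma cheb_op_norm: "f \<in> Lp_space M 2 \<Longrightarrow> Lp_norm M 2 (cheb_op n f) \<le> (real n + 1) * Lp_norm M 2 f"
  using kernel_op_Lp(2)[OF cheb_kernel_schur[of n], of 2 f] by (simp add: cheb_op_kernel)

lemma cheb_op_sym:
  "f \<in> Lp_space M 2 \<Longrightarrow> g \<in> Lp_space M 2 \<Longrightarrow> pairing M (cheb_op n f) g = pairing M f (cheb_op n g)"
  using kernel_op_adjoint_L2[OF cheb_kernel_schur[of n], of f g] by (simp add: cheb_op_kernel)

lemma laplacian_L2: 
  assumes "f \<in> Lp_space M 2"
  shows "laplacian f \<in> Lp_space M 2"
proof -
  have "laplacian f = (\<lambda>x. f x - 1 / 2 * cheb_op 1 f x)" by (auto simp: laplacian_cheb)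
  then show ?thesis by (simp only: L2_diff[OF assms L2_cmult[OF cheb_op_L2[OF assms]]])
qed

lemma average_diff: "average l (\<lambda>x. f x - g x) x = average l f x - average l g x"
  by (simp add: average_def left_diff_distrib sum_subtractf diff_divide_distrib)

lemma average_cmult: "average l (\<lambda>x. c * f x) x = c * average l f x"
  by (simp add: average_def mult.assoc sum_distrib_left)

lemma laplacian_diff: "laplacian (\<lambda>x. f x - g x) = (\<lambda>x. laplacian f x - laplacian g x)"
  by (auto simp: laplacian_def average_diff field_simps)

lemma laplacian_cmult: "laplacian (\<lambda>x. c * f x) = (\<lambda>x. c * laplacian f x)"
  by (auto simp: laplacian_def average_cmult algebra_simps)

lemma pairing_laplacian:
  assumes "f \<in> Lp_space M 2" "g \<in> Lp_space M 2"
  shows "pairing M (laplacian f) g = pairing M f g - pairing M (cheb_op 1 f) g / 2"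
proof -
  have eq: "laplacian f = (\<lambda>x. f x - 1 / 2 * cheb_op 1 f x)" by (auto simp: laplacian_cheb)
  have "pairing M (laplacian f) g = pairing M f g - pairing M (\<lambda>x. 1 / 2 * cheb_op 1 f x) g"
    unfolding eq by (intro pairing_diff_left L2_cmult cheb_op_L2 assms)
  then show ?thesis unfolding pairing_cmult_left by simp
qed

lemma laplacian_sym:
  assumes "f \<in> Lp_space M 2" "g \<in> Lp_space M 2"
  shows "pairing M (laplacian f) g = pairing M f (laplacian g)"
proof -
  have "pairing M f (laplacian g) = cnj (pairing M (laplacian g) f)" by (simp add: pairing_cnj)
  then show ?thesis using assms cheb_op_sym[of f g 1] by (simp add: pairing_laplacian pairing_cnj)
qed

text \<open>The kernel of \<open>cheb_op 1\<close> has mass 2, so half of that operator is a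
  contraction, and the Laplacian is the identity minus this contraction.\<close>

lemma laplacian_bounds:
  assumes "f \<in> Lp_space M 2"
  shows "0 \<le> Re (pairing M (laplacian f) f)" "Re (pairing M (laplacian f) f) \<le> 2 * Re (pairing M f f)"
proof -
  let ?N = "Lp_norm M 2 f"
  let ?h = "\<lambda>x. 1 / 2 * cheb_op 1 f x"
  have "Lp_norm M 2 (cheb_op 1 f) \<le> 2 * ?N" using cheb_op_norm[OF assms, of 1] by simp
  moreover have "Lp_norm M 2 ?h = Lp_norm M 2 (cheb_op 1 f) / 2"
    by (simp add: Lp_norm_2 norm_divide power_divide real_sqrt_divide)
  ultimately have "(Lp_norm M 2 ?h)\<^sup>2 \<le> ?N\<^sup>2" by (intro power_mono) auto
  moreover have "cmod (pairing M ?h f) \<le> ((Lp_norm M 2 ?h)\<^sup>2 + ?N\<^sup>2) / 2"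
    by (intro pairing_bound L2_cmult cheb_op_L2 assms)
  moreover have "y \<le> (a + b) / 2 \<Longrightarrow> a \<le> b \<Longrightarrow> y \<le> b" for y a b :: real by simp
  ultimately have "cmod (pairing M ?h f) \<le> ?N\<^sup>2" by blast
  then have "\<bar>Re (pairing M (cheb_op 1 f) f / 2)\<bar> \<le> ?N\<^sup>2"
    using abs_Re_le_cmod[of "pairing M ?h f"] unfolding pairing_cmult_left by simp
  then show "0 \<le> Re (pairing M (laplacian f) f)" "Re (pairing M (laplacian f) f) \<le> 2 * Re (pairing M f f)"
    using assms by (simp_all add: pairing_laplacian pairing_self)
qed

sublocale half: unit_interval_operator m "\<lambda>f x. laplacian f x / 2"
proof
  have half: "(\<lambda>x. laplacian f x / 2) = (\<lambda>x. 1 / 2 * laplacian f x)" for f by simp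
  fix f g :: "'v \<Rightarrow> complex"
  show "(\<lambda>x. laplacian (\<lambda>x. f x - g x) x / 2) = (\<lambda>x. laplacian f x / 2 - laplacian g x / 2)"
    by (simp add: laplacian_diff diff_divide_distrib)
  assume f: "f \<in> Lp_space M 2"
  show "(\<lambda>x. laplacian f x / 2) \<in> Lp_space M 2" unfolding half by (intro L2_cmult laplacian_L2 f)
  show "0 \<le> Re (pairing M (\<lambda>x. laplacian f x / 2) f)"
    "Re (pairing M (\<lambda>x. laplacian f x / 2) f) \<le> Re (pairing M f f)"
    unfolding half pairing_cmult_left using laplacian_bounds[OF f] by simp_all
  assume g: "g \<in> Lp_space M 2"
  show "pairing M (\<lambda>x. laplacian f x / 2) g = pairing M f (\<lambda>x. laplacian g x / 2)"
    unfolding half pairing_cmult_left pairing_cmult_right using laplacian_sym[OF f g] by simp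
qed

lemma laplacian_pow_L2: "f \<in> Lp_space M 2 \<Longrightarrow> (laplacian ^^ n) f \<in> Lp_space M 2"
  by (induction n) (auto intro: laplacian_L2)

lemma laplacian_pow_sym:
  "f \<in> Lp_space M 2 \<Longrightarrow> g \<in> Lp_space M 2 \<Longrightarrow> pairing M ((laplacian ^^ n) f) g = pairing M f ((laplacian ^^ n) g)"
proof (induction n arbitrary: f g)
  case (Suc n)
  then show ?case
    by (simp add: laplacian_sym laplacian_pow_L2 laplacian_L2 funpow_swap1[of laplacian n g])
qed simp

lemma laplacian_pow_half: "((\<lambda>f x. laplacian f x / 2) ^^ n) f = (\<lambda>x. 1 / 2 ^ n * (laplacian ^^ n) f x)"
proof (induction n)
  case (Suc n)
  show ?case
  proof
    fix x
    have "((\<lambda>f x. laplacian f x / 2) ^^ Suc n) f x = laplacian (\<lambda>x. 1 / 2 ^ n * (laplacian ^^ n) f x) x / 2"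
      using Suc by simp
    then show "((\<lambda>f x. laplacian f x / 2) ^^ Suc n) f x = 1 / 2 ^ Suc n * (laplacian ^^ Suc n) f x"
      unfolding laplacian_cmult by simp
  qed
qed simp

text \<open>The definite description behind \<open>spectral_measure\<close> succeeds: existence
  comes from half the Laplacian by stretching its measure from [0, 1] to [0, 2], and uniqueness from
  the moments, against competitors supported in any bounded interval.\<close>

theorem spectral_measure_laplacian:
  assumes f: "f \<in> Lp_space M 2"
  defines "\<mu> \<equiv> spectral_measure M laplacian f"
  shows "sets \<mu> = sets borel" "finite_measure \<mu>" "AE t in \<mu>. 0 \<le> t \<and> t \<le> 2"
    and "complex_of_real (LINT t|\<mu>. t ^ n) = pairing M ((laplacian ^^ n) f) f"
proof -
  let ?P = "\<lambda>\<mu>. sets \<mu> = sets borel \<and> finite_measure \<mu> \<and> (\<exists>R. AE t in \<mu>. \<bar>t\<bar> \<le> R) \<and>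
    (\<forall>n. complex_of_real (LINT t|\<mu>. t ^ n) = pairing M ((laplacian ^^ n) f) f)"
  obtain \<nu> where \<nu>: "sets \<nu> = sets borel" "finite_measure \<nu>" "AE t in \<nu>. 0 \<le> t \<and> t \<le> 1"
    "\<And>n. (LINT t|\<nu>. t ^ n) = Re (pairing M (((\<lambda>f x. laplacian f x / 2) ^^ n) f) f)"
    using half.ex_spectral_measure[OF f] by auto
  have [measurable]: "(\<lambda>t. 2 * t) \<in> measurable \<nu> borel" 
    using \<nu>(1) by (simp add: measurable_cong_sets[OF \<nu>(1) refl])
  define \<rho> where "\<rho> = distr \<nu> borel (\<lambda>t. 2 * t)"
  have \<rho>: "sets \<rho> = sets borel" "finite_measure \<rho>" "AE t in \<rho>. 0 \<le> t \<and> t \<le> 2"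
  proof -
    show "AE t in \<rho>. 0 \<le> t \<and> t \<le> 2"
      unfolding \<rho>_def using \<nu>(3) by (subst AE_distr_iff) auto
  qed (use \<nu> in \<open>auto simp: \<rho>_def intro!: finite_measure.finite_measure_distr\<close>)
  have "complex_of_real (LINT t|\<rho>. t ^ n) = pairing M ((laplacian ^^ n) f) f" for n
  proof -
    \<comment> \<open>The moment problem was solved for real parts; by symmetry of the powers
      nothing is lost.\<close>
    have real: "complex_of_real (Re (pairing M ((laplacian ^^ n) f) f)) = pairing M ((laplacian ^^ n) f) f"
    proof -
      have "cnj (pairing M ((laplacian ^^ n) f) f) = pairing M ((laplacian ^^ n) f) f"
        using laplacian_pow_sym[OF f f, of n] by (simp add: pairing_cnj)
      then show ?thesis by (simp add: complex_eq_iff)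
    qed
    have "(LINT t|\<rho>. t ^ n) = (LINT t|\<nu>. (2 * t) ^ n)"
      unfolding \<rho>_def by (intro integral_distr) auto
    also have "\<dots> = 2 ^ n * (LINT t|\<nu>. t ^ n)" by (simp add: power_mult_distrib)
    also have "\<dots> = Re (pairing M ((laplacian ^^ n) f) f)"
      unfolding \<nu>(4) laplacian_pow_half pairing_cmult_left
      by (simp add: Re_divide_of_real[of _ "2 ^ n", simplified])
    finally show ?thesis using real by simp
  qed
  moreover have \<rho>2: "AE t in \<rho>. \<bar>t\<bar> \<le> 2" using \<rho>(3) by eventually_elim auto
  ultimately have P: "?P \<rho>" using \<rho> by blast
  have "\<mu> = \<rho>" unfolding \<mu>_def spectral_measure_def
  proof (rule the_equality[where P = ?P, OF P])
    fix \<sigma> assume \<sigma>: "?P \<sigma>"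
    then obtain R where "AE t in \<sigma>. \<bar>t\<bar> \<le> R" by auto
    moreover have "(LINT t|\<sigma>. t ^ n) = (LINT t|\<rho>. t ^ n)" for n
      using P \<sigma> by (metis of_real_eq_iff)
    ultimately show "\<sigma> = \<rho>" using \<sigma> \<rho> \<rho>2 by (intro moments_determine_measure[of _ R _ 2]) auto
  qed
  then show "sets \<mu> = sets borel" "finite_measure \<mu>" "AE t in \<mu>. 0 \<le> t \<and> t \<le> 2"
    and "complex_of_real (LINT t|\<mu>. t ^ n) = pairing M ((laplacian ^^ n) f) f"
    using \<rho> P by auto
qed

end

section \<open>Functional calculus by Chebyshev expansions\<close>

fun cheb_U :: "nat \<Rightarrow> real \<Rightarrow> real" where
  "cheb_U 0 x = 1"
| "cheb_U (Suc 0) x = 2 * x"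
| "cheb_U (Suc (Suc n)) x = 2 * x * cheb_U (Suc n) x - cheb_U n x"

text \<open>The scalar counterpart of the recursion for \<open>cheb_op\<close>, with a b = 1 in the
  role of \<open>S\<^sup>* S = 1\<close>. It exhibits \<open>cheb_U n (cos \<theta>)\<close> as a
  sum of n + 1 numbers of modulus 1.\<close>

lemma geometric_three_term:
  fixes a b :: complex
  assumes "a * b = 1"
  shows "(\<Sum>k\<le>Suc (Suc n). a ^ k * b ^ (Suc (Suc n) - k))
     = (a + b) * (\<Sum>k\<le>Suc n. a ^ k * b ^ (Suc n - k)) - (\<Sum>k\<le>n. a ^ k * b ^ (n - k))"
proof -
  have 1: "(\<Sum>k\<le>Suc (Suc n). a ^ k * b ^ (Suc (Suc n) - k))
     = b ^ Suc (Suc n) + a * (\<Sum>k\<le>Suc n. a ^ k * b ^ (Suc n - k))"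
    by (subst sum.atMost_Suc_shift) (simp add: sum_distrib_left mult_ac distrib_left)
  have "(\<Sum>k\<le>n. a ^ k * b ^ (n - k)) = (\<Sum>k\<le>n. (a * b) * (a ^ k * b ^ (n - k)))"
    using assms by simp
  then have 2: "b * (\<Sum>k\<le>Suc n. a ^ k * b ^ (Suc n - k)) = b ^ Suc (Suc n) + (\<Sum>k\<le>n. a ^ k * b ^ (n - k))"
    by (subst sum.atMost_Suc_shift) (simp add: sum_distrib_left mult_ac distrib_left)
  show ?thesis unfolding 1 distrib_right 2 by simp
qed

lemma cheb_U_cos: "complex_of_real (cheb_U n (cos \<theta>)) = (\<Sum>k\<le>n. cis \<theta> ^ k * cis (-\<theta>) ^ (n - k))"
proof (induction n "cos \<theta>" rule: cheb_U.induct)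
  case (3 n)
  have "cis \<theta> * cis (-\<theta>) = 1" "cis \<theta> + cis (-\<theta>) = 2 * cos \<theta>"
    by (auto simp: cis_mult complex_eq_iff)
  then show ?case using 3 geometric_three_term[of "cis \<theta>" "cis (-\<theta>)" n] by simp
qed (auto simp: complex_eq_iff)

lemma abs_cheb_U_le:
  assumes "\<bar>x\<bar> \<le> 1"
  shows "\<bar>cheb_U n x\<bar> \<le> real n + 1"
proof -
  have x: "x = cos (arccos x)" using assms by simp
  have "\<bar>cheb_U n x\<bar> = cmod (complex_of_real (cheb_U n (cos (arccos x))))" using x by simp
  also have "\<dots> \<le> (\<Sum>k\<le>n. cmod (cis (arccos x) ^ k * cis (- arccos x) ^ (n - k)))"
    unfolding cheb_U_cos by (rule norm_sum)
  also have "\<dots> = real n + 1" by (simp add: norm_mult norm_power)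
  finally show ?thesis .
qed

lemma cheb_U_sin: "cheb_U n (cos \<theta>) * sin \<theta> = sin (real (Suc n) * \<theta>)"
proof (induction n "cos \<theta>" rule: cheb_U.induct)
  case (3 n)
  have "sin (real (Suc (Suc (Suc n))) * \<theta>) + sin (real (Suc n) * \<theta>)
      = 2 * cos \<theta> * sin (real (Suc (Suc n)) * \<theta>)"
    using sin_add[of "real (Suc (Suc n)) * \<theta>" \<theta>] sin_diff[of "real (Suc (Suc n)) * \<theta>" \<theta>]
    by (simp add: algebra_simps)
  then show ?case using 3 by (simp add: algebra_simps)
qed (auto simp: sin_double)

lemma continuous_cheb_U: "continuous_on S (cheb_U n)"
proof -
  have "continuous_on UNIV (cheb_U n)"
  proof (induction n rule: induct_nat_012)
    case (ge2 n)
    have "cheb_U (Suc (Suc n)) = (\<lambda>x. 2 * x * cheb_U (Suc n) x - cheb_U n x)" by auto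
    then show ?case using ge2 by (auto intro!: continuous_intros)
  next
    case 1
    have "cheb_U (Suc 0) = (\<lambda>x. 2 * x)" by auto
    then show ?case by (auto intro!: continuous_intros)
  next
    case 0
    have "cheb_U 0 = (\<lambda>x. 1)" by auto
    then show ?case by auto
  qed
  then show ?thesis by (rule continuous_on_subset) simp
qed

context positive_weight
begin

lemma kernel_op_linear:
  assumes k: "schur_kernel B k" and "f \<in> Lp_space M 2" "h \<in> Lp_space M 2"
  shows "kernel_op k (\<lambda>x. f x + c * h x) = (\<lambda>x. kernel_op k f x + c * kernel_op k h x)"
proof
  fix x
  have "integrable M (\<lambda>y. k x y * f y)" "integrable M (\<lambda>y. k x y * h y)"
    using schur_kernel_pointwise(1)[OF k, of 2] assms by auto
  moreover have "(\<lambda>y. k x y * (f y + c * h y)) = (\<lambda>y. k x y * f y + c * (k x y * h y))"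
    by (simp add: algebra_simps)
  ultimately show "kernel_op k (\<lambda>x. f x + c * h x) x = kernel_op k f x + c * kernel_op k h x"
    by (simp add: kernel_op_def)
qed

lemma kernel_op_L2:
  assumes "schur_kernel B k" "f \<in> Lp_space M 2"
  shows "kernel_op k f \<in> Lp_space M 2"
  using kernel_op_Lp(1)[OF assms(1), of 2 f] assms(2) by simp

text \<open>Dividing the operator by B makes it a contraction, after which the arithmetic-geometric
  bound applies. What matters is that the bound is linear in B, so that it tends to 0 along tails of
  a series.\<close>

lemma kernel_op_pairing_bound:
  assumes k: "schur_kernel B k" and f: "f \<in> Lp_space M 2" and g: "g \<in> Lp_space M 2"
  shows "cmod (pairing M (kernel_op k f) g) \<le> B * ((Lp_norm M 2 f)\<^sup>2 + (Lp_norm M 2 g)\<^sup>2)"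
proof (cases "B = 0")
  case True
  then have "k x y = 0" for x y using schur_kernelD(6)[OF k, of x y] by simp
  then show ?thesis using True by (simp add: pairing_def kernel_op_def)
next
  case False
  then have B: "B > 0" using schur_kernelD(2)[OF k] by simp
  let ?h = "\<lambda>x. complex_of_real (1 / B) * kernel_op k f x"
  have h: "?h \<in> Lp_space M 2" by (intro L2_cmult kernel_op_L2[OF k] f)
  have "Lp_norm M 2 ?h = Lp_norm M 2 (kernel_op k f) / B"
    using B by (simp add: Lp_norm_2 norm_divide power_divide real_sqrt_divide)
  also have "\<dots> \<le> Lp_norm M 2 f"
    using kernel_op_Lp(2)[OF k, of 2 f] f B by (simp add: divide_le_eq mult.commute)
  finally have le: "(Lp_norm M 2 ?h)\<^sup>2 \<le> (Lp_norm M 2 f)\<^sup>2" by (intro power_mono) auto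
  have "pairing M (kernel_op k f) g = of_real B * pairing M ?h g"
    unfolding pairing_cmult_left using B by simp
  then have "cmod (pairing M (kernel_op k f) g) = B * cmod (pairing M ?h g)"
    using B by (simp add: norm_mult)
  also have "cmod (pairing M ?h g) \<le> ((Lp_norm M 2 ?h)\<^sup>2 + (Lp_norm M 2 g)\<^sup>2) / 2"
    by (rule pairing_bound[OF h g])
  also have "\<dots> \<le> (Lp_norm M 2 f)\<^sup>2 + (Lp_norm M 2 g)\<^sup>2"
  proof -
    have "a \<le> c \<Longrightarrow> 0 \<le> c \<Longrightarrow> 0 \<le> b \<Longrightarrow> (a + b) / 2 \<le> c + b" for a b c :: real by simp
    from this[OF le] show ?thesis by simp
  qed
  finally show ?thesis using B by simp
qed

end

section \<open>Absolutely summable Chebyshev series of the Laplacian\<close>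

context flow
begin

definition multiplier_kernel :: "(nat \<Rightarrow> complex) \<Rightarrow> 'v \<Rightarrow> 'v \<Rightarrow> complex" where
  "multiplier_kernel d x y = (\<Sum>n. d n * of_real (cheb_kernel n x y))"

text \<open>A weighted analogue of the norm of the Wiener algebra; the weight n + 1 is the Schur
  bound of \<open>cheb_kernel n\<close>.\<close>

definition wiener_norm :: "(nat \<Rightarrow> complex) \<Rightarrow> real" where
  "wiener_norm d = (\<Sum>n. (real n + 1) * cmod (d n))"

definition wiener :: "(nat \<Rightarrow> complex) \<Rightarrow> bool" where
  "wiener d \<longleftrightarrow> summable (\<lambda>n. (real n + 1) * cmod (d n))"

lemma wiener_kernel_summable:
  assumes "wiener d"
  shows "summable (\<lambda>n. cmod (d n) * cheb_kernel n x y)"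
proof (rule summable_comparison_test')
  show "summable (\<lambda>n. ((real n + 1) * cmod (d n)) / m x)"
    using assms unfolding wiener_def by (rule summable_divide)
  show "norm (cmod (d n) * cheb_kernel n x y) \<le> ((real n + 1) * cmod (d n)) / m x" for n
    using mult_left_mono[OF cheb_kernel_le[of n x y], of "cmod (d n)"] by (simp add: mult_ac)
qed

lemma multiplier_kernel_schur:
  assumes d: "wiener d"
  shows "schur_kernel (wiener_norm d) (multiplier_kernel d)"
  unfolding schur_kernel_def
proof (intro conjI allI)
  show "multiplier_kernel d x y = multiplier_kernel d y x" for x y
    unfolding multiplier_kernel_def by (simp add: cheb_kernel_sym[of _ x y])
  show "0 \<le> wiener_norm d"
    using d unfolding wiener_norm_def wiener_def by (intro suminf_nonneg) auto
  fix x
  have "(\<integral>\<^sup>+y. cmod (multiplier_kernel d x y) \<partial>M) \<le> (\<integral>\<^sup>+y. (\<Sum>n. ennreal (cmod (d n) * cheb_kernel n x y)) \<partial>M)"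
  proof (rule nn_integral_mono)
    fix y
    have s: "summable (\<lambda>n. cmod (d n * of_real (cheb_kernel n x y)))"
      using wiener_kernel_summable[OF d, of x y] by (simp add: norm_mult)
    have "cmod (multiplier_kernel d x y) \<le> (\<Sum>n. cmod (d n) * cheb_kernel n x y)"
      unfolding multiplier_kernel_def using summable_norm[OF s] by (simp add: norm_mult)
    then have "ennreal (cmod (multiplier_kernel d x y)) \<le> ennreal (\<Sum>n. cmod (d n) * cheb_kernel n x y)"
      by (rule ennreal_leI)
    also have "\<dots> = (\<Sum>n. ennreal (cmod (d n) * cheb_kernel n x y))"
      by (intro suminf_ennreal2[symmetric] wiener_kernel_summable d) auto
    finally show "ennreal (cmod (multiplier_kernel d x y)) \<le> (\<Sum>n. ennreal (cmod (d n) * cheb_kernel n x y))" .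
  qed
  also have "\<dots> = (\<Sum>n. \<integral>\<^sup>+y. ennreal (cmod (d n) * cheb_kernel n x y) \<partial>M)"
    by (rule nn_integral_suminf) simp
  also have "\<dots> = (\<Sum>n. ennreal ((real n + 1) * cmod (d n)))"
  proof (intro arg_cong[where f = suminf] ext)
    fix n
    have "has_bochner_integral M (\<lambda>y. cmod (d n) * cheb_kernel n x y) (cmod (d n) * (real n + 1))"
      by (intro has_bochner_integral_mult_right cheb_kernel_integral)
    then show "(\<integral>\<^sup>+y. ennreal (cmod (d n) * cheb_kernel n x y) \<partial>M) = ennreal ((real n + 1) * cmod (d n))"
      by (subst nn_integral_eq_integral) (auto simp: has_bochner_integral_iff mult.commute)
  qed
  also have "\<dots> = ennreal (wiener_norm d)"
    unfolding wiener_norm_def using d[unfolded wiener_def] by (intro suminf_ennreal2) auto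
  finally show "(\<integral>\<^sup>+y. ennreal (cmod (multiplier_kernel d x y)) \<partial>M) \<le> ennreal (wiener_norm d)" .
qed

text \<open>The remainder after N terms is again the operator of a multiplier kernel, whose Wiener
  norm is a tail of a convergent series.\<close>

lemma multiplier_pairing_sums:
  assumes d: "wiener d" and f: "f \<in> Lp_space M 2" and g: "g \<in> Lp_space M 2"
  shows "(\<lambda>n. d n * pairing M (cheb_op n f) g) sums pairing M (kernel_op (multiplier_kernel d) f) g"
proof -
  \<comment> \<open>The coefficients from index N on.\<close>
  define t where "t N = (\<lambda>n. if n < N then 0 else d n)" for N
  have tle: "norm ((real n + 1) * cmod (t N n)) \<le> (real n + 1) * cmod (d n)" for n N
    by (simp add: t_def)
  have t: "wiener (t N)" for N
    unfolding wiener_def by (rule summable_comparison_test'[OF d[unfolded wiener_def] tle])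
  have tail: "wiener_norm d = (\<Sum>n<N. (real n + 1) * cmod (d n)) + wiener_norm (t N)" for N
  proof -
    have "(\<lambda>n. (if n < N then (real n + 1) * cmod (d n) else 0) + (real n + 1) * cmod (t N n))
       sums ((\<Sum>n<N. (real n + 1) * cmod (d n)) + wiener_norm (t N))"
      using sums_If_finite_set[of "{..<N}" "\<lambda>n. (real n + 1) * cmod (d n)"] t[of N]
      unfolding wiener_norm_def wiener_def by (intro sums_add) (auto simp: summable_sums)
    moreover have "(\<lambda>n. (if n < N then (real n + 1) * cmod (d n) else 0) + (real n + 1) * cmod (t N n))
       = (\<lambda>n. (real n + 1) * cmod (d n))" by (auto simp: t_def)
    ultimately show ?thesis unfolding wiener_norm_def by (simp add: sums_iff)
  qed
  have split: "kernel_op (multiplier_kernel d) f x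
     = (\<Sum>n<N. d n * cheb_op n f x) + kernel_op (multiplier_kernel (t N)) f x" for N x
  proof -
    have "multiplier_kernel d x y = (\<Sum>n<N. d n * of_real (cheb_kernel n x y)) + multiplier_kernel (t N) x y" for y
    proof -
      have s: "summable (\<lambda>n. t N n * of_real (cheb_kernel n x y))"
        using wiener_kernel_summable[OF t[of N], of x y]
        by - (rule summable_norm_cancel, simp add: norm_mult)
      have "(\<lambda>n. (if n < N then d n * of_real (cheb_kernel n x y) else 0) + t N n * of_real (cheb_kernel n x y))
         sums ((\<Sum>n<N. d n * of_real (cheb_kernel n x y)) + multiplier_kernel (t N) x y)"
        using sums_If_finite_set[of "{..<N}" "\<lambda>n. d n * of_real (cheb_kernel n x y)"] s
        unfolding multiplier_kernel_def by (intro sums_add) (auto simp: summable_sums)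
      moreover have "(\<lambda>n. (if n < N then d n * of_real (cheb_kernel n x y) else 0) + t N n * of_real (cheb_kernel n x y))
         = (\<lambda>n. d n * of_real (cheb_kernel n x y))" by (auto simp: t_def)
      ultimately show ?thesis unfolding multiplier_kernel_def[of d] by (simp add: sums_iff)
    qed
    then have eq: "multiplier_kernel d x y * f y = (\<Sum>n<N. d n * (of_real (cheb_kernel n x y) * f y))
        + multiplier_kernel (t N) x y * f y" for y
      by (simp add: distrib_right sum_distrib_right mult.assoc)
    have i: "integrable M (\<lambda>y. of_real (cheb_kernel n x y) * f y)" for n
      using schur_kernel_pointwise(1)[OF cheb_kernel_schur[of n], of 2 f] f by simp
    have j: "integrable M (\<lambda>y. multiplier_kernel (t N) x y * f y)"
      using schur_kernel_pointwise(1)[OF multiplier_kernel_schur[OF t], of 2 f] f by simp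
    have "kernel_op (multiplier_kernel d) f x = (\<Sum>n<N. d n * (LINT y|M. of_real (cheb_kernel n x y) * f y))
       + kernel_op (multiplier_kernel (t N)) f x"
      unfolding kernel_op_def eq using i j by (simp add: Bochner_Integration.integral_sum)
    moreover have "(LINT y|M. of_real (cheb_kernel n x y) * f y) = cheb_op n f x" for n
      unfolding cheb_op_kernel[symmetric] by (simp add: kernel_op_def)
    ultimately show ?thesis by simp
  qed
  have sum_L2: "(\<lambda>x. \<Sum>n<N. d n * cheb_op n f x) \<in> Lp_space M 2 \<and>
    pairing M (\<lambda>x. \<Sum>n<N. d n * cheb_op n f x) g = (\<Sum>n<N. d n * pairing M (cheb_op n f) g)" for N
  proof (induction N)
    case 0
    then show ?case by (simp add: L2_iff pairing_def)
  next
    case (Suc N)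
    then show ?case
      using f g by (auto simp: L2_add L2_cmult cheb_op_L2 pairing_add_left pairing_cmult_left)
  qed
  let ?c = "(Lp_norm M 2 f)\<^sup>2 + (Lp_norm M 2 g)\<^sup>2"
  have bound: "cmod ((\<Sum>n<N. d n * pairing M (cheb_op n f) g) - pairing M (kernel_op (multiplier_kernel d) f) g)
      \<le> (wiener_norm d - (\<Sum>n<N. (real n + 1) * cmod (d n))) * ?c" for N
  proof -
    have "pairing M (kernel_op (multiplier_kernel d) f) g = (\<Sum>n<N. d n * pairing M (cheb_op n f) g)
       + pairing M (kernel_op (multiplier_kernel (t N)) f) g"
      unfolding split[of _ N] using sum_L2[of N] kernel_op_L2[OF multiplier_kernel_schur[OF t] f, of N] g
      by (subst pairing_add_left) auto
    then show ?thesis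
      using kernel_op_pairing_bound[OF multiplier_kernel_schur[OF t] f g, of N] tail[of N] by simp
  qed
  have lim: "(\<lambda>N. (wiener_norm d - (\<Sum>n<N. (real n + 1) * cmod (d n))) * ?c) \<longlonglongrightarrow> (wiener_norm d - wiener_norm d) * ?c"
    using d unfolding wiener_norm_def wiener_def by (intro tendsto_intros summable_LIMSEQ)
  have "(\<lambda>N. (\<Sum>n<N. d n * pairing M (cheb_op n f) g) - pairing M (kernel_op (multiplier_kernel d) f) g) \<longlonglongrightarrow> 0"
    by (rule Lim_null_comparison[OF always_eventually]) (use bound lim in auto)
  then show ?thesis unfolding sums_def by (simp add: LIM_zero_iff)
qed

section \<open>Spectral integrals of Chebyshev series\<close>

lemma spectral_measure_integrable:
  fixes g :: "real \<Rightarrow> 'b::{banach, second_countable_topology}"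
  assumes f: "f \<in> Lp_space M 2" and g: "continuous_on UNIV g"
  shows "integrable (spectral_measure M laplacian f) g"
proof -
  note \<mu> = spectral_measure_laplacian[OF f]
  interpret finite_measure "spectral_measure M laplacian f" by (rule \<mu>(2))
  have "bounded (g ` {0..2})"
    using g by (intro compact_imp_bounded compact_continuous_image) (auto intro: continuous_on_subset)
  then obtain b where "\<forall>y\<in>g ` {0..2}. norm y \<le> b" unfolding bounded_iff by blast
  then have b: "0 \<le> t \<Longrightarrow> t \<le> 2 \<Longrightarrow> norm (g t) \<le> b" for t by auto
  show ?thesis
  proof (rule integrable_const_bound)
    show "AE t in spectral_measure M laplacian f. norm (g t) \<le> b"
      using \<mu>(3) by eventually_elim (use b in auto)
    show "g \<in> borel_measurable (spectral_measure M laplacian f)"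
      using borel_measurable_continuous_onI[OF g] by (simp add: measurable_cong_sets[OF \<mu>(1) refl])
  qed
qed

text \<open>The factor \<open>t ^ j\<close> is there for the induction: the recursion for
  \<open>cheb_U\<close> at 1 - t multiplies by t, and this has to be matched by one more application
  of the Laplacian.\<close>

lemma spectral_measure_cheb:
  assumes f: "f \<in> Lp_space M 2"
  defines "\<mu> \<equiv> spectral_measure M laplacian f"
  shows "complex_of_real (LINT t|\<mu>. t ^ j * cheb_U n (1 - t)) = pairing M ((laplacian ^^ j) (cheb_op n f)) f"
proof (induction n arbitrary: j rule: induct_nat_012)
  case 0
  have "cheb_op 0 f = f" by (auto simp: cheb_op_0)
  then show ?case using spectral_measure_laplacian(4)[OF f, of j] by (simp add: \<mu>_def)
next
  have lin: "(laplacian ^^ j) (\<lambda>x. 2 * h x - 2 * laplacian h x - k x)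
     = (\<lambda>x. 2 * (laplacian ^^ j) h x - 2 * (laplacian ^^ Suc j) h x - (laplacian ^^ j) k x)" for j h k
    by (induction j) (auto simp: laplacian_diff laplacian_cmult)
  have pair: "pairing M (\<lambda>x. 2 * u x - 2 * v x - w x) f = 2 * pairing M u f - 2 * pairing M v f - pairing M w f"
    if "u \<in> Lp_space M 2" "v \<in> Lp_space M 2" "w \<in> Lp_space M 2" for u v w
    using that f by (simp add: pairing_diff_left L2_diff L2_cmult pairing_cmult_left)
  have int: "integrable \<mu> (\<lambda>t. t ^ j * cheb_U n (1 - t))" for j n
    unfolding \<mu>_def by (intro spectral_measure_integrable f)
       (auto intro!: continuous_intros continuous_on_compose2[OF continuous_cheb_U])
  {
    case 1
    \<comment> \<open>The subtracted 0 brings the first polynomial into the three-term form, so that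
      the same linearity statement covers it.\<close>
    have "cheb_op (Suc 0) f = (\<lambda>x. 2 * f x - 2 * laplacian f x - 0)"
      using cheb_op_1 by (auto simp: fun_eq_iff)
    then have "pairing M ((laplacian ^^ j) (cheb_op (Suc 0) f)) f
      = 2 * pairing M ((laplacian ^^ j) f) f - 2 * pairing M ((laplacian ^^ Suc j) f) f - pairing M ((laplacian ^^ j) (\<lambda>_. 0)) f"
      by (simp only: lin) (intro pair laplacian_pow_L2 f, simp add: L2_iff)
    moreover have "(laplacian ^^ j) (\<lambda>_. 0) = (\<lambda>_. 0)" for j
      by (induction j) (auto simp: laplacian_def average_def)
    moreover have "(LINT t|\<mu>. t ^ j * cheb_U (Suc 0) (1 - t)) = 2 * (LINT t|\<mu>. t ^ j) - 2 * (LINT t|\<mu>. t ^ Suc j)"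
    proof -
      have "(\<lambda>t. t ^ j * cheb_U (Suc 0) (1 - t)) = (\<lambda>t. 2 * t ^ j - 2 * t ^ Suc j)"
        by (auto simp: algebra_simps)
      then show ?thesis using int[of j 0] int[of "Suc j" 0] by simp
    qed
    ultimately show ?case
      using spectral_measure_laplacian(4)[OF f, of j] spectral_measure_laplacian(4)[OF f, of "Suc j"]
      by (simp add: \<mu>_def pairing_def)
  next
    case (ge2 n)
    have "cheb_op (Suc (Suc n)) f = (\<lambda>x. 2 * cheb_op (Suc n) f x - 2 * laplacian (cheb_op (Suc n) f) x - cheb_op n f x)"
      using cheb_op_Suc_Suc by auto
    then have "pairing M ((laplacian ^^ j) (cheb_op (Suc (Suc n)) f)) f
      = 2 * pairing M ((laplacian ^^ j) (cheb_op (Suc n) f)) f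
        - 2 * pairing M ((laplacian ^^ Suc j) (cheb_op (Suc n) f)) f - pairing M ((laplacian ^^ j) (cheb_op n f)) f"
      by (simp only: lin) (intro pair laplacian_pow_L2 cheb_op_L2 f)
    also have "\<dots> = complex_of_real (2 * (LINT t|\<mu>. t ^ j * cheb_U (Suc n) (1 - t))
      - 2 * (LINT t|\<mu>. t ^ Suc j * cheb_U (Suc n) (1 - t)) - (LINT t|\<mu>. t ^ j * cheb_U n (1 - t)))"
      by (simp only: ge2[symmetric]) simp
    also have "2 * (LINT t|\<mu>. t ^ j * cheb_U (Suc n) (1 - t))
      - 2 * (LINT t|\<mu>. t ^ Suc j * cheb_U (Suc n) (1 - t)) - (LINT t|\<mu>. t ^ j * cheb_U n (1 - t))
      = (LINT t|\<mu>. t ^ j * cheb_U (Suc (Suc n)) (1 - t))"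
    proof -
      have "(\<lambda>t. t ^ j * cheb_U (Suc (Suc n)) (1 - t)) = (\<lambda>t. 2 * (t ^ j * cheb_U (Suc n) (1 - t))
        - 2 * (t ^ Suc j * cheb_U (Suc n) (1 - t)) - t ^ j * cheb_U n (1 - t))"
        by (auto simp: algebra_simps)
      then show ?thesis using int[of j "Suc n"] int[of "Suc j" "Suc n"] int[of j n] by simp
    qed
    finally show ?case by simp
  }
qed

text \<open>The spectral measure is carried by [0, 2], where the n-th term of the expansion is at
  most (n + 1) \<bar>d n\<bar>, so the series may be integrated term by term; the kernel operator
  has the same series of pairings.\<close>

lemma spectral_measure_multiplier:
  assumes d: "wiener d" and F: "continuous_on UNIV F"
    and exp: "\<And>t. 0 \<le> t \<Longrightarrow> t \<le> 2 \<Longrightarrow> (\<lambda>n. d n * of_real (cheb_U n (1 - t))) sums F t"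
    and f: "f \<in> Lp_space M 2"
  shows "(LINT t|spectral_measure M laplacian f. F t) = pairing M (kernel_op (multiplier_kernel d) f) f"
proof -
  define \<mu> where "\<mu> = spectral_measure M laplacian f"
  note \<mu> = spectral_measure_laplacian[OF f, folded \<mu>_def]
  interpret finite_measure \<mu> by (rule \<mu>(2))
  let ?h = "\<lambda>n t. d n * complex_of_real (cheb_U n (1 - t))"
  have cont: "continuous_on UNIV (\<lambda>t. cheb_U n (1 - t))" for n
    by (auto intro!: continuous_intros continuous_on_compose2[OF continuous_cheb_U])
  have int: "integrable \<mu> (?h n)" for n
    unfolding \<mu>_def by (intro spectral_measure_integrable f continuous_intros cont)
  have le: "norm (?h n t) \<le> (real n + 1) * cmod (d n)" if "0 \<le> t" "t \<le> 2" for n t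
    using mult_left_mono[OF abs_cheb_U_le[of "1 - t" n], of "cmod (d n)"] that
    by (simp add: norm_mult mult.commute)
  have sums: "(\<lambda>n. LINT t|\<mu>. ?h n t) sums (LINT t|\<mu>. (\<Sum>n. ?h n t))"
  proof (rule sums_integral[OF int])
    show "AE t in \<mu>. summable (\<lambda>n. norm (?h n t))"
      using \<mu>(3)
    proof eventually_elim
      case (elim t)
      then show ?case
        by (intro summable_comparison_test'[OF d[unfolded wiener_def]]) (use le in auto)
    qed
    have "norm (LINT t|\<mu>. norm (?h n t)) \<le> (real n + 1) * cmod (d n) * measure \<mu> (space \<mu>)" for n
    proof -
      have "(LINT t|\<mu>. norm (?h n t)) \<le> (LINT t|\<mu>. (real n + 1) * cmod (d n))"
      proof (intro integral_mono_AE integrable_norm int)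
        show "AE t in \<mu>. norm (?h n t) \<le> (real n + 1) * cmod (d n)"
          using \<mu>(3) by eventually_elim (use le in auto)
      qed auto
      also have "\<dots> = (real n + 1) * cmod (d n) * measure \<mu> (space \<mu>)" by simp
      finally show ?thesis by (simp add: integral_nonneg_AE)
    qed
    then show "summable (\<lambda>n. LINT t|\<mu>. norm (?h n t))"
      by (rule summable_comparison_test'[OF summable_mult2[OF d[unfolded wiener_def]]])
  qed
  have moments: "(LINT t|\<mu>. ?h n t) = d n * pairing M (cheb_op n f) f" for n
    using spectral_measure_cheb[OF f, of 0 n] by (simp add: \<mu>_def)
  have sum: "(LINT t|\<mu>. (\<Sum>n. ?h n t)) = (LINT t|\<mu>. F t)"
  proof (rule integral_cong_AE)
    show "AE t in \<mu>. (\<Sum>n. ?h n t) = F t"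
      using \<mu>(3) by eventually_elim (use exp in \<open>auto simp: sums_iff\<close>)
    show "F \<in> borel_measurable \<mu>"
      using borel_measurable_continuous_onI[OF F] by (simp add: measurable_cong_sets[OF \<mu>(1) refl])
    have [measurable]: "(\<lambda>t. cheb_U n (1 - t)) \<in> borel_measurable borel" for n
      by (rule borel_measurable_continuous_onI[OF cont])
    show "(\<lambda>t. \<Sum>n. ?h n t) \<in> borel_measurable \<mu>"
      by (subst measurable_cong_sets[OF \<mu>(1) refl]) measurable
  qed
  from sums_unique2[OF sums[unfolded moments sum] multiplier_pairing_sums[OF d f f]] show ?thesis by (simp add: \<mu>_def)
qed

text \<open>Spectral integrals are known on the diagonal, polarization gives the form for all pairs,
  and testing against point masses identifies the vector that the calculus describes.\<close>

theorem borel_calculus_multiplier: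
  assumes d: "wiener d" and F: "continuous_on UNIV F"
    and exp: "\<And>t. 0 \<le> t \<Longrightarrow> t \<le> 2 \<Longrightarrow> (\<lambda>n. d n * of_real (cheb_U n (1 - t))) sums F t"
    and f: "f \<in> Lp_space M 2"
  shows "borel_calculus M laplacian F f = kernel_op (multiplier_kernel d) f"
proof -
  let ?T = "kernel_op (multiplier_kernel d)"
  note k = multiplier_kernel_schur[OF d]
  have T: "?T h \<in> Lp_space M 2" if "h \<in> Lp_space M 2" for h by (rule kernel_op_L2[OF k that])
  have form: "spectral_form M laplacian F f h = pairing M (?T f) h" if h: "h \<in> Lp_space M 2" for h
  proof -
    have *: "(LINT t|spectral_measure M laplacian (\<lambda>x. f x + c * h x). F t)
       = pairing M (?T f) f + c * pairing M (?T h) f + cnj c * pairing M (?T f) h + c * cnj c * pairing M (?T h) h" for c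
    proof -
      have "(LINT t|spectral_measure M laplacian (\<lambda>x. f x + c * h x). F t)
         = pairing M (\<lambda>x. ?T f x + c * ?T h x) (\<lambda>x. f x + c * h x)"
        using f h by (subst spectral_measure_multiplier[OF d F exp])
          (auto simp: L2_add L2_cmult kernel_op_linear[OF k f h])
      also have "\<dots> = pairing M (?T f) f + c * pairing M (?T h) f + cnj c * pairing M (?T f) h + c * cnj c * pairing M (?T h) h"
        using f h by (simp add: pairing_add_left pairing_add_right L2_add L2_cmult T
          pairing_cmult_left pairing_cmult_right algebra_simps)
      finally show ?thesis .
    qed
    \<comment> \<open>With c running through the powers of \<i> and the weights c, three of the four
      terms sum to 0 and the one with \<open>cnj c\<close> survives with factor 4.\<close>
    show ?thesis unfolding spectral_form_def * by (simp add: eval_nat_numeral algebra_simps)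
  qed
  show ?thesis
    unfolding borel_calculus_def
  proof (rule the_equality)
    fix g assume g: "g \<in> Lp_space M 2 \<and> (\<forall>h\<in>Lp_space M 2. pairing M g h = spectral_form M laplacian F f h)"
    show "g = ?T f"
    proof
      fix x
      have "pairing M g (indicator {x}) = pairing M (?T f) (indicator {x})"
        using g form delta_Lp[of 2 x] by simp
      then show "g x = ?T f x" by (simp add: pairing_delta)
    qed
  qed (use T f form in auto)
qed

end

section \<open>Boundedness on all Lebesgue spaces\<close>

context positive_weight
begin

text \<open>Convergence in the mean forces convergence at every point, each point having positive
  mass.\<close>

lemma L1_tendsto_unique:
  assumes "Lp_tendsto M 1 us u sequentially" "Lp_tendsto M 1 us v sequentially"
  shows "u = v"
proof
  fix x
  have le: "norm (us n x - w x) \<le> Lp_norm M 1 (\<lambda>x. us n x - w x) / m x"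
    if "(\<lambda>x. us n x - w x) \<in> Lp_space M 1" for w n
    using integral_ge_point[of "\<lambda>x. cmod (us n x - w x)" x] that
    by (simp add: L1_iff L1_norm field_simps)
  have lim: "(\<lambda>n. us n x) \<longlonglongrightarrow> w x" if "Lp_tendsto M 1 us w sequentially" for w
  proof -
    have "((\<lambda>n. Lp_norm M 1 (\<lambda>x. us n x - w x) / m x) \<longlonglongrightarrow> 0 / m x)"
      using that unfolding Lp_tendsto_def by (intro tendsto_divide) auto
    then have "((\<lambda>n. Lp_norm M 1 (\<lambda>x. us n x - w x) / m x) \<longlonglongrightarrow> 0)" by simp
    moreover have "\<forall>\<^sub>F n in sequentially. (\<lambda>x. us n x - w x) \<in> Lp_space M 1"
      using that unfolding Lp_tendsto_def by blast
    then have "\<forall>\<^sub>F n in sequentially. norm (us n x - w x) \<le> Lp_norm M 1 (\<lambda>x. us n x - w x) / m x"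
      by eventually_elim (rule le)
    ultimately have "(\<lambda>n. us n x - w x) \<longlonglongrightarrow> 0"
      by - (rule Lim_null_comparison)
    then show ?thesis by (simp add: LIM_zero_iff)
  qed
  show "u x = v x" using LIMSEQ_unique[OF lim[OF assms(1)] lim[OF assms(2)]] .
qed

end

context flow
begin

text \<open>Without such a sequence the condition in \<open>Lp_extension\<close> would be vacuous
  and would determine nothing. Restrictions to finite sets that exhaust the vertices serve, by
  dominated convergence.\<close>

lemma ex_L1_approximation:
  assumes f: "f \<in> Lp_space M 1"
  shows "\<exists>fs. (\<forall>n::nat. fs n \<in> Lp_space M 2 \<inter> Lp_space M 1) \<and> Lp_tendsto M 1 fs f sequentially"
proof -
  obtain e :: "nat \<Rightarrow> 'v" where e: "range e = UNIV"
    using range_from_nat_into[OF UNIV_not_empty countable_UNIV] by blast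
  define S where "S n = e ` {..<n}" for n
  define fs where "fs n y = (if y \<in> S n then f y else 0)" for n y
  have S: "finite (S n)" for n by (simp add: S_def)
  have fs: "fs n \<in> Lp_space M 2" "fs n \<in> Lp_space M 1" for n
  proof -
    have "(\<lambda>y. (cmod (fs n y))\<^sup>2) = (\<lambda>y. if y \<in> S n then (cmod (f y))\<^sup>2 else 0)" by (auto simp: fs_def)
    then show "fs n \<in> Lp_space M 2"
      using has_integral_finite_support[OF S[of n], of "\<lambda>y. (cmod (f y))\<^sup>2"]
      by (simp add: L2_iff has_bochner_integral_iff)
    show "fs n \<in> Lp_space M 1"
      using has_integral_finite_support[OF S[of n], of f]
      by (simp add: L1_iff has_bochner_integral_iff fs_def[abs_def])
  qed
  have diff: "(\<lambda>x. fs n x - f x) \<in> Lp_space M 1" for n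
    using fs(2)[of n] f by (simp add: L1_iff)
  have "(\<lambda>n. LINT x|M. cmod (fs n x - f x)) \<longlonglongrightarrow> (LINT x|M. 0)"
  proof (rule integral_dominated_convergence[where w = "\<lambda>x. cmod (f x)"])
    show "AE x in M. (\<lambda>n. cmod (fs n x - f x)) \<longlonglongrightarrow> 0"
    proof (simp, rule allI)
      fix x
      obtain k where "x = e k" using e by (metis rangeE UNIV_I)
      then have "x \<in> S n" if "n > k" for n using that by (auto simp: S_def)
      then have "eventually (\<lambda>n. cmod (fs n x - f x) = 0) sequentially"
        by (intro eventually_sequentiallyI[of "Suc k"]) (auto simp: fs_def)
      then show "(\<lambda>n. cmod (fs n x - f x)) \<longlonglongrightarrow> 0" by (rule tendsto_eventually)
    qed
  qed (use f in \<open>auto simp: L1_iff fs_def\<close>)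
  then have "Lp_tendsto M 1 fs f sequentially"
    unfolding Lp_tendsto_def L1_norm using diff by simp
  then show ?thesis using fs by blast
qed

lemma kernel_op_diff_L1:
  assumes k: "schur_kernel B k" and "f \<in> Lp_space M 1" "h \<in> Lp_space M 1"
  shows "kernel_op k (\<lambda>x. f x - h x) = (\<lambda>x. kernel_op k f x - kernel_op k h x)"
proof
  fix x
  have "integrable M (\<lambda>y. k x y * f y)" "integrable M (\<lambda>y. k x y * h y)"
    using schur_kernel_pointwise(1)[OF k, of 1] assms by auto
  then show "kernel_op k (\<lambda>x. f x - h x) x = kernel_op k f x - kernel_op k h x"
    by (simp add: kernel_op_def right_diff_distrib)
qed

text \<open>The kernel operator is bounded on the integrable functions, so it is a continuous
  extension; limits in the mean being unique, it is the only one.\<close>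

lemma Lp_extension_kernel_op:
  assumes k: "schur_kernel B k" and T: "\<And>f. f \<in> Lp_space M 2 \<Longrightarrow> T f = kernel_op k f"
    and f: "f \<in> Lp_space M 1"
  shows "Lp_extension M 1 T f = kernel_op k f"
proof -
  have L1: "kernel_op k h \<in> Lp_space M 1" "Lp_norm M 1 (kernel_op k h) \<le> B * Lp_norm M 1 h"
    if "h \<in> Lp_space M 1" for h
    using kernel_op_Lp[OF k, of 1 h] that by simp_all
  have conv: "Lp_tendsto M 1 (\<lambda>n. T (fs n)) (kernel_op k f) sequentially"
    if fs: "\<And>n. fs n \<in> Lp_space M 2 \<inter> Lp_space M 1" and lim: "Lp_tendsto M 1 fs f sequentially" for fs
  proof -
    have eq: "(\<lambda>x. T (fs n) x - kernel_op k f x) = kernel_op k (\<lambda>x. fs n x - f x)" for n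
      using fs f T kernel_op_diff_L1[OF k] by auto
    have diff: "(\<lambda>x. fs n x - f x) \<in> Lp_space M 1" for n
      using fs[of n] f by (auto simp: L1_iff)
    have "(\<lambda>n. B * Lp_norm M 1 (\<lambda>x. fs n x - f x)) \<longlonglongrightarrow> B * 0"
      using lim unfolding Lp_tendsto_def by (intro tendsto_mult_left) auto
    then have z: "(\<lambda>n. B * Lp_norm M 1 (\<lambda>x. fs n x - f x)) \<longlonglongrightarrow> 0" by simp
    have "(\<lambda>n. Lp_norm M 1 (kernel_op k (\<lambda>x. fs n x - f x))) \<longlonglongrightarrow> 0"
      by (rule tendsto_sandwich[OF _ _ tendsto_const z]) (use L1(2)[OF diff] in auto)
    then show ?thesis unfolding Lp_tendsto_def eq using L1(1)[OF diff] by simp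
  qed
  show ?thesis
    unfolding Lp_extension_def
  proof (rule the_equality)
    fix u assume u: "u \<in> Lp_space M 1 \<and> (\<forall>fs :: nat \<Rightarrow> 'v \<Rightarrow> complex.
       (\<forall>n. fs n \<in> Lp_space M 2 \<inter> Lp_space M 1) \<and> Lp_tendsto M 1 fs f sequentially \<longrightarrow>
         Lp_tendsto M 1 (\<lambda>n. T (fs n)) u sequentially)"
    obtain fs :: "nat \<Rightarrow> 'v \<Rightarrow> complex" where "\<And>n. fs n \<in> Lp_space M 2 \<inter> Lp_space M 1"
      "Lp_tendsto M 1 fs f sequentially" using ex_L1_approximation[OF f] by blast
    then show "u = kernel_op k f" using u conv by (intro L1_tendsto_unique[of "\<lambda>n. T (fs n)"]) auto
  qed (use L1 f conv in auto)
qed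

lemma Linf_adjoint_kernel_op:
  assumes k: "schur_kernel B k" and T: "\<And>g. g \<in> Lp_space M 1 \<Longrightarrow> T g = kernel_op (\<lambda>x y. cnj (k x y)) g"
    and f: "f \<in> Lp_space M top"
  shows "Linf_adjoint M T f = kernel_op k f"
  unfolding Linf_adjoint_def
proof (rule the_equality)
  have eq: "pairing M (kernel_op k f) g = pairing M f (T g)" if "g \<in> Lp_space M 1" for g
    using kernel_op_adjoint_L1[OF k f that] T[OF that] by simp
  then show "kernel_op k f \<in> Lp_space M top \<and> (\<forall>g\<in>Lp_space M 1. pairing M (kernel_op k f) g = pairing M f (T g))"
    using kernel_op_Linf(2)[OF k f] by simp
  fix h assume h: "h \<in> Lp_space M top \<and> (\<forall>g\<in>Lp_space M 1. pairing M h g = pairing M f (T g))"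
  show "h = kernel_op k f"
  proof
    fix x
    have "indicator {x} \<in> Lp_space M 1" using delta_Lp[of 1 x] by simp
    then have "pairing M h (indicator {x}) = pairing M (kernel_op k f) (indicator {x})"
      using h eq by simp
    then show "h x = kernel_op k f x" by (simp add: pairing_delta)
  qed
qed

theorem wiener_mult_bounds:
  assumes d: "wiener d" and F: "continuous_on UNIV F"
    and exp: "\<And>t. 0 \<le> t \<Longrightarrow> t \<le> 2 \<Longrightarrow> (\<lambda>n. d n * of_real (cheb_U n (1 - t))) sums F t"
    and q: "1 \<le> q"
  shows "wiener_norm d \<in> mult_bounds M laplacian F q"
proof -
  note k = multiplier_kernel_schur[OF d]
  show ?thesis
  proof (cases "q = top")
    case False
    then obtain r where r: "q = ennreal r" "0 \<le> r" by (metis ennreal_cases infinity_ennreal_def)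
    then have r1: "r \<ge> 1" using q by (simp add: ennreal_le_iff flip: ennreal_1)
    show ?thesis
      unfolding mult_bounds_def mult_operator_def mult_domain_def using False
      by (auto simp: borel_calculus_multiplier[OF d F exp] schur_kernelD(2)[OF k] r
        intro: kernel_op_Lp[OF k r1])
  next
    case True
    \<comment> \<open>The polynomials \<open>cheb_U n\<close> are real, so conjugating the
      multiplier conjugates its coefficients and its kernel. The adjoint conjugates the kernel once
      more and returns the original one.\<close>
    define d' where "d' n = cnj (d n)" for n
    have d': "wiener d'" using d by (simp add: wiener_def d'_def)
    have F': "continuous_on UNIV (\<lambda>t. cnj (F t))" using F by (intro continuous_intros)
    have exp': "(\<lambda>n. d' n * of_real (cheb_U n (1 - t))) sums cnj (F t)" if "0 \<le> t" "t \<le> 2" for t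
      using sums_cnj[THEN iffD2, OF exp[OF that]] by (simp add: d'_def)
    have kern: "multiplier_kernel d' = (\<lambda>x y. cnj (multiplier_kernel d x y))"
    proof (intro ext)
      fix x y
      have "summable (\<lambda>n. d n * of_real (cheb_kernel n x y))"
        using wiener_kernel_summable[OF d, of x y] by - (rule summable_norm_cancel, simp add: norm_mult)
      then have "(\<lambda>n. cnj (d n * of_real (cheb_kernel n x y))) sums cnj (multiplier_kernel d x y)"
        unfolding multiplier_kernel_def sums_cnj by (rule summable_sums)
      then show "multiplier_kernel d' x y = cnj (multiplier_kernel d x y)"
        by (simp add: multiplier_kernel_def[of d'] d'_def sums_iff)
    qed
    have "Lp_extension M 1 (borel_calculus M laplacian (\<lambda>t. cnj (F t))) g = kernel_op (multiplier_kernel d') g"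
      if "g \<in> Lp_space M 1" for g
      by (intro Lp_extension_kernel_op[OF multiplier_kernel_schur[OF d'] _ that]
        borel_calculus_multiplier[OF d' F' exp'])
    then have "Linf_adjoint M (Lp_extension M 1 (borel_calculus M laplacian (\<lambda>t. cnj (F t)))) f
        = kernel_op (multiplier_kernel d) f" if "f \<in> Lp_space M top" for f
      unfolding kern by (intro Linf_adjoint_kernel_op[OF k _ that])
    then show ?thesis
      unfolding mult_bounds_def mult_operator_def mult_domain_def
      using True kernel_op_Linf[OF k] schur_kernelD(2)[OF k] by auto
  qed
qed

lemma mult_norm_le:
  assumes "c \<in> mult_bounds N A F q" "c \<le> c'"
  shows "mult_bounded N A F q" "mult_norm N A F q \<le> c'"
proof -
  have "bdd_below (mult_bounds N A F q)" by (rule bdd_belowI[of _ 0]) (auto simp: mult_bounds_def)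
  then show "mult_norm N A F q \<le> c'"
    unfolding mult_norm_def using assms by (meson cInf_lower order_trans)
qed (use assms in \<open>auto simp: mult_bounded_def\<close>)

end

section \<open>Transfer to flow trees\<close>

lemma (in rooted_tree) flow_of_flow_tree:
  assumes "flow_tree E \<omega> m"
  shows "flow m p"
proof
  show "countable (UNIV :: 'v set)" by (rule countable_vertices)
  show "finite {y. p y = x}" for x by (rule finite_successors)
  show "0 < m x" "m x = (\<Sum>y | p y = x. m y)" for x
    using assms unfolding flow_tree_def successors_eq by blast+
qed

lemma (in rooted_tree) flow_laplacian_eq:
  assumes "flow_tree E \<omega> m"
  shows "flow_laplacian E \<omega> m = flow.laplacian m p"
proof (intro ext)
  interpret flow m p by (rule flow_of_flow_tree[OF assms])
  fix f x
  show "flow_laplacian E \<omega> m f x = laplacian f x"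
    unfolding laplacian_def average_def fibre_1 flow_laplacian_def successors_eq by simp
qed

section \<open>Fourier integrals\<close>

lemma cauchy_schwarz_integral:
  fixes f g :: "'a \<Rightarrow> real"
  assumes [measurable]: "f \<in> borel_measurable M" "g \<in> borel_measurable M"
    and f: "integrable M (\<lambda>x. (f x)\<^sup>2)" and g: "integrable M (\<lambda>x. (g x)\<^sup>2)"
  shows "integrable M (\<lambda>x. f x * g x)"
    and "(LINT x|M. \<bar>f x * g x\<bar>) \<le> sqrt (LINT x|M. (f x)\<^sup>2) * sqrt (LINT x|M. (g x)\<^sup>2)"
proof -
  have le: "\<bar>a * b\<bar> \<le> a\<^sup>2 + b\<^sup>2" for a b :: real
    using mult_le_sum_squares[of "\<bar>a\<bar>" "\<bar>b\<bar>"] by (simp add: abs_mult)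
  show i: "integrable M (\<lambda>x. f x * g x)"
    by (rule Bochner_Integration.integrable_bound[of _ "\<lambda>x. (f x)\<^sup>2 + (g x)\<^sup>2"]) (use f g le in auto)
  have "(\<integral>\<^sup>+x. ennreal \<bar>f x\<bar> * ennreal \<bar>g x\<bar> \<partial>M)\<^sup>2
      \<le> (\<integral>\<^sup>+x. (ennreal \<bar>f x\<bar>)\<^sup>2 \<partial>M) * (\<integral>\<^sup>+x. (ennreal \<bar>g x\<bar>)\<^sup>2 \<partial>M)"
    by (rule Cauchy_Schwarz_nn_integral) auto
  also have "(\<integral>\<^sup>+x. (ennreal \<bar>f x\<bar>)\<^sup>2 \<partial>M) = ennreal (LINT x|M. (f x)\<^sup>2)"
    using nn_integral_eq_integral[OF f] by (simp add: ennreal_power)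
  also have "(\<integral>\<^sup>+x. (ennreal \<bar>g x\<bar>)\<^sup>2 \<partial>M) = ennreal (LINT x|M. (g x)\<^sup>2)"
    using nn_integral_eq_integral[OF g] by (simp add: ennreal_power)
  also have "(\<integral>\<^sup>+x. ennreal \<bar>f x\<bar> * ennreal \<bar>g x\<bar> \<partial>M) = ennreal (LINT x|M. \<bar>f x * g x\<bar>)"
    using nn_integral_eq_integral[OF integrable_abs[OF i]] by (simp add: ennreal_mult abs_mult)
  finally have "(LINT x|M. \<bar>f x * g x\<bar>)\<^sup>2 \<le> (LINT x|M. (f x)\<^sup>2) * (LINT x|M. (g x)\<^sup>2)"
    by (simp add: ennreal_power ennreal_mult'[symmetric] integral_nonneg_AE)
  then show "(LINT x|M. \<bar>f x * g x\<bar>) \<le> sqrt (LINT x|M. (f x)\<^sup>2) * sqrt (LINT x|M. (g x)\<^sup>2)"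
    unfolding real_sqrt_mult[symmetric] by (rule real_le_rsqrt)
qed

lemma borel_measurable_cis [measurable]: "cis \<in> borel_measurable borel"
  by (intro borel_measurable_continuous_onI continuous_intros)

lemma borel_measurable_cnj [measurable]: "cnj \<in> borel_measurable borel"
  by (intro borel_measurable_continuous_onI continuous_intros)

lemma fubini_bounded_kernel:
  fixes f g :: "real \<Rightarrow> complex" and k :: "real \<Rightarrow> real \<Rightarrow> complex"
  assumes f: "integrable lborel f" and g: "integrable lborel g"
    and [measurable]: "case_prod k \<in> borel_measurable (borel \<Otimes>\<^sub>M borel)" and k: "\<And>x y. cmod (k x y) \<le> 1"
  shows "(LINT x|lborel. f x * (LINT y|lborel. g y * k x y)) = (LINT y|lborel. g y * (LINT x|lborel. f x * k x y))"
proof -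
  have [measurable]: "f \<in> borel_measurable borel" "g \<in> borel_measurable borel" using f g by auto
  have gk: "integrable lborel (\<lambda>y. f x * (g y * k x y))" for x
    by (rule Bochner_Integration.integrable_bound[of _ "\<lambda>y. cmod (f x) * cmod (g y)"])
       (use g k[of x] in \<open>auto simp: norm_mult intro!: mult_left_mono mult_left_le\<close>)
  have int: "integrable (lborel \<Otimes>\<^sub>M lborel) (\<lambda>(x, y). f x * (g y * k x y))"
  proof (rule lborel_pair.Fubini_integrable)
    show "integrable lborel (\<lambda>x. LINT y|lborel. norm (case (x, y) of (x, y) \<Rightarrow> f x * (g y * k x y)))"
    proof (rule Bochner_Integration.integrable_bound)
      show "integrable lborel (\<lambda>x. cmod (f x) * (LINT y|lborel. cmod (g y)))" using f by auto
      have "(LINT y|lborel. cmod (f x * (g y * k x y))) \<le> (LINT y|lborel. cmod (f x) * cmod (g y))" for x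
        by (intro integral_mono integrable_norm gk)
           (use g k[of x] in \<open>auto simp: norm_mult intro!: mult_left_mono mult_left_le\<close>)
      then show "AE x in lborel. norm (LINT y|lborel. norm (case (x, y) of (x, y) \<Rightarrow> f x * (g y * k x y)))
          \<le> norm (cmod (f x) * (LINT y|lborel. cmod (g y)))"
        by (auto simp: integral_nonneg_AE)
    qed simp
  qed (use gk in auto)
  have "(LINT x|lborel. f x * (LINT y|lborel. g y * k x y)) = (LINT x|lborel. LINT y|lborel. f x * (g y * k x y))"
    by simp
  also have "\<dots> = (LINT y|lborel. LINT x|lborel. f x * (g y * k x y))"
    using lborel_pair.Fubini_integral[OF int] by simp
  also have "\<dots> = (LINT y|lborel. LINT x|lborel. g y * (f x * k x y))"
    by (simp add: mult.left_commute)
  finally show ?thesis by simp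
qed

text \<open>The inverse Fourier transform without its normalising factor, which is later put into
  H.\<close>

definition fourier_int :: "(real \<Rightarrow> complex) \<Rightarrow> real \<Rightarrow> complex" where
  "fourier_int H x = (LINT \<xi>|lborel. H \<xi> * cis (x * \<xi>))"

lemma integrable_mult_cis:
  assumes "integrable lborel H"
  shows "integrable lborel (\<lambda>\<xi>. H \<xi> * cis (x * \<xi>))"
proof -
  have [measurable]: "H \<in> borel_measurable borel" using assms by auto
  show ?thesis by (rule Bochner_Integration.integrable_bound[OF assms]) (auto simp: norm_mult)
qed

lemma norm_fourier_int_le:
  assumes "integrable lborel H"
  shows "cmod (fourier_int H x) \<le> (LINT \<xi>|lborel. cmod (H \<xi>))"
  unfolding fourier_int_def by (rule order_trans[OF integral_norm_bound]) (simp add: norm_mult)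

lemma continuous_fourier_int:
  assumes "integrable lborel H"
  shows "continuous_on S (fourier_int H)"
proof -
  have [measurable]: "H \<in> borel_measurable borel" using assms by auto
  have "(\<lambda>n. fourier_int H (X n)) \<longlonglongrightarrow> fourier_int H x" if "X \<longlonglongrightarrow> x" for X x
    unfolding fourier_int_def
    by (rule integral_dominated_convergence[where w = "\<lambda>\<xi>. cmod (H \<xi>)"])
       (use assms that in \<open>auto simp: norm_mult intro!: tendsto_intros AE_I2\<close>)
  then have "isCont (fourier_int H) x" for x
    unfolding continuous_at_sequentially by (auto simp: o_def)
  then show ?thesis by (simp add: continuous_at_imp_continuous_on)
qed

lemma fourier_int_derivative:
  assumes H: "integrable lborel H" and H': "integrable lborel (\<lambda>\<xi>. \<i> * of_real \<xi> * H \<xi>)"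
  shows "(fourier_int H has_vector_derivative fourier_int (\<lambda>\<xi>. \<i> * of_real \<xi> * H \<xi>) x) (at x)"
  unfolding has_vector_derivative_def has_derivative_at
proof
  have [measurable]: "H \<in> borel_measurable borel" using H by auto
  let ?r = "\<lambda>h \<xi>. cis (h * \<xi>) - 1 - \<i> * of_real (h * \<xi>)"
  let ?D = "fourier_int (\<lambda>\<xi>. \<i> * of_real \<xi> * H \<xi>) x"
  let ?q = "\<lambda>h. norm (fourier_int H (x + h) - fourier_int H x - h *\<^sub>R ?D) / norm h"
  \<comment> \<open>The quadratic bound gives the pointwise limit of the difference quotient, the
    linear one an integrable majorant.\<close>
  have r1: "cmod (?r h \<xi>) \<le> (h * \<xi>)\<^sup>2" and r2: "cmod (?r h \<xi>) \<le> 2 * \<bar>h * \<xi>\<bar>" for h \<xi>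
  proof -
    have "cmod (?r h \<xi>) \<le> \<bar>h * \<xi>\<bar> ^ 2 / 2"
      using iexp_approx1[of "h * \<xi>" 1] by (simp add: cis_conv_exp numeral_2_eq_2 diff_diff_eq)
    also have "\<dots> \<le> (h * \<xi>)\<^sup>2" by simp
    finally show "cmod (?r h \<xi>) \<le> (h * \<xi>)\<^sup>2" .
    show "cmod (?r h \<xi>) \<le> 2 * \<bar>h * \<xi>\<bar>"
      using iexp_approx2[of "h * \<xi>" 1] by (simp add: cis_conv_exp numeral_2_eq_2 diff_diff_eq)
  qed
  have H'': "integrable lborel (\<lambda>\<xi>. \<bar>\<xi>\<bar> * cmod (H \<xi>))"
    using integrable_norm[OF H'] by (simp add: norm_mult)
  have int: "integrable lborel (\<lambda>\<xi>. cmod (H \<xi>) * cmod (?r h \<xi>) / \<bar>h\<bar>)" for h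
  proof (rule Bochner_Integration.integrable_bound)
    show "integrable lborel (\<lambda>\<xi>. 2 * (\<bar>\<xi>\<bar> * cmod (H \<xi>)))" using H'' by simp
    show "AE \<xi> in lborel. norm (cmod (H \<xi>) * cmod (?r h \<xi>) / \<bar>h\<bar>) \<le> norm (2 * (\<bar>\<xi>\<bar> * cmod (H \<xi>)))"
    proof (rule AE_I2)
      fix \<xi>
      have "cmod (H \<xi>) * cmod (?r h \<xi>) / \<bar>h\<bar> \<le> cmod (H \<xi>) * (2 * \<bar>h * \<xi>\<bar>) / \<bar>h\<bar>"
        by (intro divide_right_mono mult_left_mono r2) auto
      also have "\<dots> \<le> 2 * (\<bar>\<xi>\<bar> * cmod (H \<xi>))" by (cases "h = 0") (auto simp: abs_mult)
      finally show "norm (cmod (H \<xi>) * cmod (?r h \<xi>) / \<bar>h\<bar>) \<le> norm (2 * (\<bar>\<xi>\<bar> * cmod (H \<xi>)))"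
        by (simp add: abs_mult)
    qed
  qed simp
  have q: "?q h \<le> (LINT \<xi>|lborel. cmod (H \<xi>) * cmod (?r h \<xi>) / \<bar>h\<bar>)" for h
  proof -
    have "fourier_int H (x + h) - fourier_int H x - h *\<^sub>R ?D = (LINT \<xi>|lborel. H \<xi> * cis (x * \<xi>) * ?r h \<xi>)"
    proof -
      have "(\<lambda>\<xi>. H \<xi> * cis (x * \<xi>) * ?r h \<xi>)
        = (\<lambda>\<xi>. H \<xi> * cis ((x + h) * \<xi>) - H \<xi> * cis (x * \<xi>) - h *\<^sub>R (\<i> * of_real \<xi> * H \<xi> * cis (x * \<xi>)))"
        by (simp add: fun_eq_iff distrib_right cis_mult[symmetric] scaleR_conv_of_real algebra_simps)
      then show ?thesis
        unfolding fourier_int_def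
        using integrable_mult_cis[OF H] integrable_mult_cis[OF H'] by simp
    qed
    then have "norm (fourier_int H (x + h) - fourier_int H x - h *\<^sub>R ?D)
       \<le> (LINT \<xi>|lborel. cmod (H \<xi> * cis (x * \<xi>) * ?r h \<xi>))"
      by (simp only: integral_norm_bound)
    also have "\<dots> = (LINT \<xi>|lborel. cmod (H \<xi>) * cmod (?r h \<xi>))" by (simp add: norm_mult)
    finally show ?thesis by (simp add: divide_right_mono)
  qed
  have "?q \<midarrow>0\<rightarrow> 0"
    unfolding tendsto_at_iff_sequentially
  proof (intro allI impI)
    fix X :: "nat \<Rightarrow> real" assume X: "\<forall>i. X i \<in> UNIV - {0}" "X \<longlonglongrightarrow> 0"
    have "(\<lambda>n. LINT \<xi>|lborel. cmod (H \<xi>) * cmod (?r (X n) \<xi>) / \<bar>X n\<bar>) \<longlonglongrightarrow> (LINT \<xi>|(lborel::real measure). 0)"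
    proof (rule integral_dominated_convergence[where w = "\<lambda>\<xi>. 2 * (\<bar>\<xi>\<bar> * cmod (H \<xi>))"])
      show "AE \<xi> in lborel. (\<lambda>n. cmod (H \<xi>) * cmod (?r (X n) \<xi>) / \<bar>X n\<bar>) \<longlonglongrightarrow> 0"
      proof (rule AE_I2)
        fix \<xi>
        show "(\<lambda>n. cmod (H \<xi>) * cmod (?r (X n) \<xi>) / \<bar>X n\<bar>) \<longlonglongrightarrow> 0"
        proof (rule tendsto_sandwich[OF _ _ tendsto_const])
          have "(\<lambda>n. cmod (H \<xi>) * (\<bar>X n\<bar> * \<xi>\<^sup>2)) \<longlonglongrightarrow> cmod (H \<xi>) * (\<bar>0\<bar> * \<xi>\<^sup>2)"
            using X by (intro tendsto_intros)
          then show "(\<lambda>n. cmod (H \<xi>) * (\<bar>X n\<bar> * \<xi>\<^sup>2)) \<longlonglongrightarrow> 0" by simp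
          show "\<forall>\<^sub>F n in sequentially. cmod (H \<xi>) * cmod (?r (X n) \<xi>) / \<bar>X n\<bar> \<le> cmod (H \<xi>) * (\<bar>X n\<bar> * \<xi>\<^sup>2)"
          proof (rule always_eventually, rule allI)
            fix n
            have "cmod (H \<xi>) * cmod (?r (X n) \<xi>) / \<bar>X n\<bar> \<le> cmod (H \<xi>) * (X n * \<xi>)\<^sup>2 / \<bar>X n\<bar>"
              by (intro divide_right_mono mult_left_mono r1) auto
            also have "\<dots> = cmod (H \<xi>) * (\<bar>X n\<bar> * \<xi>\<^sup>2)"
              using X(1) by (simp add: power2_eq_square field_simps abs_if)
            finally show "cmod (H \<xi>) * cmod (?r (X n) \<xi>) / \<bar>X n\<bar> \<le> cmod (H \<xi>) * (\<bar>X n\<bar> * \<xi>\<^sup>2)" .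
          qed
        qed auto
      qed
      show "AE \<xi> in lborel. norm (cmod (H \<xi>) * cmod (?r (X n) \<xi>) / \<bar>X n\<bar>) \<le> 2 * (\<bar>\<xi>\<bar> * cmod (H \<xi>))" for n
      proof (rule AE_I2)
        fix \<xi>
        have "cmod (H \<xi>) * cmod (?r (X n) \<xi>) / \<bar>X n\<bar> \<le> cmod (H \<xi>) * (2 * \<bar>X n * \<xi>\<bar>) / \<bar>X n\<bar>"
          by (intro divide_right_mono mult_left_mono r2) auto
        also have "\<dots> = 2 * (\<bar>\<xi>\<bar> * cmod (H \<xi>))" using X(1) by (auto simp: abs_mult)
        finally show "norm (cmod (H \<xi>) * cmod (?r (X n) \<xi>) / \<bar>X n\<bar>) \<le> 2 * (\<bar>\<xi>\<bar> * cmod (H \<xi>))"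
          by simp
      qed
    qed (use H'' in auto)
    then have "(\<lambda>n. LINT \<xi>|lborel. cmod (H \<xi>) * cmod (?r (X n) \<xi>) / \<bar>X n\<bar>) \<longlonglongrightarrow> 0" by simp
    then show "(?q \<circ> X) \<longlonglongrightarrow> 0"
    proof (rule Lim_null_comparison[rotated], intro always_eventually allI)
      fix n
      have "norm ((?q \<circ> X) n) = ?q (X n)" by simp
      then show "norm ((?q \<circ> X) n) \<le> (LINT \<xi>|lborel. cmod (H \<xi>) * cmod (?r (X n) \<xi>) / \<bar>X n\<bar>)"
        using q[of "X n"] by (simp only:)
    qed
  qed
  then show "?q \<midarrow>0\<rightarrow> 0" .
qed (rule bounded_linear_scaleR_left)

section \<open>A Gaussian form of Plancherel's inequality\<close>

lemma gaussian_fourier: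
  "(LINT x|lborel. of_real (std_normal_density x) * cis (t * x)) = of_real (exp (- t\<^sup>2 / 2))"
proof -
  have "of_real (exp (- t\<^sup>2 / 2)) = char std_normal_distribution t"
    by (simp add: char_std_normal_distribution)
  also have "\<dots> = (LINT x|lborel. std_normal_density x *\<^sub>R iexp (t * x))"
    unfolding char_def by (subst integral_density) auto
  finally show ?thesis by (simp add: cis_conv_exp scaleR_conv_of_real)
qed

lemma ennreal_distrib:
  assumes "0 \<le> u" "0 \<le> v" "0 \<le> w"
  shows "ennreal ((u + v) * w) = ennreal u * ennreal w + ennreal v * ennreal w"
  using assms by (subst ennreal_mult) (auto simp: distrib_right)

lemma std_normal_density_le_1: "std_normal_density x \<le> 1"
proof -
  have "1 / sqrt (2 * pi) \<le> 1" using pi_ge_two by (simp add: divide_le_eq)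
  then show ?thesis unfolding std_normal_density_def by (intro mult_le_one) auto
qed

lemma std_normal_density_nonneg: "0 \<le> std_normal_density x"
  by (rule normal_density_nonneg)

lemma integrable_std_normal: "integrable lborel std_normal_density"
  by (rule integrable_normal_density) simp

lemma borel_measurable_fourier_int [measurable]:
  "integrable lborel H \<Longrightarrow> fourier_int H \<in> borel_measurable borel"
  by (intro borel_measurable_continuous_onI continuous_fourier_int)

lemma integral_gaussian_shift:
  "(\<integral>\<^sup>+\<eta>. ennreal (exp (- (\<xi> - \<eta>)\<^sup>2 / 2)) \<partial>lborel) = ennreal (sqrt (2 * pi))"
proof -
  have e: "exp (- (\<xi> - \<eta>)\<^sup>2 / 2) = sqrt (2 * pi) * normal_density \<xi> 1 \<eta>" for \<eta>
    by (simp add: normal_density_def power2_commute)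
  have "(\<integral>\<^sup>+\<eta>. ennreal (normal_density \<xi> 1 \<eta>) \<partial>lborel) = 1"
    by (subst nn_integral_eq_integral) (auto simp: integrable_normal_density)
  then show ?thesis unfolding e by (simp add: ennreal_mult nn_integral_cmult)
qed

text \<open>A Gaussian weight reduces the bound to Schur's test for the kernel \<open>exp (- (\<xi> - \<eta>)\<^sup>2 / 2)\<close>.\<close>
lemma gaussian_plancherel:
  assumes H: "integrable lborel H" and H2: "integrable lborel (\<lambda>\<xi>. (cmod (H \<xi>))\<^sup>2)"
  shows "integrable lborel (\<lambda>x. std_normal_density x * (cmod (fourier_int H x))\<^sup>2)"
    and "(LINT x|lborel. std_normal_density x * (cmod (fourier_int H x))\<^sup>2)
      \<le> sqrt (2 * pi) * (LINT \<xi>|lborel. (cmod (H \<xi>))\<^sup>2)"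
proof -
  define h where "h = fourier_int H"
  have [measurable]: "H \<in> borel_measurable borel" "h \<in> borel_measurable borel"
    using H unfolding h_def by auto
  define N where "N = (LINT \<xi>|lborel. cmod (H \<xi>))"
  have hN: "cmod (h x) \<le> N" for x unfolding h_def N_def by (rule norm_fourier_int_le[OF H])
  have hN2: "(cmod (h x))\<^sup>2 \<le> N\<^sup>2" for x by (intro power_mono hN) auto
  have N0: "N \<ge> 0" unfolding N_def by (intro integral_nonneg_AE) auto
  let ?p = "std_normal_density"
  note p0 = std_normal_density_nonneg
  show "integrable lborel (\<lambda>x. ?p x * (cmod (fourier_int H x))\<^sup>2)"
  proof (rule Bochner_Integration.integrable_bound)
    show "integrable lborel (\<lambda>x. N\<^sup>2 * ?p x)" using integrable_std_normal by simp
    show "AE x in lborel. norm (?p x * (cmod (fourier_int H x))\<^sup>2) \<le> norm (N\<^sup>2 * ?p x)"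
      using hN2 p0
      by (intro AE_I2) (simp add: h_def abs_mult mult.commute mult_left_mono)
  qed (use H in measurable)
  have ph: "integrable lborel (\<lambda>x. of_real (?p x) * cnj (h x))"
  proof (rule Bochner_Integration.integrable_bound)
    show "integrable lborel (\<lambda>x. N * ?p x)" using integrable_std_normal by simp
    show "AE x in lborel. norm (of_real (?p x) * cnj (h x)) \<le> norm (N * ?p x)"
      using hN p0 N0 by (intro AE_I2) (simp add: norm_mult abs_mult mult.commute mult_right_mono)
  qed measurable
  \<comment> \<open>The Gaussian is its own transform, so multiplying by it becomes convolution with
    a Gaussian on the frequency side.\<close>
  have K: "(LINT x|lborel. of_real (?p x) * cnj (h x) * cis (x * \<xi>))
      = (LINT \<eta>|lborel. cnj (H \<eta>) * of_real (exp (- (\<xi> - \<eta>)\<^sup>2 / 2)))" for \<xi>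
  proof -
    have "cnj (h x) = (LINT \<eta>|lborel. cnj (H \<eta>) * cis (- (x * \<eta>)))" for x
    proof -
      have "cnj (h x) = (LINT \<eta>|lborel. cnj (H \<eta> * cis (x * \<eta>)))"
        unfolding h_def fourier_int_def by (rule Bochner_Integration.integral_cnj [symmetric])
      then show ?thesis by (simp add: cis_cnj)
    qed
    then have "(LINT x|lborel. of_real (?p x) * cnj (h x) * cis (x * \<xi>))
      = (LINT x|lborel. (of_real (?p x) * cis (x * \<xi>)) * (LINT \<eta>|lborel. cnj (H \<eta>) * cis (- (x * \<eta>))))"
      by (simp add: mult_ac)
    also have "\<dots> = (LINT \<eta>|lborel. cnj (H \<eta>) * (LINT x|lborel. (of_real (?p x) * cis (x * \<xi>)) * cis (- (x * \<eta>))))"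
    proof (rule fubini_bounded_kernel)
      show "integrable lborel (\<lambda>x. of_real (?p x) * cis (x * \<xi>))"
        by (rule Bochner_Integration.integrable_bound[OF integrable_std_normal]) (auto simp: norm_mult)
      show "integrable lborel (\<lambda>\<eta>. cnj (H \<eta>))" using H by simp
      show "(\<lambda>(x, \<eta>). cis (- (x * \<eta>))) \<in> borel_measurable (borel \<Otimes>\<^sub>M borel)" by measurable
    qed simp
    also have "\<dots> = (LINT \<eta>|lborel. cnj (H \<eta>) * of_real (exp (- (\<xi> - \<eta>)\<^sup>2 / 2)))"
    proof -
      have "(\<lambda>x. of_real (?p x) * cis (x * \<xi>) * cis (- (x * \<eta>))) = (\<lambda>x. of_real (?p x) * cis ((\<xi> - \<eta>) * x))" for \<eta>
        by (simp add: mult.assoc cis_mult) (simp add: algebra_simps)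
      then show ?thesis unfolding gaussian_fourier[symmetric] by simp
    qed
    finally show ?thesis .
  qed
  define Q where "Q = (LINT x|lborel. ?p x * (cmod (h x))\<^sup>2)"
  define W where "W = (LINT \<xi>|lborel. (cmod (H \<xi>))\<^sup>2)"
  have W: "(\<integral>\<^sup>+\<xi>. ennreal ((cmod (H \<xi>))\<^sup>2) \<partial>lborel) = ennreal W" "W \<ge> 0"
    unfolding W_def using nn_integral_eq_integral[OF H2] by (auto intro: integral_nonneg_AE)
  have "complex_of_real Q = (LINT x|lborel. of_real (?p x * (cmod (h x))\<^sup>2))"
    unfolding Q_def by (simp del: of_real_mult of_real_power)
  \<comment> \<open>One of the two factors of the squared modulus is written out as a Fourier
    integral and the order of integration exchanged; this leaves a quadratic form in H.\<close>
  also have "\<dots> = (LINT x|lborel. (of_real (?p x) * cnj (h x)) * (LINT \<xi>|lborel. H \<xi> * cis (x * \<xi>)))"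
    unfolding fourier_int_def[symmetric] h_def[symmetric]
    by (intro Bochner_Integration.integral_cong refl) (simp add: complex_norm_square mult_ac del: of_real_power)
  also have "\<dots> = (LINT \<xi>|lborel. H \<xi> * (LINT x|lborel. (of_real (?p x) * cnj (h x)) * cis (x * \<xi>)))"
    by (rule fubini_bounded_kernel[OF ph H]) auto
  finally have Q: "complex_of_real Q = (LINT \<xi>|lborel. H \<xi> * (LINT \<eta>|lborel. cnj (H \<eta>) * of_real (exp (- (\<xi> - \<eta>)\<^sup>2 / 2))))"
    unfolding K .
  have He: "integrable lborel (\<lambda>\<eta>. cmod (H \<eta>) * exp (- (\<xi> - \<eta>)\<^sup>2 / 2))" for \<xi>
    by (rule Bochner_Integration.integrable_bound[OF integrable_norm[OF H]])
       (auto simp: abs_mult intro!: mult_left_le)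
  \<comment> \<open>A Bochner integral that fails to exist has value 0, so this bound holds in
    either case.\<close>
  have "ennreal Q \<le> (\<integral>\<^sup>+\<xi>. ennreal (cmod (H \<xi> * (LINT \<eta>|lborel. cnj (H \<eta>) * of_real (exp (- (\<xi> - \<eta>)\<^sup>2 / 2))))) \<partial>lborel)"
  proof (cases "integrable lborel (\<lambda>\<xi>. H \<xi> * (LINT \<eta>|lborel. cnj (H \<eta>) * of_real (exp (- (\<xi> - \<eta>)\<^sup>2 / 2))))")
    case True
    have "Q \<le> cmod (complex_of_real Q)" by simp
    then have "ennreal Q \<le> ennreal (cmod (complex_of_real Q))" by (rule ennreal_leI)
    also have "\<dots> \<le> (\<integral>\<^sup>+\<xi>. ennreal (cmod (H \<xi> * (LINT \<eta>|lborel. cnj (H \<eta>) * of_real (exp (- (\<xi> - \<eta>)\<^sup>2 / 2))))) \<partial>lborel)"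
      unfolding Q by (rule integral_norm_bound_ennreal[OF True])
    finally show ?thesis .
  next
    case False
    then have "complex_of_real Q = 0" unfolding Q by (rule not_integrable_integral_eq)
    then show ?thesis by simp
  qed
  \<comment> \<open>The product of the two values of H is split into squares; each square then meets
    the full mass sqrt (2 pi) of the Gaussian kernel.\<close>
  also have "\<dots> \<le> (\<integral>\<^sup>+\<xi>. \<integral>\<^sup>+\<eta>. ennreal ((cmod (H \<xi>))\<^sup>2 / 2) * ennreal (exp (- (\<xi> - \<eta>)\<^sup>2 / 2))
      + ennreal ((cmod (H \<eta>))\<^sup>2 / 2) * ennreal (exp (- (\<xi> - \<eta>)\<^sup>2 / 2)) \<partial>lborel \<partial>lborel)"
  proof (rule nn_integral_mono)
    fix \<xi>
    let ?e = "\<lambda>\<eta> :: real. exp (- (\<xi> - \<eta>)\<^sup>2 / 2) :: real"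
    have "cmod (LINT \<eta>|lborel. cnj (H \<eta>) * of_real (?e \<eta>)) \<le> (LINT \<eta>|lborel. cmod (cnj (H \<eta>) * of_real (?e \<eta>)))"
      by (rule integral_norm_bound)
    also have "\<dots> = (LINT \<eta>|lborel. cmod (H \<eta>) * ?e \<eta>)" by (simp add: norm_mult)
    finally have "ennreal (cmod (H \<xi> * (LINT \<eta>|lborel. cnj (H \<eta>) * of_real (?e \<eta>))))
       \<le> ennreal (cmod (H \<xi>) * (LINT \<eta>|lborel. cmod (H \<eta>) * ?e \<eta>))"
      by (intro ennreal_leI) (simp add: norm_mult mult_left_mono)
    also have "\<dots> = ennreal (LINT \<eta>|lborel. cmod (H \<xi>) * (cmod (H \<eta>) * ?e \<eta>))" by simp
    also have "\<dots> = (\<integral>\<^sup>+\<eta>. ennreal (cmod (H \<xi>) * (cmod (H \<eta>) * ?e \<eta>)) \<partial>lborel)"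
      by (rule nn_integral_eq_integral[symmetric]) (use He in auto)
    also have "\<dots> \<le> (\<integral>\<^sup>+\<eta>. ennreal ((cmod (H \<xi>))\<^sup>2 / 2) * ennreal (?e \<eta>)
        + ennreal ((cmod (H \<eta>))\<^sup>2 / 2) * ennreal (?e \<eta>) \<partial>lborel)"
    proof (rule nn_integral_mono)
      fix \<eta>
      have "cmod (H \<xi>) * (cmod (H \<eta>) * ?e \<eta>) \<le> ((cmod (H \<xi>))\<^sup>2 / 2 + (cmod (H \<eta>))\<^sup>2 / 2) * ?e \<eta>"
        unfolding mult.assoc[symmetric] using sum_squares_bound[of "cmod (H \<xi>)" "cmod (H \<eta>)"]
        by (intro mult_right_mono) auto
      then have "ennreal (cmod (H \<xi>) * (cmod (H \<eta>) * ?e \<eta>))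
         \<le> ennreal (((cmod (H \<xi>))\<^sup>2 / 2 + (cmod (H \<eta>))\<^sup>2 / 2) * ?e \<eta>)" by (rule ennreal_leI)
      also have "\<dots> = ennreal ((cmod (H \<xi>))\<^sup>2 / 2) * ennreal (?e \<eta>) + ennreal ((cmod (H \<eta>))\<^sup>2 / 2) * ennreal (?e \<eta>)"
        by (rule ennreal_distrib) auto
      finally show "ennreal (cmod (H \<xi>) * (cmod (H \<eta>) * ?e \<eta>))
        \<le> ennreal ((cmod (H \<xi>))\<^sup>2 / 2) * ennreal (?e \<eta>) + ennreal ((cmod (H \<eta>))\<^sup>2 / 2) * ennreal (?e \<eta>)" .
    qed
    finally show "ennreal (cmod (H \<xi> * (LINT \<eta>|lborel. cnj (H \<eta>) * of_real (?e \<eta>))))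
      \<le> (\<integral>\<^sup>+\<eta>. ennreal ((cmod (H \<xi>))\<^sup>2 / 2) * ennreal (?e \<eta>)
        + ennreal ((cmod (H \<eta>))\<^sup>2 / 2) * ennreal (?e \<eta>) \<partial>lborel)" .
  qed
  also have "\<dots> = (\<integral>\<^sup>+\<xi>. ennreal ((cmod (H \<xi>))\<^sup>2 / 2) * (\<integral>\<^sup>+\<eta>. ennreal (exp (- (\<xi> - \<eta>)\<^sup>2 / 2)) \<partial>lborel) \<partial>lborel)
     + (\<integral>\<^sup>+\<xi>. \<integral>\<^sup>+\<eta>. ennreal ((cmod (H \<eta>))\<^sup>2 / 2) * ennreal (exp (- (\<xi> - \<eta>)\<^sup>2 / 2)) \<partial>lborel \<partial>lborel)"
    by (simp add: nn_integral_add nn_integral_cmult)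
  also have "(\<integral>\<^sup>+\<xi>. \<integral>\<^sup>+\<eta>. ennreal ((cmod (H \<eta>))\<^sup>2 / 2) * ennreal (exp (- (\<xi> - \<eta>)\<^sup>2 / 2)) \<partial>lborel \<partial>lborel)
     = (\<integral>\<^sup>+\<eta>. ennreal ((cmod (H \<eta>))\<^sup>2 / 2) * (\<integral>\<^sup>+\<xi>. ennreal (exp (- (\<eta> - \<xi>)\<^sup>2 / 2)) \<partial>lborel) \<partial>lborel)"
    by (subst lborel_pair.Fubini') (auto simp: nn_integral_cmult power2_commute)
  also have "(\<integral>\<^sup>+\<xi>. ennreal ((cmod (H \<xi>))\<^sup>2 / 2) * (\<integral>\<^sup>+\<eta>. ennreal (exp (- (\<xi> - \<eta>)\<^sup>2 / 2)) \<partial>lborel) \<partial>lborel)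
     = ennreal (W / 2 * sqrt (2 * pi))"
  proof -
    have "(\<integral>\<^sup>+\<xi>. ennreal ((cmod (H \<xi>))\<^sup>2 / 2) \<partial>lborel) = ennreal (W / 2)"
      by (subst nn_integral_eq_integral) (use H2 in \<open>auto simp: W_def\<close>)
    moreover have "ennreal (W / 2) * ennreal (sqrt (2 * pi)) = ennreal (W / 2 * sqrt (2 * pi))"
      using W(2) by (intro ennreal_mult[symmetric]) auto
    ultimately show ?thesis
      unfolding integral_gaussian_shift by (subst nn_integral_multc) auto
  qed
  also have "ennreal (W / 2 * sqrt (2 * pi)) + ennreal (W / 2 * sqrt (2 * pi)) = ennreal (sqrt (2 * pi) * W)"
    using W(2) by (subst ennreal_plus[symmetric]) (auto simp: field_simps)
  finally show "(LINT x|lborel. ?p x * (cmod (fourier_int H x))\<^sup>2) \<le> sqrt (2 * pi) * (LINT \<xi>|lborel. (cmod (H \<xi>))\<^sup>2)"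
    using W(2) unfolding Q_def h_def W_def by simp
qed

text \<open>On [0, 2] the normal density is at least exp (-2) / sqrt (2 pi). This and the factor
  sqrt (2 pi) of the weighted inequality produce the constant.\<close>

lemma local_plancherel:
  assumes H: "integrable lborel H" and H2: "integrable lborel (\<lambda>\<xi>. (cmod (H \<xi>))\<^sup>2)"
  shows "integral {0..2} (\<lambda>x. (cmod (fourier_int H x))\<^sup>2) \<le> 2 * pi * exp 2 * (LINT \<xi>|lborel. (cmod (H \<xi>))\<^sup>2)"
proof -
  let ?h = "\<lambda>x. (cmod (fourier_int H x))\<^sup>2"
  note P = gaussian_plancherel[OF assms]
  have cont: "continuous_on {0..2} ?h" by (intro continuous_intros continuous_fourier_int H)
  have si: "set_integrable lborel {0..2} ?h" by (rule borel_integrable_atLeastAtMost'[OF cont])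
  have "integral {0..2} ?h = (LINT x|lborel. indicator {0..2} x *\<^sub>R ?h x)"
    using set_borel_integral_eq_integral(2)[OF si] by (simp add: set_lebesgue_integral_def)
  also have "\<dots> \<le> (LINT x|lborel. exp 2 * sqrt (2 * pi) * (std_normal_density x * ?h x))"
  proof (rule integral_mono)
    show "indicator {0..2} x *\<^sub>R ?h x \<le> exp 2 * sqrt (2 * pi) * (std_normal_density x * ?h x)" for x
    proof (cases "x \<in> {0..2}")
      case True
      then have "x\<^sup>2 / 2 \<le> 2" using power_mono[of x 2 2] by simp
      then have "1 \<le> exp 2 * exp (- x\<^sup>2 / 2)" by (simp add: exp_add[symmetric])
      then have "1 \<le> exp 2 * sqrt (2 * pi) * std_normal_density x" by (simp add: std_normal_density_def)
      from mult_right_mono[OF this, of "?h x"] show ?thesis using True by (simp add: mult_ac)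
    qed (use std_normal_density_nonneg in auto)
  qed (use si P(1) in \<open>auto simp: set_integrable_def\<close>)
  also have "\<dots> = exp 2 * sqrt (2 * pi) * (LINT x|lborel. std_normal_density x * ?h x)" by simp
  also have "\<dots> \<le> exp 2 * sqrt (2 * pi) * (sqrt (2 * pi) * (LINT \<xi>|lborel. (cmod (H \<xi>))\<^sup>2))"
    by (intro mult_left_mono P(2)) auto
  also have "\<dots> = 2 * pi * exp 2 * (LINT \<xi>|lborel. (cmod (H \<xi>))\<^sup>2)" by simp
  finally show ?thesis .
qed

section \<open>Fourier inversion for continuous functions in the Sobolev spaces\<close>

lemma L2_complex_mult:
  fixes f g :: "'a \<Rightarrow> complex"
  assumes f: "f \<in> Lp_space M 2" and g: "g \<in> Lp_space M 2"
  shows "integrable M (\<lambda>x. f x * g x)"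
    and "cmod (LINT x|M. f x * g x) \<le> Lp_norm M 2 f * Lp_norm M 2 g"
proof -
  have [measurable]: "f \<in> borel_measurable M" "g \<in> borel_measurable M" using f g by (auto simp: Lp_space_2)
  note cs = cauchy_schwarz_integral[of "\<lambda>x. cmod (f x)" M "\<lambda>x. cmod (g x)"]
  have "integrable M (\<lambda>x. cmod (f x) * cmod (g x))"
    using cs f g by (simp add: Lp_space_2)
  then show "integrable M (\<lambda>x. f x * g x)"
    by (rule Bochner_Integration.integrable_bound) (auto simp: norm_mult)
  have "cmod (LINT x|M. f x * g x) \<le> (LINT x|M. cmod (f x * g x))" by (rule integral_norm_bound)
  also have "\<dots> \<le> Lp_norm M 2 f * Lp_norm M 2 g"
    using cs(2) f g by (simp add: Lp_space_2 Lp_norm_2 norm_mult abs_mult)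
  finally show "cmod (LINT x|M. f x * g x) \<le> Lp_norm M 2 f * Lp_norm M 2 g" .
qed

lemma scaled_gaussian_fourier:
  assumes "\<sigma> > 0"
  shows "(LINT \<xi>|lborel. of_real (std_normal_density (\<sigma> * \<xi>)) * cis (u * \<xi>)) = of_real (exp (- (u / \<sigma>)\<^sup>2 / 2) / \<sigma>)"
proof -
  have "of_real (exp (- (u / \<sigma>)\<^sup>2 / 2)) = (LINT x|lborel. of_real (std_normal_density x) * cis (u / \<sigma> * x))"
    by (rule gaussian_fourier[symmetric])
  also have "\<dots> = \<sigma> *\<^sub>R (LINT \<xi>|lborel. of_real (std_normal_density (\<sigma> * \<xi>)) * cis (u * \<xi>))"
    using assms by (subst lborel_integral_real_affine[of \<sigma> _ 0]) auto
  finally show ?thesis using assms by (simp add: scaleR_conv_of_real field_simps)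
qed

lemma integrable_scaled_gaussian:
  "\<sigma> \<noteq> 0 \<Longrightarrow> integrable lborel (\<lambda>\<xi>. std_normal_density (\<sigma> * \<xi>))"
  using lborel_integrable_real_affine[OF integrable_std_normal, of \<sigma> 0] by simp

lemma L2_scaled_gaussian:
  assumes "\<sigma> \<noteq> 0"
  shows "(\<lambda>\<xi>. complex_of_real (std_normal_density (\<sigma> * \<xi>)) * cis (x * \<xi>)) \<in> Lp_space lborel 2"
  unfolding Lp_space_2
proof
  show "integrable lborel (\<lambda>\<xi>. (cmod (complex_of_real (std_normal_density (\<sigma> * \<xi>)) * cis (x * \<xi>)))\<^sup>2)"
  proof (rule Bochner_Integration.integrable_bound[OF integrable_scaled_gaussian[OF assms]])
    have "(std_normal_density y)\<^sup>2 \<le> std_normal_density y" for y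
      using mult_left_mono[OF std_normal_density_le_1[of y] std_normal_density_nonneg[of y]]
      by (simp add: power2_eq_square)
    then show "AE \<xi> in lborel. norm ((cmod (complex_of_real (std_normal_density (\<sigma> * \<xi>)) * cis (x * \<xi>)))\<^sup>2)
        \<le> norm (std_normal_density (\<sigma> * \<xi>))"
      using std_normal_density_nonneg by (auto simp: norm_mult power_mult_distrib)
  qed simp
qed simp

lemma L2_shifted_gaussian:
  assumes "\<tau> \<noteq> 0"
  shows "(\<lambda>y. complex_of_real (std_normal_density (\<tau> * (y - x)))) \<in> Lp_space lborel 2"
proof -
  have "integrable lborel (\<lambda>y. (cmod (complex_of_real (std_normal_density (\<tau> * y)) * cis (0 * y)))\<^sup>2)"
    using L2_scaled_gaussian[OF assms, of 0] unfolding Lp_space_2 by blast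
  from lborel_integrable_real_affine[OF this, of 1 "-x"] show ?thesis
    unfolding Lp_space_2 by (simp add: norm_mult)
qed

text \<open>The multiplication formula: the transform is moved from F to the Gaussian, where it is
  explicit.\<close>

lemma truncated_fourier_gaussian:
  assumes F: "continuous_on UNIV F" and \<sigma>: "\<sigma> > 0"
  shows "(LINT \<xi>|lborel. truncated_fourier R F \<xi> * (of_real (std_normal_density (\<sigma> * \<xi>)) * cis (x * \<xi>)))
    = (LINT y|lborel. indicator {-R..R} y *\<^sub>R (F y * of_real (std_normal_density ((y - x) / \<sigma>) / \<sigma>)))"
proof -
  define c where "c = complex_of_real (1 / sqrt (2 * pi))"
  let ?F = "\<lambda>y. indicator {-R..R} y *\<^sub>R F y"
  let ?g = "\<lambda>\<xi>. of_real (std_normal_density (\<sigma> * \<xi>)) * cis (x * \<xi>)"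
  have Fi: "integrable lborel ?F"
    using F by (intro borel_integrable_compact) (auto intro: continuous_on_subset)
  have gi: "integrable lborel ?g"
    by (rule Bochner_Integration.integrable_bound[OF integrable_scaled_gaussian[of \<sigma>]]) (use \<sigma> in \<open>auto simp: norm_mult\<close>)
  have tf: "truncated_fourier R F \<xi> = c * (LINT y|lborel. ?F y * cis (- (y * \<xi>)))" for \<xi>
    unfolding truncated_fourier_def set_lebesgue_integral_def c_def by (simp add: cis_conv_exp)
  have "(LINT \<xi>|lborel. truncated_fourier R F \<xi> * ?g \<xi>)
     = (LINT \<xi>|lborel. c * (?g \<xi> * (LINT y|lborel. ?F y * cis (- (y * \<xi>)))))"
    unfolding tf by (simp add: mult_ac)
  also have "\<dots> = c * (LINT \<xi>|lborel. ?g \<xi> * (LINT y|lborel. ?F y * cis (- (y * \<xi>))))" by simp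
  also have "(LINT \<xi>|lborel. ?g \<xi> * (LINT y|lborel. ?F y * cis (- (y * \<xi>))))
     = (LINT y|lborel. ?F y * (LINT \<xi>|lborel. ?g \<xi> * cis (- (y * \<xi>))))"
    by (rule fubini_bounded_kernel[OF gi Fi]) auto
  also have "\<dots> = (LINT y|lborel. ?F y * of_real (exp (- ((x - y) / \<sigma>)\<^sup>2 / 2) / \<sigma>))"
  proof -
    have "(\<lambda>\<xi>. ?g \<xi> * cis (- (y * \<xi>))) = (\<lambda>\<xi>. of_real (std_normal_density (\<sigma> * \<xi>)) * cis ((x - y) * \<xi>))" for y
      by (simp add: mult.assoc cis_mult left_diff_distrib)
    then show ?thesis unfolding scaled_gaussian_fourier[OF \<sigma>, symmetric] by simp
  qed
  also have "c * \<dots> = (LINT y|lborel. c * (?F y * of_real (exp (- ((x - y) / \<sigma>)\<^sup>2 / 2) / \<sigma>)))"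
    by (rule integral_mult_right_zero[symmetric])
  also have "\<dots> = (LINT y|lborel. indicator {-R..R} y *\<^sub>R (F y * of_real (std_normal_density ((y - x) / \<sigma>) / \<sigma>)))"
  proof (intro Bochner_Integration.integral_cong refl)
    fix y
    have "c * of_real (exp (- ((x - y) / \<sigma>)\<^sup>2 / 2) / \<sigma>) = of_real (std_normal_density ((y - x) / \<sigma>) / \<sigma>)"
      unfolding c_def std_normal_density_def of_real_mult[symmetric]
      by (simp add: power_divide power2_commute)
    then show "c * (?F y * of_real (exp (- ((x - y) / \<sigma>)\<^sup>2 / 2) / \<sigma>))
        = indicator {-R..R} y *\<^sub>R (F y * of_real (std_normal_density ((y - x) / \<sigma>) / \<sigma>))"
      by (simp only: mult_scaleR_left mult_scaleR_right mult.left_commute[of c])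
  qed
  finally show ?thesis .
qed

text \<open>Let R tend to infinity: on the left, mean-square convergence is paired with a square
  integrable Gaussian; on the right, F times the Gaussian is integrable and dominates its
  truncations.\<close>

lemma plancherel_gaussian:
  assumes F: "continuous_on UNIV F" and G: "is_plancherel_transform F G" and \<sigma>: "\<sigma> > 0"
  shows "(LINT \<xi>|lborel. G \<xi> * (of_real (std_normal_density (\<sigma> * \<xi>)) * cis (x * \<xi>)))
    = (LINT y|lborel. F y * of_real (std_normal_density ((y - x) / \<sigma>) / \<sigma>))"
proof -
  let ?g = "\<lambda>\<xi>. complex_of_real (std_normal_density (\<sigma> * \<xi>)) * cis (x * \<xi>)"
  let ?k = "\<lambda>y. complex_of_real (std_normal_density ((y - x) / \<sigma>) / \<sigma>)"
  have F2: "F \<in> Lp_space lborel 2" and G2: "G \<in> Lp_space lborel 2"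
    and lim: "Lp_tendsto lborel 2 (\<lambda>R. truncated_fourier R F) G at_top"
    using G by (auto simp: is_plancherel_transform_def)
  have g2: "?g \<in> Lp_space lborel 2" by (rule L2_scaled_gaussian) (use \<sigma> in auto)
  have k2: "?k \<in> Lp_space lborel 2"
    using L2_shifted_gaussian[of "1 / \<sigma>" x] \<sigma>
    by (simp add: Lp_space_2 norm_divide power_divide)
  have Gg: "integrable lborel (\<lambda>\<xi>. G \<xi> * ?g \<xi>)" by (rule L2_complex_mult(1)[OF G2 g2])
  have Fk: "integrable lborel (\<lambda>y. F y * ?k y)" by (rule L2_complex_mult(1)[OF F2 k2])
  let ?a = "\<lambda>R. LINT \<xi>|lborel. truncated_fourier R F \<xi> * ?g \<xi>"
  have 1: "(?a \<longlongrightarrow> (LINT \<xi>|lborel. G \<xi> * ?g \<xi>)) at_top"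
  proof -
    have z: "((\<lambda>R. Lp_norm lborel 2 (\<lambda>\<xi>. truncated_fourier R F \<xi> - G \<xi>) * Lp_norm lborel 2 ?g) \<longlongrightarrow> 0) at_top"
      by (rule tendsto_mult_left_zero) (use lim in \<open>simp add: Lp_tendsto_def\<close>)
    have ev: "\<forall>\<^sub>F R in at_top. (\<lambda>\<xi>. truncated_fourier R F \<xi> - G \<xi>) \<in> Lp_space lborel 2"
      using lim by (simp add: Lp_tendsto_def)
    have "((\<lambda>R. ?a R - (LINT \<xi>|lborel. G \<xi> * ?g \<xi>)) \<longlongrightarrow> 0) at_top"
    proof (rule Lim_null_comparison[OF _ z], use ev in eventually_elim)
      fix R assume R: "(\<lambda>\<xi>. truncated_fourier R F \<xi> - G \<xi>) \<in> Lp_space lborel 2"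
      note i = L2_complex_mult[OF R g2]
      have "?a R = (LINT \<xi>|lborel. (truncated_fourier R F \<xi> - G \<xi>) * ?g \<xi> + G \<xi> * ?g \<xi>)"
        by (simp add: left_diff_distrib)
      also have "\<dots> = (LINT \<xi>|lborel. (truncated_fourier R F \<xi> - G \<xi>) * ?g \<xi>) + (LINT \<xi>|lborel. G \<xi> * ?g \<xi>)"
        by (rule Bochner_Integration.integral_add[OF i(1) Gg])
      finally show "norm (?a R - (LINT \<xi>|lborel. G \<xi> * ?g \<xi>))
          \<le> Lp_norm lborel 2 (\<lambda>\<xi>. truncated_fourier R F \<xi> - G \<xi>) * Lp_norm lborel 2 ?g"
        using i(2) by (simp only: add_diff_cancel_right')
    qed
    then show ?thesis by (simp add: LIM_zero_iff)
  qed
  have 2: "(?a \<longlongrightarrow> (LINT y|lborel. F y * ?k y)) at_top"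
    unfolding truncated_fourier_gaussian[OF F \<sigma>]
  proof (rule integral_dominated_convergence_at_top[where w = "\<lambda>y. cmod (F y * ?k y)"])
    show "AE y in lborel. ((\<lambda>R. indicator {-R..R} y *\<^sub>R (F y * ?k y)) \<longlongrightarrow> F y * ?k y) at_top"
    proof (rule AE_I2)
      fix y
      have "\<forall>\<^sub>F R in at_top. indicator {-R..R} y *\<^sub>R (F y * ?k y) = F y * ?k y"
        using eventually_ge_at_top[of "\<bar>y\<bar>"] by eventually_elim (auto simp: indicator_def)
      then show "((\<lambda>R. indicator {-R..R} y *\<^sub>R (F y * ?k y)) \<longlongrightarrow> F y * ?k y) at_top"
        by (rule tendsto_eventually)
    qed
    show "\<forall>\<^sub>F R in at_top. AE y in lborel. norm (indicator {-R..R} y *\<^sub>R (F y * ?k y)) \<le> cmod (F y * ?k y)"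
      by (intro always_eventually allI AE_I2) (auto simp: indicator_def)
    have "(\<lambda>y. F y * ?k y) \<in> borel_measurable lborel" using Fk by auto
    then show "(\<lambda>y. indicator {-R..R} y *\<^sub>R (F y * ?k y)) \<in> borel_measurable lborel" for R by measurable
  qed (use Fk in auto)
  show ?thesis by (rule tendsto_unique[OF _ 1 2]) simp
qed

lemma exp_neg_le_inverse: "0 < u \<Longrightarrow> exp (- u) \<le> 1 / (u::real)"
proof -
  assume "0 < u"
  moreover have "u \<le> exp u" using exp_ge_add_one_self[of u] by linarith
  ultimately show ?thesis by (simp add: exp_minus field_simps)
qed

text \<open>Away from \<open>x\<close> the factor \<open>exp (-\<tau>\<^sup>2 / 4)\<close> is split off from the Gaussian, which beats \<open>\<tau>\<close>.\<close>
lemma gaussian_approximate_identity: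
  assumes F: "continuous_on UNIV F" and F2: "F \<in> Lp_space lborel 2"
  shows "(\<lambda>n. LINT y|lborel. F y * of_real (std_normal_density ((y - x) / (1 / real (Suc n))) / (1 / real (Suc n))))
     \<longlonglongrightarrow> F x"
proof -
  let ?p = std_normal_density
  let ?k = "\<lambda>n y. complex_of_real (real (Suc n) * ?p (real (Suc n) * (y - x)))"
  \<comment> \<open>Within distance 1 of x continuity makes F bounded; farther out only square
    integrability is available.\<close>
  define F1 where "F1 y = (if \<bar>y - x\<bar> \<le> 1 then F y else 0)" for y
  define F2' where "F2' y = (if \<bar>y - x\<bar> \<le> 1 then 0 else F y)" for y
  have mF [measurable]: "F \<in> borel_measurable borel" using F by (rule borel_measurable_continuous_onI)
  have mF12 [measurable]: "F1 \<in> borel_measurable borel" "F2' \<in> borel_measurable borel"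
    unfolding F1_def[abs_def] F2'_def[abs_def] by measurable
  have k: "?k n \<in> Lp_space lborel 2" for n
    using L2_shifted_gaussian[of "real (Suc n)" x] by (simp add: Lp_space_2 norm_mult power_mult_distrib)
  have Fj: "F1 \<in> Lp_space lborel 2" "F2' \<in> Lp_space lborel 2"
    using F2 unfolding Lp_space_2
    by (auto intro!: Bochner_Integration.integrable_bound[of _ "\<lambda>y. (cmod (F y))\<^sup>2"] simp: F1_def F2'_def)
  note int = L2_complex_mult(1)[OF Fj(1) k] L2_complex_mult(1)[OF Fj(2) k]
  have split: "(LINT y|lborel. F y * ?k n y) = (LINT y|lborel. F1 y * ?k n y) + (LINT y|lborel. F2' y * ?k n y)" for n
  proof -
    have "(\<lambda>y. F y * ?k n y) = (\<lambda>y. F1 y * ?k n y + F2' y * ?k n y)" by (auto simp: F1_def F2'_def)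
    then show ?thesis using int[of n] by simp
  qed
  have near: "(\<lambda>n. LINT y|lborel. F1 y * ?k n y) \<longlonglongrightarrow> F x"
  proof -
    have "compact (F ` {x-1..x+1})"
      using F by (intro compact_continuous_image) (auto intro: continuous_on_subset)
    then have "bounded (F ` {x-1..x+1})" by (rule compact_imp_bounded)
    then obtain b where "\<forall>z\<in>F ` {x-1..x+1}. cmod z \<le> b"
      unfolding bounded_iff by blast
    then have b: "cmod (F y) \<le> b" if "\<bar>y - x\<bar> \<le> 1" for y
      using that by (auto simp: abs_le_iff)
    have b0: "0 \<le> b" using b[of x] order_trans[OF norm_ge_zero] by simp
    \<comment> \<open>Substitute y = x + z / (n + 1), after which the Gaussian no longer depends on
      n.\<close>
    have eq: "(LINT y|lborel. F1 y * ?k n y) = (LINT z|lborel. F1 (x + 1 / real (Suc n) * z) * of_real (?p z))" for n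
    proof -
      have "(LINT y|lborel. F1 y * ?k n y) = (1 / real (Suc n)) *\<^sub>R (LINT z|lborel. F1 (x + 1 / real (Suc n) * z) * ?k n (x + 1 / real (Suc n) * z))"
        by (subst lborel_integral_real_affine[of "1 / real (Suc n)" _ x]) auto
      also have "\<dots> = (LINT z|lborel. (1 / real (Suc n)) *\<^sub>R (F1 (x + 1 / real (Suc n) * z) * ?k n (x + 1 / real (Suc n) * z)))"
        by (rule integral_scaleR_right[symmetric])
      also have "\<dots> = (LINT z|lborel. F1 (x + 1 / real (Suc n) * z) * of_real (?p z))"
      proof (intro Bochner_Integration.integral_cong refl)
        fix z
        have z: "real (Suc n) * (x + 1 / real (Suc n) * z - x) = z" by (simp del: of_nat_Suc)
        show "(1 / real (Suc n)) *\<^sub>R (F1 (x + 1 / real (Suc n) * z) * ?k n (x + 1 / real (Suc n) * z))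
            = F1 (x + 1 / real (Suc n) * z) * of_real (?p z)"
          unfolding z by (simp add: scaleR_conv_of_real del: of_nat_Suc)
      qed
      finally show ?thesis .
    qed
    have "(\<lambda>n. LINT z|lborel. F1 (x + 1 / real (Suc n) * z) * of_real (?p z)) \<longlonglongrightarrow> (LINT z|lborel. F x * of_real (?p z))"
    proof (rule integral_dominated_convergence[where w = "\<lambda>z. b * ?p z"])
      show "AE z in lborel. (\<lambda>n. F1 (x + 1 / real (Suc n) * z) * of_real (?p z)) \<longlonglongrightarrow> F x * of_real (?p z)"
      proof (intro AE_I2 tendsto_mult tendsto_const)
        fix z
        have "(\<lambda>n. 1 / real (Suc n)) \<longlonglongrightarrow> 0" using LIMSEQ_inverse_real_of_nat by (simp add: inverse_eq_divide)
        then have "(\<lambda>n. x + 1 / real (Suc n) * z) \<longlonglongrightarrow> x + 0 * z" by (intro tendsto_intros)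
        then have l: "(\<lambda>n. x + 1 / real (Suc n) * z) \<longlonglongrightarrow> x" by simp
        have "isCont F x" using F by (simp add: continuous_on_eq_continuous_at)
        then have "(\<lambda>n. F (x + 1 / real (Suc n) * z)) \<longlonglongrightarrow> F x" using l by (rule isCont_tendsto_compose)
        moreover have "\<forall>\<^sub>F n in sequentially. F (x + 1 / real (Suc n) * z) = F1 (x + 1 / real (Suc n) * z)"
          using tendstoD[OF l zero_less_one] by eventually_elim (auto simp: dist_real_def F1_def)
        ultimately show "(\<lambda>n. F1 (x + 1 / real (Suc n) * z)) \<longlonglongrightarrow> F x"
          by (rule Lim_transform_eventually)
      qed
      have "cmod (F1 y) \<le> b" for y using b b0 by (auto simp: F1_def)
      then show "AE z in lborel. norm (F1 (x + 1 / real (Suc n) * z) * of_real (?p z)) \<le> b * ?p z" for n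
        using std_normal_density_nonneg by (auto simp: norm_mult intro!: mult_right_mono)
    qed (use integrable_std_normal in auto)
    moreover have "(LINT z|lborel. F x * of_real (?p z)) = F x" by simp
    ultimately show ?thesis unfolding eq by simp
  qed
  have far: "(\<lambda>n. LINT y|lborel. F2' y * ?k n y) \<longlonglongrightarrow> 0"
  proof -
    let ?e = "\<lambda>y. exp (- (y - x)\<^sup>2 / 4)"
    have e2: "(\<lambda>y. complex_of_real (?e y)) \<in> Lp_space lborel 2"
    proof -
      have "(\<lambda>y. (cmod (complex_of_real (?e y)))\<^sup>2) = (\<lambda>y. sqrt (2 * pi) * ?p (-x + 1 * y))"
        by (simp add: std_normal_density_def power2_eq_square exp_add[symmetric])
      moreover have "integrable lborel (\<lambda>y. sqrt (2 * pi) * ?p (-x + 1 * y))"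
        by (intro integrable_mult_right lborel_integrable_real_affine integrable_std_normal) simp
      ultimately show ?thesis unfolding Lp_space_2 by simp
    qed
    define J where "J = (LINT y|lborel. cmod (F y * of_real (?e y)))"
    have i: "integrable lborel (\<lambda>y. cmod (F y * of_real (?e y)))"
      using L2_complex_mult(1)[OF F2 e2] by (rule integrable_norm)
    have bound: "norm (LINT y|lborel. F2' y * ?k n y) \<le> 4 * J * (1 / real (Suc n))" for n
    proof -
      let ?t = "real (Suc n)"
      have "norm (LINT y|lborel. F2' y * ?k n y) \<le> (LINT y|lborel. norm (F2' y * ?k n y))"
        by (rule integral_norm_bound)
      also have "\<dots> \<le> (LINT y|lborel. 4 / ?t * cmod (F y * of_real (?e y)))"
      proof (rule integral_mono)
        fix y
        show "norm (F2' y * ?k n y) \<le> 4 / ?t * cmod (F y * of_real (?e y))"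
        proof (cases "\<bar>y - x\<bar> \<le> 1")
          case False
          then have u: "1 \<le> (y - x)\<^sup>2" using abs_le_square_iff[of 1 "y - x"] by simp
          have t: "1 \<le> ?t\<^sup>2" by simp
          \<comment> \<open>For \<open>?t\<^sup>2\<close> and \<open>(y - x)\<^sup>2\<close> both at
            least 1, this shows that twice their product dominates their sum; hence the exponent
            splits into a part in \<open>?t\<close> and a part in y.\<close>
          have "0 \<le> (?t\<^sup>2 - 1) * ((y - x)\<^sup>2 - 1)" using u t by (intro mult_nonneg_nonneg) auto
          then have "?t\<^sup>2 * 1 + 1 * (y - x)\<^sup>2 \<le> 1 + ?t\<^sup>2 * (y - x)\<^sup>2" by (simp add: algebra_simps)
          also have "1 \<le> ?t\<^sup>2 * (y - x)\<^sup>2" using mult_mono[OF t u] by simp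
          finally have "?t\<^sup>2 + (y - x)\<^sup>2 \<le> 2 * (?t * (y - x))\<^sup>2" by (simp add: power_mult_distrib mult_ac)
          then have "exp (- (?t * (y - x))\<^sup>2 / 2) \<le> exp (- (?t\<^sup>2 / 4) + - (y - x)\<^sup>2 / 4)" by simp
          also have "\<dots> = exp (- (?t\<^sup>2 / 4)) * ?e y" by (rule exp_add)
          \<comment> \<open>This absorbs the factor \<open>?t\<close> of the scaled Gaussian and
            leaves a decay of order 1 / \<open>?t\<close>.\<close>
          also have "\<dots> \<le> 1 / (?t\<^sup>2 / 4) * ?e y" by (intro mult_right_mono exp_neg_le_inverse) auto
          finally have "exp (- (?t * (y - x))\<^sup>2 / 2) \<le> 4 / ?t\<^sup>2 * ?e y" by simp
          moreover have "?p (?t * (y - x)) \<le> exp (- (?t * (y - x))\<^sup>2 / 2)"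
            unfolding std_normal_density_def using pi_ge_two by (intro mult_left_le_one_le) (auto simp: divide_le_eq)
          ultimately have "?t * ?p (?t * (y - x)) \<le> ?t * (4 / ?t\<^sup>2 * ?e y)" by (intro mult_left_mono) auto
          also have "\<dots> = 4 / ?t * ?e y" by (simp add: power2_eq_square)
          finally have "cmod (F y) * (?t * ?p (?t * (y - x))) \<le> cmod (F y) * (4 / ?t * ?e y)"
            by (intro mult_left_mono) auto
          then show ?thesis using False std_normal_density_nonneg
            by (simp add: F2'_def norm_mult mult_ac del: of_nat_Suc)
        qed (simp add: F2'_def)
      qed (use int(2)[of n] i in \<open>auto intro: integrable_norm\<close>)
      also have "\<dots> = 4 * J * (1 / ?t)" by (simp add: J_def)
      finally show ?thesis .
    qed
    have "(\<lambda>n. 4 * J * (1 / real (Suc n))) \<longlonglongrightarrow> 0"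
      using tendsto_mult_right_zero[OF LIMSEQ_inverse_real_of_nat, of "4 * J"] by (simp add: inverse_eq_divide)
    then show ?thesis by (rule Lim_null_comparison[rotated]) (intro always_eventually allI bound)
  qed
  have "(\<lambda>n. LINT y|lborel. F y * ?k n y) \<longlonglongrightarrow> F x + 0"
    unfolding split by (rule tendsto_add[OF near far])
  then show ?thesis by (simp add: mult.commute)
qed

text \<open>In \<open>plancherel_gaussian\<close> with \<sigma> = 1 / (n + 1), one side tends to F x
  because F is continuous at x, the other to the inversion integral because G is integrable. The
  normalising factor is the value of the normal density at 0.\<close>

theorem fourier_inversion:
  assumes F: "continuous_on UNIV F" and G: "is_plancherel_transform F G" and G1: "integrable lborel G"
  shows "F x = fourier_int (\<lambda>\<xi>. of_real (1 / sqrt (2 * pi)) * G \<xi>) x"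
proof -
  let ?s = "\<lambda>n. 1 / real (Suc n)"
  have [measurable]: "G \<in> borel_measurable borel" using G1 by auto
  have F2: "F \<in> Lp_space lborel 2" using G by (simp add: is_plancherel_transform_def)
  have s: "?s \<longlonglongrightarrow> 0" using LIMSEQ_inverse_real_of_nat by (simp add: inverse_eq_divide)
  have "(\<lambda>n. LINT \<xi>|lborel. G \<xi> * (of_real (std_normal_density (?s n * \<xi>)) * cis (x * \<xi>)))
     \<longlonglongrightarrow> (LINT \<xi>|lborel. G \<xi> * (of_real (std_normal_density 0) * cis (x * \<xi>)))"
  proof (rule integral_dominated_convergence[where w = "\<lambda>\<xi>. cmod (G \<xi>)"])
    have c: "isCont std_normal_density 0" unfolding std_normal_density_def by (intro continuous_intros) auto
    show "AE \<xi> in lborel. (\<lambda>n. G \<xi> * (of_real (std_normal_density (?s n * \<xi>)) * cis (x * \<xi>)))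
       \<longlonglongrightarrow> G \<xi> * (of_real (std_normal_density 0) * cis (x * \<xi>))"
    proof (intro AE_I2 tendsto_mult tendsto_const tendsto_of_real)
      fix \<xi>
      have "(\<lambda>n. ?s n * \<xi>) \<longlonglongrightarrow> 0" using s by (rule tendsto_mult_left_zero)
      then show "(\<lambda>n. std_normal_density (?s n * \<xi>)) \<longlonglongrightarrow> std_normal_density 0"
        using c by (rule isCont_tendsto_compose[rotated])
    qed
    show "AE \<xi> in lborel. norm (G \<xi> * (of_real (std_normal_density (?s n * \<xi>)) * cis (x * \<xi>))) \<le> cmod (G \<xi>)" for n
      using std_normal_density_le_1 std_normal_density_nonneg
      by (auto simp: norm_mult intro!: mult_left_le)
  qed (use G1 in auto)
  moreover have "(LINT \<xi>|lborel. G \<xi> * (of_real (std_normal_density (?s n * \<xi>)) * cis (x * \<xi>)))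
    = (LINT y|lborel. F y * of_real (std_normal_density ((y - x) / ?s n) / ?s n))" for n
    by (rule plancherel_gaussian[OF F G]) simp
  ultimately have "(\<lambda>n. LINT y|lborel. F y * of_real (std_normal_density ((y - x) / ?s n) / ?s n))
     \<longlonglongrightarrow> (LINT \<xi>|lborel. G \<xi> * (of_real (std_normal_density 0) * cis (x * \<xi>)))" by simp
  from LIMSEQ_unique[OF gaussian_approximate_identity[OF F F2] this]
  show ?thesis by (simp add: fourier_int_def std_normal_density_def mult_ac)
qed

section \<open>Cosine coefficients\<close>

text \<open>The squared distance from g to its orthogonal projection S is nonnegative; c is the
  common squared norm of the orthogonal system.\<close>

lemma bessel_inequality_real:
  fixes g :: "real \<Rightarrow> real" and \<phi> :: "nat \<Rightarrow> real \<Rightarrow> real"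
  assumes g: "continuous_on {a..b} g" and \<phi>: "\<And>i. i \<in> I \<Longrightarrow> continuous_on {a..b} (\<phi> i)" and I: "finite I" and c: "c > 0"
    and orth: "\<And>i j. i \<in> I \<Longrightarrow> j \<in> I \<Longrightarrow> integral {a..b} (\<lambda>x. \<phi> i x * \<phi> j x) = (if i = j then c else 0)"
  shows "(\<Sum>i\<in>I. (integral {a..b} (\<lambda>x. g x * \<phi> i x))\<^sup>2) \<le> c * integral {a..b} (\<lambda>x. (g x)\<^sup>2)"
proof -
  define k where "k i = integral {a..b} (\<lambda>x. g x * \<phi> i x)" for i
  define S where "S x = (\<Sum>i\<in>I. k i / c * \<phi> i x)" for x
  have S: "continuous_on {a..b} S" unfolding S_def by (intro continuous_intros \<phi>)
  note int = integrable_continuous_interval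
  have Sphi: "integral {a..b} (\<lambda>x. S x * \<phi> j x) = k j" if j: "j \<in> I" for j
  proof -
    have "integral {a..b} (\<lambda>x. S x * \<phi> j x) = integral {a..b} (\<lambda>x. \<Sum>i\<in>I. k i / c * (\<phi> i x * \<phi> j x))"
      by (simp add: S_def sum_distrib_right mult.assoc)
    also have "\<dots> = (\<Sum>i\<in>I. integral {a..b} (\<lambda>x. k i / c * (\<phi> i x * \<phi> j x)))"
      by (intro integral_sum I int continuous_intros \<phi> j)
    also have "\<dots> = (\<Sum>i\<in>I. if i = j then k i else 0)"
      using c by (intro sum.cong refl) (simp add: orth j)
    also have "\<dots> = k j" using I j by simp
    finally show ?thesis .
  qed
  have lin: "integral {a..b} (\<lambda>x. h x * S x) = (\<Sum>i\<in>I. k i / c * integral {a..b} (\<lambda>x. h x * \<phi> i x))"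
    if h: "continuous_on {a..b} h" for h
  proof -
    have "integral {a..b} (\<lambda>x. h x * S x) = integral {a..b} (\<lambda>x. \<Sum>i\<in>I. k i / c * (h x * \<phi> i x))"
      by (simp add: S_def sum_distrib_left mult_ac)
    also have "\<dots> = (\<Sum>i\<in>I. integral {a..b} (\<lambda>x. k i / c * (h x * \<phi> i x)))"
      by (intro integral_sum I int continuous_intros \<phi> h)
    finally show ?thesis by simp
  qed
  have "0 \<le> integral {a..b} (\<lambda>x. (g x - S x)\<^sup>2)"
    by (intro integral_nonneg int continuous_intros g S) auto
  also have "(\<lambda>x. (g x - S x)\<^sup>2) = (\<lambda>x. ((g x)\<^sup>2 - 2 * (g x * S x)) + S x * S x)"
    by (simp add: power2_eq_square algebra_simps)
  also have "integral {a..b} \<dots> = integral {a..b} (\<lambda>x. (g x)\<^sup>2) - 2 * integral {a..b} (\<lambda>x. g x * S x) + integral {a..b} (\<lambda>x. S x * S x)"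
  proof -
    have "integral {a..b} (\<lambda>x. ((g x)\<^sup>2 - 2 * (g x * S x)) + S x * S x)
      = integral {a..b} (\<lambda>x. (g x)\<^sup>2 - 2 * (g x * S x)) + integral {a..b} (\<lambda>x. S x * S x)"
      by (intro Henstock_Kurzweil_Integration.integral_add int continuous_intros g S)
    also have "integral {a..b} (\<lambda>x. (g x)\<^sup>2 - 2 * (g x * S x)) = integral {a..b} (\<lambda>x. (g x)\<^sup>2) - integral {a..b} (\<lambda>x. 2 * (g x * S x))"
      by (intro Henstock_Kurzweil_Integration.integral_diff int continuous_intros g S)
    finally show ?thesis by simp
  qed
  also have "integral {a..b} (\<lambda>x. g x * S x) = (\<Sum>i\<in>I. (k i)\<^sup>2) / c"
    unfolding lin[OF g] by (simp add: k_def[symmetric] power2_eq_square sum_divide_distrib)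
  also have "integral {a..b} (\<lambda>x. S x * S x) = (\<Sum>i\<in>I. (k i)\<^sup>2) / c"
    unfolding lin[OF S] by (simp add: Sphi power2_eq_square sum_divide_distrib)
  finally show ?thesis using c by (simp add: k_def field_simps)
qed

lemma bessel_inequality:
  fixes g :: "real \<Rightarrow> complex" and \<phi> :: "nat \<Rightarrow> real \<Rightarrow> real"
  assumes g: "continuous_on {a..b} g" and \<phi>: "\<And>i. i \<in> I \<Longrightarrow> continuous_on {a..b} (\<phi> i)" and I: "finite I" and c: "c > 0"
    and orth: "\<And>i j. i \<in> I \<Longrightarrow> j \<in> I \<Longrightarrow> integral {a..b} (\<lambda>x. \<phi> i x * \<phi> j x) = (if i = j then c else 0)"
  shows "(\<Sum>i\<in>I. (cmod (integral {a..b} (\<lambda>x. g x * of_real (\<phi> i x))))\<^sup>2) \<le> c * integral {a..b} (\<lambda>x. (cmod (g x))\<^sup>2)"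
proof -
  note int = integrable_continuous_interval
  have re: "continuous_on {a..b} (\<lambda>x. Re (g x))" and im: "continuous_on {a..b} (\<lambda>x. Im (g x))"
    using g by (auto intro: continuous_intros)
  have "(cmod (integral {a..b} (\<lambda>x. g x * of_real (\<phi> i x))))\<^sup>2
      = (integral {a..b} (\<lambda>x. Re (g x) * \<phi> i x))\<^sup>2 + (integral {a..b} (\<lambda>x. Im (g x) * \<phi> i x))\<^sup>2" if "i \<in> I" for i
  proof -
    have gi: "(\<lambda>x. g x * of_real (\<phi> i x)) integrable_on {a..b}"
      by (intro int continuous_intros g \<phi> that)
    have "Re (integral {a..b} (\<lambda>x. g x * of_real (\<phi> i x))) = integral {a..b} (\<lambda>x. Re (g x) * \<phi> i x)"
      using integral_linear[OF gi bounded_linear_Re] by (simp add: o_def)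
    moreover have "Im (integral {a..b} (\<lambda>x. g x * of_real (\<phi> i x))) = integral {a..b} (\<lambda>x. Im (g x) * \<phi> i x)"
      using integral_linear[OF gi bounded_linear_Im] by (simp add: o_def)
    ultimately show ?thesis by (simp add: cmod_power2)
  qed
  then have "(\<Sum>i\<in>I. (cmod (integral {a..b} (\<lambda>x. g x * of_real (\<phi> i x))))\<^sup>2)
     = (\<Sum>i\<in>I. (integral {a..b} (\<lambda>x. Re (g x) * \<phi> i x))\<^sup>2) + (\<Sum>i\<in>I. (integral {a..b} (\<lambda>x. Im (g x) * \<phi> i x))\<^sup>2)"
    by (simp add: sum.distrib)
  also have "\<dots> \<le> c * integral {a..b} (\<lambda>x. (Re (g x))\<^sup>2) + c * integral {a..b} (\<lambda>x. (Im (g x))\<^sup>2)"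
    by (intro add_mono bessel_inequality_real re im \<phi> I c orth)
  also have "\<dots> = c * integral {a..b} (\<lambda>x. (Re (g x))\<^sup>2 + (Im (g x))\<^sup>2)"
    by (subst Henstock_Kurzweil_Integration.integral_add) (auto intro!: int continuous_intros re im simp: distrib_left)
  finally show ?thesis by (simp add: cmod_power2)
qed

section \<open>Orthogonality of sines and cosines on [0, pi]\<close>

lemma integral_cos_multiple:
  assumes "k \<noteq> 0" "sin (k * pi) = 0"
  shows "((\<lambda>x. cos (k * x)) has_integral 0) {0..pi}"
proof -
  have "((\<lambda>x. cos (k * x)) has_integral (sin (k * pi) / k - sin (k * 0) / k)) {0..pi}"
    by (rule fundamental_theorem_of_calculus)
       (use assms in \<open>auto intro!: derivative_eq_intros simp: has_real_derivative_iff_has_vector_derivative[symmetric]\<close>)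
  then show ?thesis using assms by simp
qed

lemma trig_orthogonality:
  assumes "i \<ge> 1" "j \<ge> 1"
  shows "integral {0..pi} (\<lambda>x. cos (real i * x) * cos (real j * x)) = (if i = j then pi / 2 else 0)"
    and "integral {0..pi} (\<lambda>x. sin (real i * x) * sin (real j * x)) = (if i = j then pi / 2 else 0)"
proof -
  have add: "((\<lambda>x. cos ((real i + real j) * x)) has_integral 0) {0..pi}"
    using assms by (intro integral_cos_multiple) (auto simp: sin_npi[of "i + j", simplified])
  have diff: "((\<lambda>x. cos ((real i - real j) * x)) has_integral (if i = j then pi else 0)) {0..pi}"
  proof (cases "i = j")
    case True
    then show ?thesis using has_integral_const_real[of "1::real" 0 pi] by simp
  next
    case False
    then have "sin ((real i - real j) * pi) = 0" by (simp add: left_diff_distrib sin_diff)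
    then show ?thesis using False integral_cos_multiple[of "real i - real j"] by simp
  qed
  have "((\<lambda>x. (cos ((real i - real j) * x) + cos ((real i + real j) * x)) / 2) has_integral ((if i = j then pi else 0) + 0) / 2) {0..pi}"
    by (intro has_integral_divide has_integral_add add diff)
  moreover have "(cos ((real i - real j) * x) + cos ((real i + real j) * x)) / 2 = cos (real i * x) * cos (real j * x)" for x
    by (simp add: left_diff_distrib distrib_right cos_diff cos_add)
  ultimately show "integral {0..pi} (\<lambda>x. cos (real i * x) * cos (real j * x)) = (if i = j then pi / 2 else 0)"
    by (auto dest: integral_unique)
  have "((\<lambda>x. (cos ((real i - real j) * x) - cos ((real i + real j) * x)) / 2) has_integral ((if i = j then pi else 0) - 0) / 2) {0..pi}"
    by (intro has_integral_divide has_integral_diff add diff)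
  moreover have "(cos ((real i - real j) * x) - cos ((real i + real j) * x)) / 2 = sin (real i * x) * sin (real j * x)" for x
    by (simp add: left_diff_distrib distrib_right cos_diff cos_add)
  ultimately show "integral {0..pi} (\<lambda>x. sin (real i * x) * sin (real j * x)) = (if i = j then pi / 2 else 0)"
    by (auto dest: integral_unique)
qed

text \<open>Left unnormalised; the division by pi takes place when the Chebyshev coefficients are
  formed.\<close>

definition cosine_coeff :: "(real \<Rightarrow> complex) \<Rightarrow> nat \<Rightarrow> complex" where
  "cosine_coeff f n = integral {0..pi} (\<lambda>\<theta>. f (1 - cos \<theta>) * of_real (cos (real n * \<theta>)))"

section \<open>Integration by parts after the substitution x = 1 - cos \<theta>\<close>

lemma continuous_comp_1_minus_cos:
  fixes f :: "real \<Rightarrow> 'b::topological_space"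
  assumes "continuous_on UNIV f"
  shows "continuous_on S (\<lambda>\<theta>. f (1 - cos \<theta>))"
proof (rule continuous_on_compose2[OF assms])
  show "continuous_on S (\<lambda>\<theta>. 1 - cos \<theta>)"
    by (intro continuous_intros)
qed simp

lemma cos_by_parts:
  fixes f :: "real \<Rightarrow> complex"
  assumes f: "continuous_on {0..pi} f" and f': "continuous_on {0..pi} f'"
    and deriv: "\<And>x. x \<in> {0..pi} \<Longrightarrow> (f has_vector_derivative f' x) (at x)"
  shows "of_nat n * integral {0..pi} (\<lambda>x. f x * of_real (cos (real n * x)))
       = - integral {0..pi} (\<lambda>x. f' x * of_real (sin (real n * x)))"
proof -
  note int = integrable_continuous_interval
  have "((\<lambda>x. f x * of_real (real n * cos (real n * x)) + f' x * of_real (sin (real n * x)))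
     has_integral (f pi * of_real (sin (real n * pi)) - f 0 * of_real (sin (real n * 0)))) {0..pi}"
  proof (rule fundamental_theorem_of_calculus)
    fix x assume x: "x \<in> {0..pi}"
    have "((\<lambda>x. sin (real n * x)) has_real_derivative real n * cos (real n * x)) (at x)"
      by (auto intro!: derivative_eq_intros)
    from has_vector_derivative_mult[OF deriv[OF x] has_vector_derivative_of_real[OF this]]
    show "((\<lambda>x. f x * of_real (sin (real n * x))) has_vector_derivative
        f x * of_real (real n * cos (real n * x)) + f' x * of_real (sin (real n * x))) (at x within {0..pi})"
      by (rule has_vector_derivative_at_within)
  qed simp
  then have "0 = integral {0..pi} (\<lambda>x. of_nat n * (f x * of_real (cos (real n * x))) + f' x * of_real (sin (real n * x)))"
    by (simp add: integral_unique mult_ac)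
  also have "\<dots> = integral {0..pi} (\<lambda>x. of_nat n * (f x * of_real (cos (real n * x)))) + integral {0..pi} (\<lambda>x. f' x * of_real (sin (real n * x)))"
    by (intro Henstock_Kurzweil_Integration.integral_add int continuous_intros f f')
  finally show ?thesis by (simp add: eq_neg_iff_add_eq_0)
qed

lemma sin_by_parts:
  fixes f :: "real \<Rightarrow> complex"
  assumes f: "continuous_on {0..pi} f" and f': "continuous_on {0..pi} f'"
    and deriv: "\<And>x. x \<in> {0..pi} \<Longrightarrow> (f has_vector_derivative f' x) (at x)" and 0: "f 0 = 0" "f pi = 0"
  shows "of_nat n * integral {0..pi} (\<lambda>x. f x * of_real (sin (real n * x)))
       = integral {0..pi} (\<lambda>x. f' x * of_real (cos (real n * x)))"
proof -
  note int = integrable_continuous_interval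
  have "((\<lambda>x. f x * of_real (- real n * sin (real n * x)) + f' x * of_real (cos (real n * x)))
     has_integral (f pi * of_real (cos (real n * pi)) - f 0 * of_real (cos (real n * 0)))) {0..pi}"
  proof (rule fundamental_theorem_of_calculus)
    fix x assume x: "x \<in> {0..pi}"
    have "((\<lambda>x. cos (real n * x)) has_real_derivative - real n * sin (real n * x)) (at x)"
      by (auto intro!: derivative_eq_intros)
    from has_vector_derivative_mult[OF deriv[OF x] has_vector_derivative_of_real[OF this]]
    show "((\<lambda>x. f x * of_real (cos (real n * x))) has_vector_derivative
        f x * of_real (- real n * sin (real n * x)) + f' x * of_real (cos (real n * x))) (at x within {0..pi})"
      by (rule has_vector_derivative_at_within)
  qed simp
  then have "0 = integral {0..pi} (\<lambda>x. f' x * of_real (cos (real n * x)) - of_nat n * (f x * of_real (sin (real n * x))))"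
    using 0 by (simp add: integral_unique mult_ac)
  also have "\<dots> = integral {0..pi} (\<lambda>x. f' x * of_real (cos (real n * x))) - integral {0..pi} (\<lambda>x. of_nat n * (f x * of_real (sin (real n * x))))"
    by (intro Henstock_Kurzweil_Integration.integral_diff int continuous_intros f f')
  finally show ?thesis by simp
qed

lemma integral_sin_comp:
  fixes h :: "real \<Rightarrow> real"
  assumes "continuous_on {0..2} h"
  shows "integral {0..pi} (\<lambda>\<theta>. sin \<theta> * h (1 - cos \<theta>)) = integral {0..2} h"
proof -
  have range: "0 \<le> 1 - cos x" "1 - cos x \<le> 2" for x :: real
    using cos_le_one[of x] cos_ge_minus_one[of x] by linarith+
  have "((\<lambda>x. sin x *\<^sub>R h (1 - cos x)) has_integral integral {1 - cos 0..1 - cos pi} h) {0..pi}"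
    by (rule has_integral_substitution[of _ _ _ 0 2])
       (use assms range in \<open>auto intro!: derivative_eq_intros\<close>)
  then show ?thesis by (simp add: integral_unique)
qed

lemma comp_1_minus_cos_derivative:
  fixes f :: "real \<Rightarrow> complex"
  assumes "\<And>x. (f has_vector_derivative f' x) (at x)"
  shows "((\<lambda>\<theta>. f (1 - cos \<theta>)) has_vector_derivative of_real (sin \<theta>) * f' (1 - cos \<theta>)) (at \<theta>)"
proof -
  have "((\<lambda>\<theta>. 1 - cos \<theta>) has_vector_derivative sin \<theta>) (at \<theta>)"
    by (auto intro!: derivative_eq_intros simp: has_real_derivative_iff_has_vector_derivative[symmetric])
  from vector_diff_chain_at[OF this assms] show ?thesis by (simp add: o_def scaleR_conv_of_real)
qed

text \<open>The derivative of f (1 - cos \<theta>) carries a factor sin \<theta>. Its square is at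
  most sin \<theta> on [0, pi], which is exactly the Jacobian, so no weight is left after returning
  to [0, 2].\<close>

lemma cosine_coeff_first_order:
  assumes f: "continuous_on UNIV f" and f': "continuous_on UNIV f'" and deriv: "\<And>x. (f has_vector_derivative f' x) (at x)"
    and I: "finite I" "I \<subseteq> {1..}"
  shows "(\<Sum>n\<in>I. (real n * cmod (cosine_coeff f n))\<^sup>2) \<le> pi / 2 * integral {0..2} (\<lambda>x. (cmod (f' x))\<^sup>2)"
proof -
  note int = integrable_continuous_interval
  let ?g = "\<lambda>\<theta>. of_real (sin \<theta>) * f' (1 - cos \<theta>)"
  have g: "continuous_on {0..pi} ?g" by (intro continuous_intros continuous_comp_1_minus_cos f')
  have "real n * cmod (cosine_coeff f n) = cmod (integral {0..pi} (\<lambda>\<theta>. ?g \<theta> * of_real (sin (real n * \<theta>))))" for n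
  proof -
    have "of_nat n * cosine_coeff f n = - integral {0..pi} (\<lambda>\<theta>. ?g \<theta> * of_real (sin (real n * \<theta>)))"
      unfolding cosine_coeff_def
      by (rule cos_by_parts[OF continuous_comp_1_minus_cos[OF f] g]) (rule comp_1_minus_cos_derivative[OF deriv])
    then have "cmod (of_nat n * cosine_coeff f n) = cmod (integral {0..pi} (\<lambda>\<theta>. ?g \<theta> * of_real (sin (real n * \<theta>))))"
      by simp
    then show ?thesis by (simp add: norm_mult)
  qed
  then have "(\<Sum>n\<in>I. (real n * cmod (cosine_coeff f n))\<^sup>2)
      = (\<Sum>n\<in>I. (cmod (integral {0..pi} (\<lambda>\<theta>. ?g \<theta> * of_real (sin (real n * \<theta>)))))\<^sup>2)" by simp
  also have "\<dots> \<le> pi / 2 * integral {0..pi} (\<lambda>\<theta>. (cmod (?g \<theta>))\<^sup>2)"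
    by (rule bessel_inequality[OF g])
       (use I trig_orthogonality(2) in \<open>auto intro!: continuous_intros simp: subset_iff\<close>)
  also have "integral {0..pi} (\<lambda>\<theta>. (cmod (?g \<theta>))\<^sup>2) \<le> integral {0..pi} (\<lambda>\<theta>. sin \<theta> * (cmod (f' (1 - cos \<theta>)))\<^sup>2)"
  proof (intro integral_le int continuous_intros g continuous_comp_1_minus_cos f')
    fix \<theta> :: real assume "\<theta> \<in> {0..pi}"
    then have "0 \<le> sin \<theta>" by (auto intro: sin_ge_zero)
    then have "(sin \<theta>)\<^sup>2 \<le> sin \<theta>" by (simp add: power2_eq_square mult_left_le)
    then show "(cmod (?g \<theta>))\<^sup>2 \<le> sin \<theta> * (cmod (f' (1 - cos \<theta>)))\<^sup>2"
      by (simp add: norm_mult power_mult_distrib mult_right_mono)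
  qed
  also have "\<dots> = integral {0..2} (\<lambda>x. (cmod (f' x))\<^sup>2)"
    by (rule integral_sin_comp) (intro continuous_intros continuous_on_subset[OF f'] subset_UNIV)
  finally show ?thesis by simp
qed

text \<open>The factor sin \<theta> of the first derivative vanishes at both ends, so the second
  integration by parts has no boundary terms. In the second derivative f'' still carries enough
  sines to pay for the Jacobian, but f' appears with cos \<theta>; its mean square against d\<theta>
  is not controlled by the one on [0, 2], hence the uniform bound b.\<close>

lemma cosine_coeff_second_order:
  assumes f: "continuous_on UNIV f" and f': "continuous_on UNIV f'" and f'': "continuous_on UNIV f''"
    and deriv: "\<And>x. (f has_vector_derivative f' x) (at x)" and deriv': "\<And>x. (f' has_vector_derivative f'' x) (at x)"
    and b: "\<And>x. cmod (f' x) \<le> b" and I: "finite I" "I \<subseteq> {1..}"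
  shows "(\<Sum>n\<in>I. ((real n)\<^sup>2 * cmod (cosine_coeff f n))\<^sup>2)
    \<le> pi / 2 * (2 * pi * b\<^sup>2 + 2 * integral {0..2} (\<lambda>x. (cmod (f'' x))\<^sup>2))"
proof -
  note int = integrable_continuous_interval
  let ?g = "\<lambda>\<theta>. of_real (sin \<theta>) * f' (1 - cos \<theta>)"
  let ?h = "\<lambda>\<theta>. of_real (cos \<theta>) * f' (1 - cos \<theta>) + of_real ((sin \<theta>)\<^sup>2) * f'' (1 - cos \<theta>)"
  have g: "continuous_on {0..pi} ?g" by (intro continuous_intros continuous_comp_1_minus_cos f')
  have h: "continuous_on {0..pi} ?h" by (intro continuous_intros continuous_comp_1_minus_cos f' f'')
  have gderiv: "(?g has_vector_derivative ?h \<theta>) (at \<theta>)" for \<theta>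
  proof -
    have "((\<lambda>\<theta>. sin \<theta>) has_real_derivative cos \<theta>) (at \<theta>)"
      by (auto intro!: derivative_eq_intros)
    from has_vector_derivative_mult[OF has_vector_derivative_of_real[OF this] comp_1_minus_cos_derivative[OF deriv']]
    show ?thesis by (simp add: power2_eq_square mult_ac add.commute)
  qed
  have "(real n)\<^sup>2 * cmod (cosine_coeff f n) = cmod (integral {0..pi} (\<lambda>\<theta>. ?h \<theta> * of_real (cos (real n * \<theta>))))" for n
  proof -
    have "of_nat n * cosine_coeff f n = - integral {0..pi} (\<lambda>\<theta>. ?g \<theta> * of_real (sin (real n * \<theta>)))"
      unfolding cosine_coeff_def
      by (rule cos_by_parts[OF continuous_comp_1_minus_cos[OF f] g]) (rule comp_1_minus_cos_derivative[OF deriv])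
    then have "of_nat n * (of_nat n * cosine_coeff f n) = - (of_nat n * integral {0..pi} (\<lambda>\<theta>. ?g \<theta> * of_real (sin (real n * \<theta>))))"
      by simp
    also have "of_nat n * integral {0..pi} (\<lambda>\<theta>. ?g \<theta> * of_real (sin (real n * \<theta>)))
        = integral {0..pi} (\<lambda>\<theta>. ?h \<theta> * of_real (cos (real n * \<theta>)))"
      by (rule sin_by_parts[OF g h gderiv]) auto
    finally have "cmod (of_nat n * (of_nat n * cosine_coeff f n)) = cmod (integral {0..pi} (\<lambda>\<theta>. ?h \<theta> * of_real (cos (real n * \<theta>))))"
      by simp
    then show ?thesis by (simp add: norm_mult power2_eq_square)
  qed
  then have "(\<Sum>n\<in>I. ((real n)\<^sup>2 * cmod (cosine_coeff f n))\<^sup>2)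
      = (\<Sum>n\<in>I. (cmod (integral {0..pi} (\<lambda>\<theta>. ?h \<theta> * of_real (cos (real n * \<theta>)))))\<^sup>2)" by simp
  also have "\<dots> \<le> pi / 2 * integral {0..pi} (\<lambda>\<theta>. (cmod (?h \<theta>))\<^sup>2)"
    by (rule bessel_inequality[OF h])
       (use I trig_orthogonality(1) in \<open>auto intro!: continuous_intros simp: subset_iff\<close>)
  also have "integral {0..pi} (\<lambda>\<theta>. (cmod (?h \<theta>))\<^sup>2)
     \<le> integral {0..pi} (\<lambda>\<theta>. 2 * b\<^sup>2 + 2 * (sin \<theta> * (cmod (f'' (1 - cos \<theta>)))\<^sup>2))"
  proof (intro integral_le int continuous_intros continuous_comp_1_minus_cos f' f'')
    fix \<theta> :: real assume "\<theta> \<in> {0..pi}"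
    then have s: "0 \<le> sin \<theta>" by (auto intro: sin_ge_zero)
    let ?u = "of_real (cos \<theta>) * f' (1 - cos \<theta>)" and ?v = "of_real ((sin \<theta>)\<^sup>2) * f'' (1 - cos \<theta>)"
    have u: "cmod ?u \<le> b"
      using mult_mono[of "\<bar>cos \<theta>\<bar>" 1 "cmod (f' (1 - cos \<theta>))" b] b[of "1 - cos \<theta>"] by (simp add: norm_mult)
    \<comment> \<open>Of the four factors sin \<theta> one is kept as the Jacobian and the others
      are at most 1.\<close>
    have "(sin \<theta>)\<^sup>2 * (sin \<theta>)\<^sup>2 \<le> sin \<theta> * 1"
      using s by (intro mult_mono) (auto simp: power2_eq_square mult_left_le intro: mult_le_one)
    then have "((sin \<theta>)\<^sup>2 * (sin \<theta>)\<^sup>2) * (cmod (f'' (1 - cos \<theta>)))\<^sup>2 \<le> sin \<theta> * (cmod (f'' (1 - cos \<theta>)))\<^sup>2"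
      by (intro mult_right_mono) auto
    then have v: "(cmod ?v)\<^sup>2 \<le> sin \<theta> * (cmod (f'' (1 - cos \<theta>)))\<^sup>2"
      by (simp add: norm_mult power_mult_distrib power2_eq_square mult_ac)
    have "(cmod (?u + ?v))\<^sup>2 \<le> (cmod ?u + cmod ?v)\<^sup>2" by (intro power_mono norm_triangle_ineq) auto
    also have "\<dots> \<le> 2 * (cmod ?u)\<^sup>2 + 2 * (cmod ?v)\<^sup>2"
      using sum_squares_bound[of "cmod ?u" "cmod ?v"] by (simp add: power2_sum)
    also have "\<dots> \<le> 2 * b\<^sup>2 + 2 * (sin \<theta> * (cmod (f'' (1 - cos \<theta>)))\<^sup>2)"
      using u v by (intro add_mono mult_left_mono power_mono) auto
    finally show "(cmod (?u + ?v))\<^sup>2 \<le> 2 * b\<^sup>2 + 2 * (sin \<theta> * (cmod (f'' (1 - cos \<theta>)))\<^sup>2)" .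
  qed
  also have "\<dots> = 2 * pi * b\<^sup>2 + 2 * integral {0..pi} (\<lambda>\<theta>. sin \<theta> * (cmod (f'' (1 - cos \<theta>)))\<^sup>2)"
    by (subst Henstock_Kurzweil_Integration.integral_add)
       (auto intro!: int continuous_intros continuous_comp_1_minus_cos f'')
  also have "integral {0..pi} (\<lambda>\<theta>. sin \<theta> * (cmod (f'' (1 - cos \<theta>)))\<^sup>2) = integral {0..2} (\<lambda>x. (cmod (f'' x))\<^sup>2)"
    by (rule integral_sin_comp) (intro continuous_intros continuous_on_subset[OF f''] subset_UNIV)
  finally show ?thesis by simp
qed

section \<open>Decay of the cosine coefficients in terms of a Sobolev norm\<close>

lemma integrable_powr_weight:
  fixes a :: real
  assumes "a > 1 / 2"
  shows "integrable lborel (\<lambda>\<xi>::real. (1 + \<xi>\<^sup>2) powr (- a))"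
proof -
  let ?f = "\<lambda>x::real. indicator {1..} x * x powr (-2 * a)"
  have "(\<lambda>x::real. x powr (-2 * a)) integrable_on {1..}"
    using has_integral_powr_to_inf[of "-2 * a" 1] assms by (auto simp: integrable_on_def)
  then have "(\<lambda>x::real. x powr (-2 * a)) absolutely_integrable_on {1..}"
    by (rule nonnegative_absolutely_integrable_1) auto
  then have "integrable lebesgue ?f" by (simp add: set_integrable_def)
  then have f: "integrable lborel ?f" by (subst (asm) integrable_completion) auto
  have f': "integrable lborel (\<lambda>x. ?f (- x))"
    using lborel_integrable_real_affine[OF f, of "-1" 0] by simp
  have i: "integrable lborel (indicator {-1..1::real} :: real \<Rightarrow> real)"
    by (intro integrable_real_indicator) auto
  show ?thesis
  proof (rule Bochner_Integration.integrable_bound)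
    show "integrable lborel (\<lambda>x. indicator {-1..1} x + ?f x + ?f (- x))" using f f' i by simp
    have "(1 + x\<^sup>2) powr (- a) \<le> indicator {-1..1} x + ?f x + ?f (- x)" for x :: real
    proof (cases "\<bar>x\<bar> \<le> 1")
      case True
      have "(1 + x\<^sup>2) powr (- a) \<le> (1 + x\<^sup>2) powr 0" using assms by (intro powr_mono) auto
      also have "\<dots> = 1" using add_pos_nonneg[of 1 "x\<^sup>2"] by simp
      finally show ?thesis using True by (auto simp: indicator_def abs_le_iff)
    next
      case False
      then have "0 < x\<^sup>2" by (cases "x = 0") auto
      then have "(1 + x\<^sup>2) powr (- a) \<le> (x\<^sup>2) powr (- a)" using assms by (intro powr_mono2') auto
      also have "(x\<^sup>2) powr (- a) = (\<bar>x\<bar> powr 2) powr (- a)" using False by simp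
      also have "\<dots> = \<bar>x\<bar> powr (-2 * a)" unfolding powr_powr by simp
      finally have "(1 + x\<^sup>2) powr (- a) \<le> \<bar>x\<bar> powr (-2 * a)" .
      then show ?thesis using False by (auto simp: indicator_def abs_if split: if_splits)
    qed
    then show "AE x in lborel. norm ((1 + x\<^sup>2) powr (- a)) \<le> norm (indicator {-1..1} x + ?f x + ?f (- x))"
      by (intro AE_I2) (simp add: order_trans[OF _ abs_ge_self])
  qed simp
qed

section \<open>Weighted norms on the frequency side\<close>

definition sobolev_weight :: "real \<Rightarrow> (real \<Rightarrow> complex) \<Rightarrow> real \<Rightarrow> real" where
  "sobolev_weight s H \<xi> = (1 + \<xi>\<^sup>2) powr s * (cmod (H \<xi>))\<^sup>2"

lemma sobolev_weight_nonneg [simp]: "0 \<le> sobolev_weight s H \<xi>"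
  by (simp add: sobolev_weight_def)

lemma one_plus_square_pos [simp]: "0 < 1 + (x::real)\<^sup>2"
  and one_plus_square_neq_0 [simp]: "1 + (x::real)\<^sup>2 \<noteq> 0"
  by (simp_all add: add_pos_nonneg add_nonneg_eq_0_iff)

lemma sobolev_weight_L1:
  assumes H [measurable]: "H \<in> borel_measurable borel" and W: "integrable lborel (sobolev_weight s H)" and r: "s - r > 1 / 2"
  shows "integrable lborel (\<lambda>\<xi>. (1 + \<xi>\<^sup>2) powr (r / 2) * cmod (H \<xi>))"
    and "(LINT \<xi>|lborel. (1 + \<xi>\<^sup>2) powr (r / 2) * cmod (H \<xi>))
      \<le> sqrt (LINT \<xi>|lborel. (1 + \<xi>\<^sup>2) powr (- (s - r))) * sqrt (LINT \<xi>|lborel. sobolev_weight s H \<xi>)"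
proof -
  let ?u = "\<lambda>\<xi>::real. (1 + \<xi>\<^sup>2) powr (- (s - r) / 2)" and ?v = "\<lambda>\<xi>. (1 + \<xi>\<^sup>2) powr (s / 2) * cmod (H \<xi>)"
  have u: "(\<lambda>\<xi>. (?u \<xi>)\<^sup>2) = (\<lambda>\<xi>. (1 + \<xi>\<^sup>2) powr (- (s - r)))"
    by (simp add: power2_eq_square powr_add[symmetric])
  have v: "(\<lambda>\<xi>. (?v \<xi>)\<^sup>2) = sobolev_weight s H"
    by (simp add: sobolev_weight_def fun_eq_iff power_mult_distrib) (simp add: power2_eq_square powr_add[symmetric])
  have uv: "(\<lambda>\<xi>. ?u \<xi> * ?v \<xi>) = (\<lambda>\<xi>. (1 + \<xi>\<^sup>2) powr (r / 2) * cmod (H \<xi>))"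
    by (simp add: mult.assoc[symmetric] powr_add[symmetric] diff_divide_distrib)
  have um: "?u \<in> borel_measurable lborel" and vm: "?v \<in> borel_measurable lborel" by measurable
  have ui: "integrable lborel (\<lambda>\<xi>. (?u \<xi>)\<^sup>2)" unfolding u by (rule integrable_powr_weight[OF r])
  have vi: "integrable lborel (\<lambda>\<xi>. (?v \<xi>)\<^sup>2)" unfolding v by (rule W)
  note cs = cauchy_schwarz_integral[OF um vm ui vi]
  show "integrable lborel (\<lambda>\<xi>. (1 + \<xi>\<^sup>2) powr (r / 2) * cmod (H \<xi>))" using cs(1) unfolding uv .
  have "\<bar>?u \<xi> * ?v \<xi>\<bar> = ?u \<xi> * ?v \<xi>" for \<xi> by simp
  then show "(LINT \<xi>|lborel. (1 + \<xi>\<^sup>2) powr (r / 2) * cmod (H \<xi>))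
      \<le> sqrt (LINT \<xi>|lborel. (1 + \<xi>\<^sup>2) powr (- (s - r))) * sqrt (LINT \<xi>|lborel. sobolev_weight s H \<xi>)"
    using cs(2) unfolding u v by (simp only: uv)
qed

text \<open>Exchanging the order s for t on a set of frequencies costs a bound for the ratio of the
  two weights on that set.\<close>

lemma sobolev_weight_cutoff:
  assumes H [measurable]: "H \<in> borel_measurable borel" and W: "integrable lborel (sobolev_weight s H)"
    and [measurable]: "A \<in> sets borel" and c: "c \<ge> 0"
    and le: "\<And>\<xi>. \<xi> \<in> A \<Longrightarrow> (1 + \<xi>\<^sup>2) powr t \<le> c * (1 + \<xi>\<^sup>2) powr s"
  shows "integrable lborel (sobolev_weight t (\<lambda>\<xi>. indicator A \<xi> *\<^sub>R H \<xi>))"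
    and "(LINT \<xi>|lborel. sobolev_weight t (\<lambda>\<xi>. indicator A \<xi> *\<^sub>R H \<xi>) \<xi>) \<le> c * (LINT \<xi>|lborel. sobolev_weight s H \<xi>)"
proof -
  have *: "sobolev_weight t (\<lambda>\<xi>. indicator A \<xi> *\<^sub>R H \<xi>) \<xi> \<le> c * sobolev_weight s H \<xi>" for \<xi>
  proof (cases "\<xi> \<in> A")
    case True
    from mult_right_mono[OF le[OF True], of "(cmod (H \<xi>))\<^sup>2"] show ?thesis
      using True by (simp add: sobolev_weight_def mult.assoc)
  qed (use c in \<open>simp add: sobolev_weight_def\<close>)
  show i: "integrable lborel (sobolev_weight t (\<lambda>\<xi>. indicator A \<xi> *\<^sub>R H \<xi>))"
  proof (rule Bochner_Integration.integrable_bound)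
    show "integrable lborel (\<lambda>\<xi>. c * sobolev_weight s H \<xi>)" using W by simp
    show "sobolev_weight t (\<lambda>\<xi>. indicator A \<xi> *\<^sub>R H \<xi>) \<in> borel_measurable lborel"
      unfolding sobolev_weight_def[abs_def] by measurable
  qed (use * c in \<open>auto simp: abs_mult\<close>)
  show "(LINT \<xi>|lborel. sobolev_weight t (\<lambda>\<xi>. indicator A \<xi> *\<^sub>R H \<xi>) \<xi>) \<le> c * (LINT \<xi>|lborel. sobolev_weight s H \<xi>)"
    unfolding integral_mult_right_zero[symmetric] by (rule integral_mono[OF i _ *]) (use W in simp)
qed

lemma integral_le_sobolev_weight:
  assumes g [measurable]: "g \<in> borel_measurable borel" and W: "integrable lborel (sobolev_weight t H)"
    and le: "\<And>\<xi>. (cmod (g \<xi>))\<^sup>2 \<le> sobolev_weight t H \<xi>"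
  shows "integrable lborel (\<lambda>\<xi>. (cmod (g \<xi>))\<^sup>2)" "(LINT \<xi>|lborel. (cmod (g \<xi>))\<^sup>2) \<le> (LINT \<xi>|lborel. sobolev_weight t H \<xi>)"
proof -
  show i: "integrable lborel (\<lambda>\<xi>. (cmod (g \<xi>))\<^sup>2)"
    by (rule Bochner_Integration.integrable_bound[OF W]) (use le in auto)
  show "(LINT \<xi>|lborel. (cmod (g \<xi>))\<^sup>2) \<le> (LINT \<xi>|lborel. sobolev_weight t H \<xi>)"
    by (rule integral_mono[OF i W le])
qed

text \<open>The squared Cauchy-Schwarz factor in \<open>sobolev_weight_L1\<close> for orders 2 and
  1; it enters the uniform bound on the derivative of the low-frequency part.\<close>

definition weight_const :: real where
  "weight_const = (LINT \<xi>|lborel. (1 + \<xi>\<^sup>2) powr (- 1 :: real))"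

lemma weight_const_nonneg: "0 \<le> weight_const"
  unfolding weight_const_def by (intro integral_nonneg_AE) auto

lemma norm_times_le_weight: "\<bar>\<xi>\<bar> * x \<le> (1 + \<xi>\<^sup>2) powr (1 / 2) * x" if "0 \<le> x" for x \<xi> :: real
proof -
  have "\<bar>\<xi>\<bar> = sqrt (\<xi>\<^sup>2)" by simp
  also have "\<dots> \<le> sqrt (1 + \<xi>\<^sup>2)" by (intro real_sqrt_le_mono) simp
  also have "\<dots> = (1 + \<xi>\<^sup>2) powr (1 / 2)" by (simp add: powr_half_sqrt)
  finally show ?thesis using that by (intro mult_right_mono) auto
qed

text \<open>The constant is pi / 2 from Bessel's inequality times 2 pi exp 2 from
  \<open>local_plancherel\<close>.\<close>

lemma high_frequency_bound:
  assumes H [measurable]: "H \<in> borel_measurable borel" and H1: "integrable lborel H" and W: "integrable lborel (sobolev_weight 1 H)"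
    and H1': "integrable lborel (\<lambda>\<xi>. \<i> * of_real \<xi> * H \<xi>)" and I: "finite I" "I \<subseteq> {1..}"
  shows "(\<Sum>n\<in>I. (real n * cmod (cosine_coeff (fourier_int H) n))\<^sup>2)
    \<le> pi\<^sup>2 * exp 2 * (LINT \<xi>|lborel. sobolev_weight 1 H \<xi>)"
proof -
  let ?H' = "\<lambda>\<xi>. \<i> * of_real \<xi> * H \<xi>"
  have le: "(cmod (?H' \<xi>))\<^sup>2 \<le> sobolev_weight 1 H \<xi>" for \<xi>
    by (simp add: norm_mult power_mult_distrib sobolev_weight_def mult_right_mono)
  note L2 = integral_le_sobolev_weight[OF _ W le]
  have "(\<Sum>n\<in>I. (real n * cmod (cosine_coeff (fourier_int H) n))\<^sup>2)
     \<le> pi / 2 * integral {0..2} (\<lambda>x. (cmod (fourier_int ?H' x))\<^sup>2)"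
    by (intro cosine_coeff_first_order continuous_fourier_int fourier_int_derivative H1 H1' I)
  also have "\<dots> \<le> pi / 2 * (2 * pi * exp 2 * (LINT \<xi>|lborel. (cmod (?H' \<xi>))\<^sup>2))"
    using L2(1) by (intro mult_left_mono local_plancherel H1') auto
  also have "\<dots> \<le> pi / 2 * (2 * pi * exp 2 * (LINT \<xi>|lborel. sobolev_weight 1 H \<xi>))"
    using L2(2) by (intro mult_left_mono) auto
  finally show ?thesis by (simp add: power2_eq_square)
qed

lemma low_frequency_bound:
  assumes H [measurable]: "H \<in> borel_measurable borel" and H1: "integrable lborel H" and W: "integrable lborel (sobolev_weight 2 H)"
    and H1': "integrable lborel (\<lambda>\<xi>. \<i> * of_real \<xi> * H \<xi>)"
    and H1'': "integrable lborel (\<lambda>\<xi>. \<i> * of_real \<xi> * (\<i> * of_real \<xi> * H \<xi>))" and I: "finite I" "I \<subseteq> {1..}"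
  shows "(\<Sum>n\<in>I. ((real n)\<^sup>2 * cmod (cosine_coeff (fourier_int H) n))\<^sup>2)
    \<le> (pi\<^sup>2 * weight_const + 2 * pi\<^sup>2 * exp 2) * (LINT \<xi>|lborel. sobolev_weight 2 H \<xi>)"
proof -
  let ?H' = "\<lambda>\<xi>. \<i> * of_real \<xi> * H \<xi>" and ?H'' = "\<lambda>\<xi>. \<i> * of_real \<xi> * (\<i> * of_real \<xi> * H \<xi>)"
  define V where "V = (LINT \<xi>|lborel. sobolev_weight 2 H \<xi>)"
  have V: "0 \<le> V" unfolding V_def by (intro integral_nonneg_AE) auto
  \<comment> \<open>The uniform bound on the first derivative demanded by
    \<open>cosine_coeff_second_order\<close>.\<close>
  define b where "b = (LINT \<xi>|lborel. cmod (?H' \<xi>))"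
  have b0: "0 \<le> b" unfolding b_def by (intro integral_nonneg_AE) auto
  have b: "b\<^sup>2 \<le> weight_const * V"
  proof -
    note w = sobolev_weight_L1[OF H W, of 1]
    have "b \<le> (LINT \<xi>|lborel. (1 + \<xi>\<^sup>2) powr (1 / 2) * cmod (H \<xi>))"
      unfolding b_def
      by (intro integral_mono integrable_norm H1') (use w(1) norm_times_le_weight in \<open>auto simp: norm_mult\<close>)
    also have "\<dots> \<le> sqrt weight_const * sqrt V" using w(2) by (simp add: weight_const_def V_def)
    finally have "b\<^sup>2 \<le> (sqrt weight_const * sqrt V)\<^sup>2" using b0 by (rule power_mono)
    then show ?thesis using V weight_const_nonneg by (simp add: power_mult_distrib)
  qed
  have le: "(cmod (?H'' \<xi>))\<^sup>2 \<le> sobolev_weight 2 H \<xi>" for \<xi>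
  proof -
    have "(\<xi>\<^sup>2)\<^sup>2 \<le> (1 + \<xi>\<^sup>2)\<^sup>2" by (intro power_mono) auto
    then have "(\<xi>\<^sup>2)\<^sup>2 * (cmod (H \<xi>))\<^sup>2 \<le> (1 + \<xi>\<^sup>2)\<^sup>2 * (cmod (H \<xi>))\<^sup>2" by (rule mult_right_mono) simp
    then show ?thesis
      by (simp add: norm_mult power_mult_distrib sobolev_weight_def power2_eq_square mult_ac)
  qed
  note L2 = integral_le_sobolev_weight[OF _ W le]
  have "(\<Sum>n\<in>I. ((real n)\<^sup>2 * cmod (cosine_coeff (fourier_int H) n))\<^sup>2)
     \<le> pi / 2 * (2 * pi * b\<^sup>2 + 2 * integral {0..2} (\<lambda>x. (cmod (fourier_int ?H'' x))\<^sup>2))"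
    unfolding b_def
    by (intro cosine_coeff_second_order[where f' = "fourier_int ?H'"] continuous_fourier_int fourier_int_derivative
      norm_fourier_int_le H1 H1' H1'' I)
  also have "\<dots> \<le> pi / 2 * (2 * pi * (weight_const * V) + 2 * (2 * pi * exp 2 * V))"
  proof (intro mult_left_mono add_mono b)
    have "integral {0..2} (\<lambda>x. (cmod (fourier_int ?H'' x))\<^sup>2) \<le> 2 * pi * exp 2 * (LINT \<xi>|lborel. (cmod (?H'' \<xi>))\<^sup>2)"
      using L2(1) by (intro local_plancherel H1'') auto
    also have "\<dots> \<le> 2 * pi * exp 2 * V" using L2(2) by (intro mult_left_mono) (auto simp: V_def)
    finally show "integral {0..2} (\<lambda>x. (cmod (fourier_int ?H'' x))\<^sup>2) \<le> 2 * pi * exp 2 * V" .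
  qed auto
  also have "\<dots> = (pi\<^sup>2 * weight_const + 2 * pi\<^sup>2 * exp 2) * V" by (simp add: power2_eq_square algebra_simps)
  finally show ?thesis by (simp add: V_def)
qed

text \<open>The high-frequency and low-frequency constants, each doubled because the square of a sum
  is split; \<open>2 powr (2 - s)\<close> comes from 1 + \<xi>\<xi> being at most twice the square
  of N for low frequencies.\<close>

definition block_const :: "real \<Rightarrow> real" where
  "block_const s = 2 * pi\<^sup>2 * exp 2 + 2 * (pi\<^sup>2 * weight_const + 2 * pi\<^sup>2 * exp 2) * 2 powr (2 - s)"

text \<open>For coefficients of index about \<open>N\<close>, frequencies above \<open>N\<close> are estimated by one integration by parts and
  the others by two: real interpolation between the orders 1 and 2.\<close>
lemma dyadic_block_bound:
  assumes s: "3 / 2 < s" "s \<le> 2" and H [measurable]: "H \<in> borel_measurable borel" 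
    and W: "integrable lborel (sobolev_weight s H)" and N: "N \<ge> 1"
  shows "(\<Sum>n\<in>{N..<2 * N}. real n * cmod (cosine_coeff (fourier_int H) n))
    \<le> sqrt (block_const s * (LINT \<xi>|lborel. sobolev_weight s H \<xi>)) * real N powr (3 / 2 - s)"
proof -
  define w where "w = (LINT \<xi>|lborel. sobolev_weight s H \<xi>)"
  have w0: "0 \<le> w" unfolding w_def by (intro integral_nonneg_AE) auto
  let ?I = "{N..<2 * N}"
  have I: "finite ?I" "?I \<subseteq> {1..}" using N by auto
  define A where "A = {- real N<..<real N}"
  define Hl where "Hl = (\<lambda>\<xi>. indicator A \<xi> *\<^sub>R H \<xi>)"
  define Hh where "Hh = (\<lambda>\<xi>. indicator (- A) \<xi> *\<^sub>R H \<xi>)"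
  have [measurable]: "A \<in> sets borel" by (simp add: A_def)
  have [measurable]: "Hl \<in> borel_measurable borel" "Hh \<in> borel_measurable borel"
    unfolding Hl_def Hh_def by measurable
  have H1: "integrable lborel H"
    using sobolev_weight_L1(1)[OF H W, of 0] s integrable_norm_iff[of H lborel] by simp
  have H2: "integrable lborel (\<lambda>\<xi>. \<i> * of_real \<xi> * H \<xi>)"
  proof (rule Bochner_Integration.integrable_bound)
    show "integrable lborel (\<lambda>\<xi>. (1 + \<xi>\<^sup>2) powr (1 / 2) * cmod (H \<xi>))"
      using sobolev_weight_L1(1)[OF H W, of 1] s by simp
  qed (use norm_times_le_weight in \<open>auto simp: norm_mult abs_mult\<close>)
  have l1: "integrable lborel Hl" and h1: "integrable lborel Hh"
    by (rule Bochner_Integration.integrable_bound[OF H1]; auto simp: Hl_def Hh_def indicator_def)+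
  have l2: "integrable lborel (\<lambda>\<xi>. \<i> * of_real \<xi> * Hl \<xi>)" and h2: "integrable lborel (\<lambda>\<xi>. \<i> * of_real \<xi> * Hh \<xi>)"
    by (rule Bochner_Integration.integrable_bound[OF H2]; auto simp: Hl_def Hh_def indicator_def norm_mult)+
  have l3: "integrable lborel (\<lambda>\<xi>. \<i> * of_real \<xi> * (\<i> * of_real \<xi> * Hl \<xi>))"
  proof (rule Bochner_Integration.integrable_bound)
    show "integrable lborel (\<lambda>\<xi>. real N * cmod (\<i> * of_real \<xi> * Hl \<xi>))" using l2 by (intro integrable_mult_right integrable_norm)
  qed (auto simp: Hl_def A_def indicator_def norm_mult abs_mult intro!: mult_right_mono)
  have split: "cosine_coeff (fourier_int H) n = cosine_coeff (fourier_int Hl) n + cosine_coeff (fourier_int Hh) n" for n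
  proof -
    have "fourier_int H x = fourier_int Hl x + fourier_int Hh x" for x
    proof -
      have "(\<lambda>\<xi>. H \<xi> * cis (x * \<xi>)) = (\<lambda>\<xi>. Hl \<xi> * cis (x * \<xi>) + Hh \<xi> * cis (x * \<xi>))"
        by (auto simp: Hl_def Hh_def indicator_def)
      then show ?thesis unfolding fourier_int_def
        using integrable_mult_cis[OF l1] integrable_mult_cis[OF h1] by simp
    qed
    then show ?thesis unfolding cosine_coeff_def
      by (simp add: distrib_right)
         (intro Henstock_Kurzweil_Integration.integral_add integrable_continuous_interval continuous_intros
           continuous_comp_1_minus_cos continuous_fourier_int l1 h1)
  qed
  let ?h = "\<lambda>n. cmod (cosine_coeff (fourier_int Hh) n)" and ?l = "\<lambda>n. cmod (cosine_coeff (fourier_int Hl) n)"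
  have pw: "(1 + \<xi>\<^sup>2) powr t = (1 + \<xi>\<^sup>2) powr (t - s) * (1 + \<xi>\<^sup>2) powr s" for \<xi> t :: real
    by (simp add: powr_add[symmetric])
  have N2: "((real N)\<^sup>2) powr t = real N powr (2 * t)" for t
  proof -
    have "((real N)\<^sup>2) powr t = (real N powr 2) powr t" using N by simp
    then show ?thesis unfolding powr_powr .
  qed
  have h: "(\<Sum>n\<in>?I. (real n * ?h n)\<^sup>2) \<le> pi\<^sup>2 * exp 2 * (real N powr (2 - 2 * s) * w)"
  proof -
    \<comment> \<open>The exponent 1 - s is negative, so the ratio of the weights is largest at the
      cutoff frequency N.\<close>
    have le: "(1 + \<xi>\<^sup>2) powr 1 \<le> real N powr (2 - 2 * s) * (1 + \<xi>\<^sup>2) powr s" if "\<xi> \<in> - A" for \<xi>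
    proof -
      have "real N \<le> \<bar>\<xi>\<bar>" using that by (auto simp: A_def)
      then have "(real N)\<^sup>2 \<le> \<bar>\<xi>\<bar>\<^sup>2" by (intro power_mono) auto
      then have "(real N)\<^sup>2 \<le> 1 + \<xi>\<^sup>2" by simp
      then have "(1 + \<xi>\<^sup>2) powr (1 - s) \<le> ((real N)\<^sup>2) powr (1 - s)" using N s by (intro powr_mono2') auto
      then have "(1 + \<xi>\<^sup>2) powr (1 - s) \<le> real N powr (2 - 2 * s)" unfolding N2 by (simp add: algebra_simps)
      then show ?thesis unfolding pw[of \<xi> 1] by (intro mult_right_mono) auto
    qed
    have cut: "integrable lborel (sobolev_weight 1 Hh)" "(LINT \<xi>|lborel. sobolev_weight 1 Hh \<xi>) \<le> real N powr (2 - 2 * s) * w"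
      unfolding Hh_def w_def by (rule sobolev_weight_cutoff[OF H W]; (rule le)?; simp)+
    have "(\<Sum>n\<in>?I. (real n * ?h n)\<^sup>2) \<le> pi\<^sup>2 * exp 2 * (LINT \<xi>|lborel. sobolev_weight 1 Hh \<xi>)"
      using cut(1) by (intro high_frequency_bound h1 h2 I) auto
    also have "\<dots> \<le> pi\<^sup>2 * exp 2 * (real N powr (2 - 2 * s) * w)"
      using cut(2) by (intro mult_left_mono) auto
    finally show ?thesis .
  qed
  let ?c = "pi\<^sup>2 * weight_const + 2 * pi\<^sup>2 * exp 2"
  have c0: "0 \<le> ?c" using weight_const_nonneg by simp
  have l: "(\<Sum>n\<in>?I. ((real n)\<^sup>2 * ?l n)\<^sup>2) \<le> ?c * (2 powr (2 - s) * real N powr (4 - 2 * s) * w)"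
  proof -
    \<comment> \<open>Now s \<le> 2 makes the exponent 2 - s nonnegative, and again the ratio is
      controlled at the cutoff.\<close>
    have le: "(1 + \<xi>\<^sup>2) powr 2 \<le> 2 powr (2 - s) * real N powr (4 - 2 * s) * (1 + \<xi>\<^sup>2) powr s" if "\<xi> \<in> A" for \<xi>
    proof -
      have "\<bar>\<xi>\<bar>\<^sup>2 \<le> (real N)\<^sup>2" using that by (intro power_mono) (auto simp: A_def)
      moreover have "1 \<le> (real N)\<^sup>2" using N by simp
      ultimately have "1 + \<xi>\<^sup>2 \<le> 2 * (real N)\<^sup>2" by simp
      then have "(1 + \<xi>\<^sup>2) powr (2 - s) \<le> (2 * (real N)\<^sup>2) powr (2 - s)" using s by (intro powr_mono2) auto
      also have "\<dots> = 2 powr (2 - s) * real N powr (4 - 2 * s)" by (simp add: powr_mult N2 algebra_simps)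
      finally show ?thesis unfolding pw[of \<xi> 2] by (intro mult_right_mono) auto
    qed
    have cut: "integrable lborel (sobolev_weight 2 Hl)" "(LINT \<xi>|lborel. sobolev_weight 2 Hl \<xi>) \<le> 2 powr (2 - s) * real N powr (4 - 2 * s) * w"
      unfolding Hl_def w_def by (rule sobolev_weight_cutoff[OF H W]; (rule le)?; simp)+
    have "(\<Sum>n\<in>?I. ((real n)\<^sup>2 * ?l n)\<^sup>2) \<le> ?c * (LINT \<xi>|lborel. sobolev_weight 2 Hl \<xi>)"
      using cut(1) by (intro low_frequency_bound l1 l2 l3 I) auto
    also have "\<dots> \<le> ?c * (2 powr (2 - s) * real N powr (4 - 2 * s) * w)"
      using cut(2) c0 by (intro mult_left_mono) auto
    finally show ?thesis .
  qed
  have termwise: "(real n * cmod (cosine_coeff (fourier_int H) n))\<^sup>2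
      \<le> 2 * (real n * ?h n)\<^sup>2 + 2 / (real N)\<^sup>2 * ((real n)\<^sup>2 * ?l n)\<^sup>2" if "n \<in> ?I" for n
  proof -
    have "cmod (cosine_coeff (fourier_int H) n) \<le> ?l n + ?h n" unfolding split by (rule norm_triangle_ineq)
    then have "(real n * cmod (cosine_coeff (fourier_int H) n))\<^sup>2 \<le> (real n * (?l n + ?h n))\<^sup>2"
      by (intro power_mono mult_left_mono) auto
    also have "\<dots> = (real n * ?l n + real n * ?h n)\<^sup>2" by (simp add: distrib_left)
    also have "\<dots> \<le> 2 * (real n * ?l n)\<^sup>2 + 2 * (real n * ?h n)\<^sup>2"
      using sum_squares_bound[of "real n * ?l n" "real n * ?h n"] by (simp add: power2_sum)
    \<comment> \<open>The low part was bounded with one more power of n; since n \<ge> N, that power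
      is exchanged for a factor 1 / N.\<close>
    also have "(real n * ?l n)\<^sup>2 \<le> 1 / (real N)\<^sup>2 * ((real n)\<^sup>2 * ?l n)\<^sup>2"
    proof -
      have "real N * (real n * ?l n) \<le> real n * (real n * ?l n)"
        using that by (intro mult_right_mono) auto
      then have "(real N * (real n * ?l n))\<^sup>2 \<le> ((real n)\<^sup>2 * ?l n)\<^sup>2"
        by (intro power_mono) (auto simp: power2_eq_square mult_ac)
      then show ?thesis using N by (simp add: power_mult_distrib field_simps)
    qed
    finally show ?thesis by simp
  qed
  \<comment> \<open>The block has N indices: Cauchy-Schwarz costs a factor N in the square, the half
    derivative in 3/2.\<close>
  have "(\<Sum>n\<in>?I. real n * cmod (cosine_coeff (fourier_int H) n))\<^sup>2
     \<le> (\<Sum>n\<in>?I. 1\<^sup>2) * (\<Sum>n\<in>?I. (real n * cmod (cosine_coeff (fourier_int H) n))\<^sup>2)"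
    using Cauchy_Schwarz_ineq_sum[of "\<lambda>_. 1" "\<lambda>n. real n * cmod (cosine_coeff (fourier_int H) n)" ?I] by simp
  also have "\<dots> = real N * (\<Sum>n\<in>?I. (real n * cmod (cosine_coeff (fourier_int H) n))\<^sup>2)" by simp
  also have "\<dots> \<le> real N * (\<Sum>n\<in>?I. 2 * (real n * ?h n)\<^sup>2 + 2 / (real N)\<^sup>2 * ((real n)\<^sup>2 * ?l n)\<^sup>2)"
    by (intro mult_left_mono sum_mono termwise) auto
  also have "\<dots> = real N * (2 * (\<Sum>n\<in>?I. (real n * ?h n)\<^sup>2) + 2 / (real N)\<^sup>2 * (\<Sum>n\<in>?I. ((real n)\<^sup>2 * ?l n)\<^sup>2))"
    by (simp add: sum.distrib sum_distrib_left)
  also have "\<dots> \<le> real N * (2 * (pi\<^sup>2 * exp 2 * (real N powr (2 - 2 * s) * w))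
      + 2 / (real N)\<^sup>2 * (?c * (2 powr (2 - s) * real N powr (4 - 2 * s) * w)))"
    by (intro mult_left_mono add_mono h l) auto
  \<comment> \<open>Both parts now scale as N to the power 3 - 2 s: the low one has 4 - 2 s, reduced
    by 2 and raised by 1.\<close>
  also have "\<dots> = block_const s * w * (real N powr (3 / 2 - s))\<^sup>2"
  proof -
    have "(real N powr (3 / 2 - s))\<^sup>2 = real N powr (1 + (2 - 2 * s))"
      unfolding power2_eq_square powr_add[symmetric] by simp
    then have e1: "(real N powr (3 / 2 - s))\<^sup>2 = real N * real N powr (2 - 2 * s)"
      using N unfolding powr_add by simp
    have "real N powr (4 - 2 * s) = real N powr 2 * real N powr (2 - 2 * s)"
      unfolding powr_add[symmetric] by simp
    then have e2: "real N powr (4 - 2 * s) = (real N)\<^sup>2 * real N powr (2 - 2 * s)"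
      using N by simp
    show ?thesis unfolding e1 e2 block_const_def using N by (simp add: field_simps)
  qed
  finally have "(\<Sum>n\<in>?I. real n * cmod (cosine_coeff (fourier_int H) n))\<^sup>2
      \<le> block_const s * w * (real N powr (3 / 2 - s))\<^sup>2" .
  then have "(\<Sum>n\<in>?I. real n * cmod (cosine_coeff (fourier_int H) n)) \<le> sqrt (block_const s * w * (real N powr (3 / 2 - s))\<^sup>2)"
    by (rule real_le_rsqrt)
  then show ?thesis by (simp add: real_sqrt_mult w_def)
qed

text \<open>The blocks cover the positive indices only, so \<open>a 0\<close> is counted separately;
  the rest is a geometric series.\<close>

lemma summable_dyadic:
  fixes a :: "nat \<Rightarrow> real"
  assumes a: "\<And>n. 0 \<le> a n" and q: "0 \<le> q" "q < 1" and c: "0 \<le> c"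
    and block: "\<And>j. (\<Sum>n\<in>{2 ^ j..<2 * 2 ^ j}. a n) \<le> c * q ^ j"
  shows "summable a" "(\<Sum>n. a n) \<le> a 0 + c / (1 - q)"
proof -
  have part: "(\<Sum>n<2 ^ j. a n) \<le> a 0 + (\<Sum>i<j. c * q ^ i)" for j
  proof (induction j)
    case (Suc j)
    have "(\<Sum>n<2 ^ Suc j. a n) = (\<Sum>n<2 ^ j. a n) + (\<Sum>n\<in>{2 ^ j..<2 * 2 ^ j}. a n)"
      unfolding lessThan_atLeast0 power_Suc by (rule sum.atLeastLessThan_concat[symmetric]) simp_all
    then show ?case using Suc block[of j] by simp
  qed simp
  have geo: "(\<Sum>i<j. c * q ^ i) \<le> c / (1 - q)" for j
  proof -
    have "(\<Sum>i<j. c * q ^ i) = c * ((1 - q ^ j) / (1 - q))"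
      using q sum_gp_strict[of q j] by (simp add: sum_distrib_left[symmetric])
    also have "\<dots> \<le> c * (1 / (1 - q))" using q c by (intro mult_left_mono divide_right_mono) auto
    finally show ?thesis by simp
  qed
  have le: "(\<Sum>n<j. a n) \<le> a 0 + c / (1 - q)" for j
  proof -
    have "(\<Sum>n<j. a n) \<le> (\<Sum>n<2 ^ j. a n)" using a less_exp[of j] by (intro sum_mono2) auto
    then show ?thesis using part[of j] geo[of j] by linarith
  qed
  show "summable a" by (rule summableI_nonneg_bounded[OF a le])
  then show "(\<Sum>n. a n) \<le> a 0 + c / (1 - q)" by (rule suminf_le_const) (rule le)
qed

lemma cosine_coeff_bound:
  assumes s: "3 / 2 < s" "s \<le> 2"
  shows "\<exists>C\<ge>0. \<forall>H. H \<in> borel_measurable borel \<and> integrable lborel (sobolev_weight s H) \<longrightarrow>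
    summable (\<lambda>n. (real n + 1) * cmod (cosine_coeff (fourier_int H) n)) \<and>
    (\<Sum>n. (real n + 1) * cmod (cosine_coeff (fourier_int H) n)) \<le> C * sqrt (LINT \<xi>|lborel. sobolev_weight s H \<xi>)"
proof -
  define q where "q = 2 powr (3 / 2 - s)"
  define K where "K = (LINT \<xi>|lborel. (1 + \<xi>\<^sup>2) powr (- s))"
  have q: "0 \<le> q" "q < 1" using s by (auto simp: q_def powr_less_one)
  have K: "0 \<le> K" unfolding K_def by (intro integral_nonneg_AE) auto
  have bc: "0 \<le> block_const s" unfolding block_const_def using weight_const_nonneg by simp
  \<comment> \<open>The first summand bounds the coefficient of index 0 by the supremum of the
    function; in the second, the factor 2 is due to n + 1 \<le> 2 n for n \<ge> 1 and 1 / (1 - q) to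
    the geometric series over blocks.\<close>
  define C where "C = pi * sqrt K + 2 * (sqrt (block_const s) / (1 - q))"
  have "0 \<le> C" using q K bc by (simp add: C_def)
  moreover have "summable (\<lambda>n. (real n + 1) * cmod (cosine_coeff (fourier_int H) n)) \<and>
    (\<Sum>n. (real n + 1) * cmod (cosine_coeff (fourier_int H) n)) \<le> C * sqrt (LINT \<xi>|lborel. sobolev_weight s H \<xi>)"
    if H: "H \<in> borel_measurable borel" and W: "integrable lborel (sobolev_weight s H)" for H
  proof -
    define w where "w = sqrt (LINT \<xi>|lborel. sobolev_weight s H \<xi>)"
    have w: "0 \<le> w" by (simp add: w_def integral_nonneg_AE)
    let ?a = "\<lambda>n. cmod (cosine_coeff (fourier_int H) n)"
    have block: "(\<Sum>n\<in>{2 ^ j..<2 * 2 ^ j}. real n * ?a n) \<le> (sqrt (block_const s) * w) * q ^ j" for j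
    proof -
      have "real (2 ^ j) powr (3 / 2 - s) = q ^ j"
      proof -
        have "real (2 ^ j) = 2 powr real j" by (simp add: powr_realpow)
        then show ?thesis by (simp add: q_def powr_powr powr_power)
      qed
      then show ?thesis using dyadic_block_bound[OF s H W, of "2 ^ j"] by (simp add: w_def real_sqrt_mult)
    qed
    note sum = summable_dyadic[OF _ q _ block]
    have s1: "summable (\<lambda>n. real n * ?a n)" using sum(1) bc w by simp
    have s1': "(\<Sum>n. real n * ?a n) \<le> sqrt (block_const s) * w / (1 - q)" using sum(2) bc w by simp
    have H1: "integrable lborel H"
      using sobolev_weight_L1(1)[OF H W, of 0] s H integrable_norm_iff[of H lborel] by simp
    have a0: "?a 0 \<le> pi * (sqrt K * w)"
    proof -
      have "cmod (fourier_int H x) \<le> sqrt K * w" for x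
        using norm_fourier_int_le[OF H1, of x] sobolev_weight_L1(2)[OF H W, of 0] s by (simp add: K_def w_def)
      then have "?a 0 \<le> integral {0..pi} (\<lambda>_. sqrt K * w)"
        unfolding cosine_coeff_def
        by (intro integral_norm_bound_integral integrable_continuous_interval continuous_intros
           continuous_comp_1_minus_cos continuous_fourier_int H1) simp
      then show ?thesis by (simp add: mult_ac)
    qed
    have z: "(\<lambda>n. (if n = 0 then ?a 0 else 0) + 2 * (real n * ?a n)) sums (?a 0 + 2 * (\<Sum>n. real n * ?a n))"
      using sums_If_finite_set[of "{0}" "\<lambda>_. ?a 0"] s1
      by (intro sums_add sums_mult summable_sums) auto
    have le: "(real n + 1) * ?a n \<le> (if n = 0 then ?a 0 else 0) + 2 * (real n * ?a n)" for n
      using mult_right_mono[of 1 "real n" "?a n"] by (cases "n = 0") (auto simp: distrib_right)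
    have sm: "summable (\<lambda>n. (real n + 1) * ?a n)"
      by (rule summable_comparison_test'[OF sums_summable[OF z]]) (use le in auto)
    have "(\<Sum>n. (real n + 1) * ?a n) \<le> ?a 0 + 2 * (\<Sum>n. real n * ?a n)"
      unfolding sums_unique[OF z] by (intro suminf_le le sm sums_summable[OF z])
    also have "\<dots> \<le> pi * (sqrt K * w) + 2 * (sqrt (block_const s) * w / (1 - q))"
      using a0 s1' by (intro add_mono mult_left_mono) auto
    also have "\<dots> = C * w" by (simp add: C_def algebra_simps)
    finally show ?thesis using sm by (simp add: w_def)
  qed
  ultimately show ?thesis by blast
qed

section \<open>Chebyshev expansions\<close>

text \<open>All polynomials in cos \<theta> are annihilated, so replacing one factor u by a
  Weierstrass approximation shows that the weighted square integral of u is arbitrarily small. The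
  weight vanishes only at the end points, which continuity covers.\<close>

lemma vanishing_cosine_moments:
  fixes u :: "real \<Rightarrow> real"
  assumes u: "continuous_on {-1..1} u"
    and moments: "\<And>k. integral {0..pi} (\<lambda>\<theta>. u (cos \<theta>) * (sin \<theta>)\<^sup>2 * cos \<theta> ^ k) = 0"
    and x: "x \<in> {-1..1}"
  shows "u x = 0"
proof -
  note int = integrable_continuous_interval
  have cos: "cos ` {0..pi} \<subseteq> {-1..1::real}" by auto
  have uc: "continuous_on {0..pi} (\<lambda>\<theta>. u (cos \<theta>))"
    by (rule continuous_on_compose2[OF u _ cos]) (intro continuous_intros)
  have poly: "integral {0..pi} (\<lambda>\<theta>. u (cos \<theta>) * (sin \<theta>)\<^sup>2 * q (cos \<theta>)) = 0"
    if q_poly: "real_polynomial_function q" for q :: "real \<Rightarrow> real"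
  proof -
    obtain a n where q: "q = (\<lambda>x. \<Sum>i\<le>n. a i * x ^ i)"
      using q_poly unfolding real_polynomial_function_iff_sum by (elim exE) (rule that)
    have "integral {0..pi} (\<lambda>\<theta>. u (cos \<theta>) * (sin \<theta>)\<^sup>2 * q (cos \<theta>))
       = integral {0..pi} (\<lambda>\<theta>. \<Sum>i\<le>n. a i * (u (cos \<theta>) * (sin \<theta>)\<^sup>2 * cos \<theta> ^ i))"
      unfolding q by (simp add: sum_distrib_left mult_ac)
    also have "\<dots> = (\<Sum>i\<le>n. integral {0..pi} (\<lambda>\<theta>. a i * (u (cos \<theta>) * (sin \<theta>)\<^sup>2 * cos \<theta> ^ i)))"
      by (intro integral_sum int continuous_intros uc finite_atMost)
    finally show ?thesis using moments by simp
  qed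
  obtain b where b: "\<And>x. x \<in> {-1..1} \<Longrightarrow> \<bar>u x\<bar> \<le> b" and b0: "0 < b"
  proof -
    have "bounded (u ` {-1..1})" by (intro compact_imp_bounded compact_continuous_image u) simp
    then obtain b where "b > 0" "\<forall>y\<in>u ` {-1..1}. norm y \<le> b" unfolding bounded_pos by blast
    then show ?thesis using that[of b] by auto
  qed
  let ?J = "integral {0..pi} (\<lambda>\<theta>. (u (cos \<theta>) * sin \<theta>)\<^sup>2)"
  have J: "?J \<le> \<epsilon> * (b * pi)" if e0: "\<epsilon> > 0" for \<epsilon>
  proof -
    obtain q where q: "real_polynomial_function q" "\<And>x. x \<in> {-1..1} \<Longrightarrow> \<bar>u x - q x\<bar> < \<epsilon>"
      using Stone_Weierstrass_real_polynomial_function[OF compact_Icc u e0] by blast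
    have qc: "continuous_on {0..pi} (\<lambda>\<theta>. q (cos \<theta>))"
      by (rule continuous_on_compose2[OF continuous_on_polymonial_function])
         (use q(1) real_polynomial_function_eq in \<open>auto intro!: continuous_intros\<close>)
    have "?J = ?J - integral {0..pi} (\<lambda>\<theta>. u (cos \<theta>) * (sin \<theta>)\<^sup>2 * q (cos \<theta>))" using poly[OF q(1)] by simp
    also have "\<dots> = integral {0..pi} (\<lambda>\<theta>. (u (cos \<theta>) * sin \<theta>)\<^sup>2 - u (cos \<theta>) * (sin \<theta>)\<^sup>2 * q (cos \<theta>))"
      by (intro Henstock_Kurzweil_Integration.integral_diff[symmetric] int continuous_intros uc qc)
    also have "\<dots> \<le> integral {0..pi} (\<lambda>_. \<epsilon> * b)"
    proof (intro integral_le int continuous_intros uc qc)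
      fix \<theta> :: real
      have c: "cos \<theta> \<in> {-1..1}" by simp
      have "(u (cos \<theta>) * sin \<theta>)\<^sup>2 - u (cos \<theta>) * (sin \<theta>)\<^sup>2 * q (cos \<theta>)
         = (sin \<theta>)\<^sup>2 * (u (cos \<theta>) * (u (cos \<theta>) - q (cos \<theta>)))"
        by (simp add: power2_eq_square algebra_simps)
      also have "\<dots> \<le> \<bar>(sin \<theta>)\<^sup>2 * (u (cos \<theta>) * (u (cos \<theta>) - q (cos \<theta>)))\<bar>" by (rule abs_ge_self)
      also have "\<dots> = (sin \<theta>)\<^sup>2 * (\<bar>u (cos \<theta>)\<bar> * \<bar>u (cos \<theta>) - q (cos \<theta>)\<bar>)" by (simp add: abs_mult)
      also have "\<dots> \<le> 1 * (b * \<epsilon>)"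
        using b[OF c] q(2)[OF c] b0 by (intro mult_mono) (auto simp: abs_square_le_1)
      finally show "(u (cos \<theta>) * sin \<theta>)\<^sup>2 - u (cos \<theta>) * (sin \<theta>)\<^sup>2 * q (cos \<theta>) \<le> \<epsilon> * b" by (simp add: mult.commute)
    qed
    also have "\<dots> = \<epsilon> * (b * pi)" by simp
    finally show ?thesis .
  qed
  have "?J \<le> 0"
  proof (rule field_le_epsilon)
    fix e :: real assume "e > 0"
    then show "?J \<le> 0 + e" using J[of "e / (b * pi)"] b0 by simp
  qed
  moreover have "0 \<le> ?J" by (intro integral_nonneg int continuous_intros uc) auto
  ultimately have "?J = 0" by simp
  then have "\<forall>\<theta>\<in>{0..pi}. (u (cos \<theta>) * sin \<theta>)\<^sup>2 = 0"
    by (subst (asm) integral_eq_0_iff) (auto intro!: continuous_intros uc)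
  then have "u y = 0" if "y \<in> {-1<..<1}" for y
  proof -
    have "y = cos (arccos y)" "arccos y \<in> {0..pi}" "sin (arccos y) \<noteq> 0"
      using that by (auto simp: arccos_lbound arccos_ubound sin_arccos_nonzero)
    with \<open>\<forall>\<theta>\<in>{0..pi}. (u (cos \<theta>) * sin \<theta>)\<^sup>2 = 0\<close> show ?thesis by (metis mult_eq_0_iff power_eq_0_iff)
  qed
  moreover have "closure {-1<..<1::real} = {-1..1}" by simp
  ultimately show ?thesis
    using continuous_constant_on_closure[of "{-1<..<1}" u 0 x] u x by simp
qed

text \<open>The series converges uniformly to some continuous S with the same coefficients as f. The
  difference e then has vanishing sine moments, hence vanishing moments in the sense of
  \<open>vanishing_cosine_moments\<close>, and must be 0.\<close>

lemma sums_cheb_U: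
  assumes f: "continuous_on UNIV f" and wd: "summable (\<lambda>n. (real n + 1) * cmod (d n))"
    and d: "\<And>n. integral {0..pi} (\<lambda>\<theta>. f (1 - cos \<theta>) * of_real (sin \<theta> * sin (real (Suc n) * \<theta>))) = of_real (pi / 2) * d n"
    and t: "0 \<le> t" "t \<le> 2"
  shows "(\<lambda>n. d n * of_real (cheb_U n (1 - t))) sums f t"
proof -
  note int = integrable_continuous_interval
  define S where "S x = (\<Sum>n. d n * of_real (cheb_U n x))" for x
  have le: "cmod (d n * of_real (cheb_U n x)) \<le> (real n + 1) * cmod (d n)" if "x \<in> {-1..1}" for n x
    using mult_left_mono[OF abs_cheb_U_le[of x n], of "cmod (d n)"] that
    by (simp add: norm_mult mult.commute abs_le_iff)
  have sm: "summable (\<lambda>n. d n * of_real (cheb_U n x))" if "x \<in> {-1..1}" for x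
    by (rule summable_comparison_test'[OF wd]) (use le[OF that] in auto)
  have S: "continuous_on {-1..1} S"
  proof (rule uniform_limit_theorem)
    show "uniform_limit {-1..1} (\<lambda>N x. \<Sum>n<N. d n * of_real (cheb_U n x)) S sequentially"
      unfolding S_def[abs_def] by (rule Weierstrass_m_test[OF le wd])
    show "\<forall>\<^sub>F N in sequentially. continuous_on {-1..1} (\<lambda>x. \<Sum>n<N. d n * of_real (cheb_U n x))"
      by (intro always_eventually allI continuous_intros continuous_cheb_U)
  qed simp
  define e where "e x = f (1 - x) - S x" for x
  have fc: "continuous_on {-1..1} (\<lambda>x. f (1 - x))"
    by (rule continuous_on_compose2[OF f]) (auto intro!: continuous_intros)
  have e: "continuous_on {-1..1} e" unfolding e_def by (intro continuous_intros fc S)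
  have cos: "cos ` {0..pi} \<subseteq> {-1..1::real}" by auto
  have Sc: "continuous_on {0..pi} (\<lambda>\<theta>. S (cos \<theta>))"
    by (rule continuous_on_compose2[OF S _ cos]) (intro continuous_intros)
  have ec: "continuous_on {0..pi} (\<lambda>\<theta>. e (cos \<theta>))"
    by (rule continuous_on_compose2[OF e _ cos]) (intro continuous_intros)
  have orth: "integral {0..pi} (\<lambda>\<theta>. e (cos \<theta>) * of_real (sin \<theta> * sin (real (Suc m) * \<theta>))) = 0" for m
  proof -
    let ?h = "\<lambda>n \<theta>. d n * complex_of_real (sin (real (Suc n) * \<theta>) * sin (real (Suc m) * \<theta>))"
    have lim: "uniform_limit {0..pi} (\<lambda>N \<theta>. \<Sum>n<N. ?h n \<theta>) (\<lambda>\<theta>. \<Sum>n. ?h n \<theta>) sequentially"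
    proof (rule Weierstrass_m_test[OF _ wd])
      fix n \<theta>
      have "cmod (?h n \<theta>) \<le> cmod (d n) * (1 * 1)"
        unfolding norm_mult norm_of_real abs_mult
        by (intro mult_left_mono mult_mono) (auto intro: abs_sin_le_one)
      also have "\<dots> \<le> (real n + 1) * cmod (d n)" by (simp add: distrib_right)
      finally show "norm (?h n \<theta>) \<le> (real n + 1) * cmod (d n)" .
    qed
    have hS: "(\<Sum>n. ?h n \<theta>) = S (cos \<theta>) * of_real (sin \<theta> * sin (real (Suc m) * \<theta>))" for \<theta>
    proof -
      have "?h n \<theta> = (d n * of_real (cheb_U n (cos \<theta>))) * of_real (sin \<theta> * sin (real (Suc m) * \<theta>))" for n
        unfolding cheb_U_sin[symmetric] by (simp add: mult_ac)
      then have "(\<Sum>n. ?h n \<theta>) = (\<Sum>n. (d n * of_real (cheb_U n (cos \<theta>))) * of_real (sin \<theta> * sin (real (Suc m) * \<theta>)))"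
        by (simp only:)
      also have "\<dots> = S (cos \<theta>) * of_real (sin \<theta> * sin (real (Suc m) * \<theta>))"
        unfolding S_def by (rule suminf_mult2[symmetric]) (simp add: sm)
      finally show ?thesis .
    qed
    have cont: "continuous_on {0..pi} (\<lambda>\<theta>. \<Sum>n<N. ?h n \<theta>)" for N by (intro continuous_intros)
    obtain I J where I: "\<And>N. ((\<lambda>\<theta>. \<Sum>n<N. ?h n \<theta>) has_integral I N) {0..pi}"
      and J: "((\<lambda>\<theta>. \<Sum>n. ?h n \<theta>) has_integral J) {0..pi}" and IJ: "I \<longlonglongrightarrow> J"
      using uniform_limit_integral[OF lim cont] by auto
    have "I N = of_real (pi / 2) * d m" if "N > m" for N
    proof -
      have "I N = integral {0..pi} (\<lambda>\<theta>. \<Sum>n<N. ?h n \<theta>)" using integral_unique[OF I[of N]] by (rule sym)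
      also have "\<dots> = (\<Sum>n<N. integral {0..pi} (?h n))"
        by (intro integral_sum int continuous_intros) auto
      also have "\<dots> = (\<Sum>n<N. if n = m then of_real (pi / 2) * d m else 0)"
      proof (intro sum.cong refl)
        fix n
        let ?t = "\<lambda>\<theta>. sin (real (Suc n) * \<theta>) * sin (real (Suc m) * \<theta>)"
        have "?t integrable_on {0..pi}" by (intro int continuous_intros)
        then have "(?t has_integral (if n = m then pi / 2 else 0)) {0..pi}"
          using trig_orthogonality(2)[of "Suc n" "Suc m"] by (simp add: has_integral_iff)
        then have "((\<lambda>\<theta>. d n * complex_of_real (?t \<theta>)) has_integral d n * of_real (if n = m then pi / 2 else 0)) {0..pi}"
          by (intro has_integral_mult_right has_integral_of_real)
        then show "integral {0..pi} (?h n) = (if n = m then of_real (pi / 2) * d m else 0)"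
          by (auto dest: integral_unique)
      qed
      also have "\<dots> = of_real (pi / 2) * d m" using that by simp
      finally show ?thesis .
    qed
    then have "I \<longlonglongrightarrow> of_real (pi / 2) * d m"
      by (intro tendsto_eventually eventually_sequentiallyI[of "Suc m"]) auto
    then have J': "J = of_real (pi / 2) * d m" using IJ LIMSEQ_unique by blast
    have "integral {0..pi} (\<lambda>\<theta>. e (cos \<theta>) * of_real (sin \<theta> * sin (real (Suc m) * \<theta>)))
       = integral {0..pi} (\<lambda>\<theta>. f (1 - cos \<theta>) * of_real (sin \<theta> * sin (real (Suc m) * \<theta>)) - (\<Sum>n. ?h n \<theta>))"
      unfolding hS e_def by (simp add: left_diff_distrib)
    also have "\<dots> = of_real (pi / 2) * d m - J"
    proof -
      have "(\<lambda>\<theta>. f (1 - cos \<theta>) * of_real (sin \<theta> * sin (real (Suc m) * \<theta>))) integrable_on {0..pi}"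
        by (intro int continuous_intros continuous_comp_1_minus_cos f)
      then show ?thesis using J d[of m]
        by (subst Henstock_Kurzweil_Integration.integral_diff) (auto simp: integral_unique has_integral_integrable)
    qed
    finally show ?thesis using J' by simp
  qed
  have orth_pow: "integral {0..pi} (\<lambda>\<theta>. e (cos \<theta>) * of_real (sin \<theta> * sin (real (Suc m) * \<theta>) * cos \<theta> ^ k)) = 0" for k m
  proof (induction k arbitrary: m)
    case 0
    then show ?case using orth[of m] by simp
  next
    case (Suc k)
    let ?g = "\<lambda>j \<theta>. e (cos \<theta>) * of_real (sin \<theta> * sin (real j * \<theta>) * cos \<theta> ^ k)"
    \<comment> \<open>The index 0, which arises from lowering m = 0, is trivial because its sine is
      0.\<close>
    have zero: "integral {0..pi} (?g j) = 0" for j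
      using Suc.IH by (cases j) auto
    have trig: "sin (real (Suc m) * \<theta>) * cos \<theta> = (sin (real (Suc (Suc m)) * \<theta>) + sin (real m * \<theta>)) / 2" for \<theta>
    proof -
      have e: "real (Suc (Suc m)) * \<theta> = real (Suc m) * \<theta> + \<theta>" "real m * \<theta> = real (Suc m) * \<theta> - \<theta>"
        by (simp_all add: algebra_simps)
      show ?thesis unfolding e sin_add sin_diff by simp
    qed
    have eq: "e (cos \<theta>) * of_real (sin \<theta> * sin (real (Suc m) * \<theta>) * cos \<theta> ^ Suc k) = (?g (Suc (Suc m)) \<theta> + ?g m \<theta>) / 2" for \<theta>
    proof -
      have "sin \<theta> * sin (real (Suc m) * \<theta>) * cos \<theta> ^ Suc k = sin \<theta> * (sin (real (Suc m) * \<theta>) * cos \<theta>) * cos \<theta> ^ k"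
        by (simp add: mult_ac del: of_nat_Suc)
      also have "\<dots> = (sin \<theta> * sin (real (Suc (Suc m)) * \<theta>) * cos \<theta> ^ k + sin \<theta> * sin (real m * \<theta>) * cos \<theta> ^ k) / 2"
        unfolding trig by (simp add: distrib_left distrib_right del: of_nat_Suc)
      finally have product: "sin \<theta> * sin (real (Suc m) * \<theta>) * cos \<theta> ^ Suc k
        = (sin \<theta> * sin (real (Suc (Suc m)) * \<theta>) * cos \<theta> ^ k + sin \<theta> * sin (real m * \<theta>) * cos \<theta> ^ k) / 2" .
      show ?thesis unfolding product by (simp add: distrib_left del: of_nat_Suc)
    qed
    have "integral {0..pi} (\<lambda>\<theta>. e (cos \<theta>) * of_real (sin \<theta> * sin (real (Suc m) * \<theta>) * cos \<theta> ^ Suc k))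
       = integral {0..pi} (\<lambda>\<theta>. (?g (Suc (Suc m)) \<theta> + ?g m \<theta>) / 2)"
      unfolding eq ..
    also have "\<dots> = (integral {0..pi} (?g (Suc (Suc m))) + integral {0..pi} (?g m)) / 2"
    proof -
      have "((\<lambda>\<theta>. (?g (Suc (Suc m)) \<theta> + ?g m \<theta>) / 2) has_integral (integral {0..pi} (?g (Suc (Suc m))) + integral {0..pi} (?g m)) / 2) {0..pi}"
        by (intro has_integral_divide has_integral_add integrable_integral int continuous_intros ec)
      then show ?thesis by (rule integral_unique)
    qed
    also have "\<dots> = 0" unfolding zero by simp
    finally show ?case .
  qed
  \<comment> \<open>With m = 0 the two sines coincide and form the weight.\<close>
  have moments: "integral {0..pi} (\<lambda>\<theta>. e (cos \<theta>) * of_real ((sin \<theta>)\<^sup>2 * cos \<theta> ^ k)) = 0" for k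
    using orth_pow[of 0 k] by (simp add: power2_eq_square)
  have ei: "(\<lambda>\<theta>. e (cos \<theta>) * of_real ((sin \<theta>)\<^sup>2 * cos \<theta> ^ k)) integrable_on {0..pi}" for k
    by (intro int continuous_intros ec)
  have x: "1 - t \<in> {-1..1}" using t by auto
  have "Re (e (1 - t)) = 0"
  proof (rule vanishing_cosine_moments[OF _ _ x, of "\<lambda>x. Re (e x)"])
    show "integral {0..pi} (\<lambda>\<theta>. Re (e (cos \<theta>)) * (sin \<theta>)\<^sup>2 * cos \<theta> ^ k) = 0" for k
      using integral_linear[OF ei bounded_linear_Re, of k] moments[of k] by (simp add: o_def mult.assoc del: of_real_mult of_real_power)
  qed (intro continuous_intros e)
  moreover have "Im (e (1 - t)) = 0"
  proof (rule vanishing_cosine_moments[OF _ _ x, of "\<lambda>x. Im (e x)"])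
    show "integral {0..pi} (\<lambda>\<theta>. Im (e (cos \<theta>)) * (sin \<theta>)\<^sup>2 * cos \<theta> ^ k) = 0" for k
      using integral_linear[OF ei bounded_linear_Im, of k] moments[of k] by (simp add: o_def mult.assoc del: of_real_mult of_real_power)
  qed (intro continuous_intros e)
  ultimately have "f t = S (1 - t)" by (simp add: e_def complex_eq_iff)
  then show ?thesis using summable_sums[OF sm[OF x]] by (simp add: S_def)
qed

text \<open>Multiplying a Chebyshev polynomial by sin \<theta> gives a single sine, and the product
  of two sines is a difference of cosines whose frequencies differ by 2; hence the form of
  \<open>d\<close>.\<close>

lemma chebyshev_expansion:
  assumes f: "continuous_on UNIV f" and a: "summable (\<lambda>n. (real n + 1) * cmod (cosine_coeff f n))"
  defines "d \<equiv> \<lambda>n. (cosine_coeff f n - cosine_coeff f (n + 2)) / of_real pi"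
  shows "summable (\<lambda>n. (real n + 1) * cmod (d n))"
    and "(\<Sum>n. (real n + 1) * cmod (d n)) \<le> (\<Sum>n. (real n + 1) * cmod (cosine_coeff f n))"
    and "0 \<le> t \<Longrightarrow> t \<le> 2 \<Longrightarrow> (\<lambda>n. d n * of_real (cheb_U n (1 - t))) sums f t"
proof -
  let ?a = "\<lambda>n. (real n + 1) * cmod (cosine_coeff f n)"
  have a2: "summable (\<lambda>n. ?a (n + 2))" using a by (subst summable_iff_shift)
  have s2: "(\<Sum>n. ?a (n + 2)) \<le> (\<Sum>n. ?a n)"
    using suminf_split_initial_segment[OF a, of 2] sum_nonneg[of "{..<2}" ?a] by simp
  have le: "(real n + 1) * cmod (d n) \<le> (?a n + ?a (n + 2)) / 2" for n
  proof -
    have "cmod (d n) = cmod (cosine_coeff f n - cosine_coeff f (n + 2)) / pi"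
      by (simp add: d_def norm_divide)
    \<comment> \<open>Weakening 1 / pi to 1/2 turns the two shifted sums into an average, so the
      final bound has constant 1.\<close>
    also have "\<dots> \<le> (cmod (cosine_coeff f n) + cmod (cosine_coeff f (n + 2))) / 2"
      using pi_ge_two by (intro frac_le norm_triangle_ineq4) auto
    finally have "(real n + 1) * cmod (d n) \<le> (real n + 1) * ((cmod (cosine_coeff f n) + cmod (cosine_coeff f (n + 2))) / 2)"
      by (rule mult_left_mono) simp
    also have "\<dots> \<le> (?a n + ?a (n + 2)) / 2" by (simp add: algebra_simps)
    finally show ?thesis .
  qed
  have sm: "summable (\<lambda>n. (?a n + ?a (n + 2)) / 2)" by (intro summable_divide summable_add a a2)
  show wd: "summable (\<lambda>n. (real n + 1) * cmod (d n))"
    by (rule summable_comparison_test'[OF sm]) (use le in auto)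
  have "(\<Sum>n. (real n + 1) * cmod (d n)) \<le> (\<Sum>n. (?a n + ?a (n + 2)) / 2)"
    by (intro suminf_le le wd sm)
  also have "\<dots> = ((\<Sum>n. ?a n) + (\<Sum>n. ?a (n + 2))) / 2"
    by (intro sums_unique[symmetric] sums_divide sums_add summable_sums a a2)
  finally show "(\<Sum>n. (real n + 1) * cmod (d n)) \<le> (\<Sum>n. ?a n)" using s2 by simp
  assume t: "0 \<le> t" "t \<le> 2"
  show "(\<lambda>n. d n * of_real (cheb_U n (1 - t))) sums f t"
  proof (rule sums_cheb_U[OF f wd _ t])
    fix n
    note int = integrable_continuous_interval
    have "cos (real n * \<theta>) - cos (real (n + 2) * \<theta>) = 2 * (sin \<theta> * sin (real (Suc n) * \<theta>))" for \<theta>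
    proof -
      have e: "real (n + 2) * \<theta> = real (Suc n) * \<theta> + \<theta>" "real n * \<theta> = real (Suc n) * \<theta> - \<theta>"
        by (simp_all add: algebra_simps)
      show ?thesis unfolding e cos_add cos_diff by simp
    qed
    then have eq: "f (1 - cos \<theta>) * of_real (sin \<theta> * sin (real (Suc n) * \<theta>))
       = (f (1 - cos \<theta>) * of_real (cos (real n * \<theta>)) - f (1 - cos \<theta>) * of_real (cos (real (n + 2) * \<theta>))) / 2" for \<theta>
      by (simp add: right_diff_distrib[symmetric] of_real_diff[symmetric] del: of_real_diff)
    have "((\<lambda>\<theta>. (f (1 - cos \<theta>) * of_real (cos (real n * \<theta>)) - f (1 - cos \<theta>) * of_real (cos (real (n + 2) * \<theta>))) / 2)
      has_integral (cosine_coeff f n - cosine_coeff f (n + 2)) / 2) {0..pi}"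
      unfolding cosine_coeff_def
      by (intro has_integral_divide has_integral_diff integrable_integral int continuous_intros continuous_comp_1_minus_cos f)
    from integral_unique[OF this]
    show "integral {0..pi} (\<lambda>\<theta>. f (1 - cos \<theta>) * of_real (sin \<theta> * sin (real (Suc n) * \<theta>))) = of_real (pi / 2) * d n"
      unfolding eq by (simp only:) (simp add: d_def)
  qed
qed

text \<open>Membership in \<open>sobolev\<close> speaks of some transform, while
  \<open>sobolev_norm\<close> uses a chosen one. Uniqueness up to null sets is what makes the
  weighted norm of the chosen one finite.\<close>

lemma plancherel_transform_unique:
  assumes "is_plancherel_transform F G" "is_plancherel_transform F G'"
  shows "AE \<xi> in lborel. G \<xi> = G' \<xi>"
proof -
  have [measurable]: "G \<in> borel_measurable borel" "G' \<in> borel_measurable borel"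
    using assms by (auto simp: is_plancherel_transform_def Lp_space_2)
  let ?n = "\<lambda>G R. LINT \<xi>|lborel. (cmod (truncated_fourier R F \<xi> - G \<xi>))\<^sup>2"
  have ev: "\<forall>\<^sub>F R in at_top. integrable lborel (\<lambda>\<xi>. (cmod (truncated_fourier R F \<xi> - G \<xi>))\<^sup>2)"
    and lim: "(?n G \<longlongrightarrow> 0) at_top" if "is_plancherel_transform F G" for G
  proof -
    show "\<forall>\<^sub>F R in at_top. integrable lborel (\<lambda>\<xi>. (cmod (truncated_fourier R F \<xi> - G \<xi>))\<^sup>2)"
      using that by (auto simp: is_plancherel_transform_def Lp_tendsto_def Lp_space_2 elim: eventually_mono)
    have "((\<lambda>R. (Lp_norm lborel 2 (\<lambda>\<xi>. truncated_fourier R F \<xi> - G \<xi>))\<^sup>2) \<longlongrightarrow> 0\<^sup>2) at_top"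
      using that by (intro tendsto_power) (auto simp: is_plancherel_transform_def Lp_tendsto_def)
    then show "(?n G \<longlongrightarrow> 0) at_top" by (simp add: Lp_norm_2 integral_nonneg_AE)
  qed
  let ?D = "\<lambda>\<xi>. (cmod (G \<xi> - G' \<xi>))\<^sup>2"
  have pt: "?D \<xi> \<le> 2 * (cmod (truncated_fourier R F \<xi> - G \<xi>))\<^sup>2 + 2 * (cmod (truncated_fourier R F \<xi> - G' \<xi>))\<^sup>2" for R \<xi>
  proof -
    let ?u = "truncated_fourier R F \<xi> - G \<xi>" and ?v = "truncated_fourier R F \<xi> - G' \<xi>"
    have "?D \<xi> = (cmod (?v - ?u))\<^sup>2" by simp
    also have "\<dots> \<le> (cmod ?v + cmod ?u)\<^sup>2" by (intro power_mono norm_triangle_ineq4) auto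
    also have "\<dots> \<le> 2 * (cmod ?u)\<^sup>2 + 2 * (cmod ?v)\<^sup>2"
      using sum_squares_bound[of "cmod ?v" "cmod ?u"] by (simp add: power2_sum)
    finally show ?thesis .
  qed
  have i: "integrable lborel ?D"
  proof -
    obtain R where R: "integrable lborel (\<lambda>\<xi>. (cmod (truncated_fourier R F \<xi> - G \<xi>))\<^sup>2)"
      "integrable lborel (\<lambda>\<xi>. (cmod (truncated_fourier R F \<xi> - G' \<xi>))\<^sup>2)"
      using eventually_happens'[OF trivial_limit_at_top_linorder eventually_conj[OF ev[OF assms(1)] ev[OF assms(2)]]] by auto
    show ?thesis
      by (rule Bochner_Integration.integrable_bound[OF Bochner_Integration.integrable_add[OF integrable_mult_right[OF R(1), of 2] integrable_mult_right[OF R(2), of 2]]])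
         (use pt in \<open>auto intro!: AE_I2 order_trans[OF pt]\<close>)
  qed
  have "\<forall>\<^sub>F R in at_top. (LINT \<xi>|lborel. ?D \<xi>) \<le> 2 * ?n G R + 2 * ?n G' R"
    using ev[OF assms(1)] ev[OF assms(2)]
  proof eventually_elim
    case (elim R)
    have "(LINT \<xi>|lborel. ?D \<xi>) \<le> (LINT \<xi>|lborel. 2 * (cmod (truncated_fourier R F \<xi> - G \<xi>))\<^sup>2 + 2 * (cmod (truncated_fourier R F \<xi> - G' \<xi>))\<^sup>2)"
      by (rule integral_mono[OF i _ pt]) (use elim in auto)
    also have "\<dots> = 2 * ?n G R + 2 * ?n G' R" using elim by simp
    finally show ?case .
  qed
  moreover have "((\<lambda>R. 2 * ?n G R + 2 * ?n G' R) \<longlongrightarrow> 2 * 0 + 2 * 0) at_top"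
    by (intro tendsto_intros lim assms)
  ultimately have "(LINT \<xi>|lborel. ?D \<xi>) \<le> 2 * 0 + 2 * 0"
    by (intro tendsto_lowerbound) auto
  moreover have "0 \<le> (LINT \<xi>|lborel. ?D \<xi>)" by (intro integral_nonneg_AE) auto
  ultimately have "AE \<xi> in lborel. ?D \<xi> = 0"
    using integral_nonneg_eq_0_iff_AE[OF i] by simp
  then show ?thesis by eventually_elim simp
qed

theorem sobolev_chebyshev_expansion:
  assumes s: "s > 3 / 2"
  shows "\<exists>C\<ge>0. \<forall>F. continuous_on UNIV F \<and> F \<in> sobolev s \<longrightarrow> (\<exists>d. summable (\<lambda>n. (real n + 1) * cmod (d n)) \<and>
     (\<Sum>n. (real n + 1) * cmod (d n)) \<le> C * sobolev_norm s F \<and>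
     (\<forall>t. 0 \<le> t \<longrightarrow> t \<le> 2 \<longrightarrow> (\<lambda>n. d n * of_real (cheb_U n (1 - t))) sums F t))"
proof -
  \<comment> \<open>The block estimate covers orders up to 2; a higher order is weakened to 2, where
    the weight is smaller.\<close>
  define \<sigma> where "\<sigma> = min s 2"
  have \<sigma>: "3 / 2 < \<sigma>" "\<sigma> \<le> 2" "\<sigma> \<le> s" using s by (auto simp: \<sigma>_def)
  obtain C where C: "C \<ge> 0" and bound: "\<forall>H. H \<in> borel_measurable borel \<and> integrable lborel (sobolev_weight \<sigma> H) \<longrightarrow>
    summable (\<lambda>n. (real n + 1) * cmod (cosine_coeff (fourier_int H) n)) \<and>
    (\<Sum>n. (real n + 1) * cmod (cosine_coeff (fourier_int H) n)) \<le> C * sqrt (LINT \<xi>|lborel. sobolev_weight \<sigma> H \<xi>)"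
    using cosine_coeff_bound[OF \<sigma>(1,2)] by (elim exE conjE) (rule that)
  have "\<exists>d. summable (\<lambda>n. (real n + 1) * cmod (d n)) \<and> (\<Sum>n. (real n + 1) * cmod (d n)) \<le> C * sobolev_norm s F \<and>
     (\<forall>t. 0 \<le> t \<longrightarrow> t \<le> 2 \<longrightarrow> (\<lambda>n. d n * of_real (cheb_U n (1 - t))) sums F t)"
    if F: "continuous_on UNIV F" and Fs: "F \<in> sobolev s" for F
  proof -
    obtain G' where G': "is_plancherel_transform F G'" "bessel_weight s G' \<in> Lp_space lborel 2"
      using Fs by (auto simp: sobolev_def)
    define G where "G = (SOME G. is_plancherel_transform F G)"
    have G: "is_plancherel_transform F G" unfolding G_def using G'(1) by (rule someI[of "is_plancherel_transform F"])
    have [measurable]: "G \<in> borel_measurable borel"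
      using G by (auto simp: is_plancherel_transform_def Lp_space_2)
    have GG': "AE \<xi> in lborel. G \<xi> = G' \<xi>" by (rule plancherel_transform_unique[OF G G'(1)])
    have weight: "(cmod (bessel_weight s K \<xi>))\<^sup>2 = sobolev_weight s K \<xi>" for K \<xi>
      by (simp add: bessel_weight_def sobolev_weight_def norm_mult power_mult_distrib)
         (simp add: power2_eq_square powr_add[symmetric])
    have "integrable lborel (sobolev_weight s G')"
      using G'(2) unfolding Lp_space_2 weight by simp
    moreover have "AE \<xi> in lborel. sobolev_weight s G \<xi> = sobolev_weight s G' \<xi>"
      using GG' by eventually_elim (simp add: sobolev_weight_def)
    moreover have [measurable]: "sobolev_weight s G \<in> borel_measurable borel"
      unfolding sobolev_weight_def[abs_def] by measurable
    ultimately have Ws: "integrable lborel (sobolev_weight s G)"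
      by (subst integrable_cong_AE[of _ _ "sobolev_weight s G'"]) auto
    have norm: "sobolev_norm s F = sqrt (LINT \<xi>|lborel. sobolev_weight s G \<xi>)"
      unfolding sobolev_norm_def G_def[symmetric] Lp_norm_2 weight ..
    define c where "c = complex_of_real (1 / sqrt (2 * pi))"
    \<comment> \<open>The factor of the inversion formula is absorbed here; having modulus at most
      1, it does not enlarge the weighted norm.\<close>
    define H where "H = (\<lambda>\<xi>. c * G \<xi>)"
    have Hm [measurable]: "H \<in> borel_measurable borel" unfolding H_def by measurable
    have "cmod c = 1 / sqrt (2 * pi)" unfolding c_def norm_of_real by simp
    then have "cmod c \<le> 1" using pi_ge_two by (simp add: divide_le_eq)
    then have c: "(cmod c)\<^sup>2 \<le> 1" by (simp add: power_le_one)
    have le: "sobolev_weight \<sigma> H \<xi> \<le> sobolev_weight s G \<xi>" for \<xi>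
    proof -
      have "(1 + \<xi>\<^sup>2) powr \<sigma> \<le> (1 + \<xi>\<^sup>2) powr s" using \<sigma>(3) by (intro powr_mono) auto
      moreover have "(cmod (H \<xi>))\<^sup>2 \<le> (cmod (G \<xi>))\<^sup>2"
        using mult_right_mono[OF c, of "(cmod (G \<xi>))\<^sup>2"] by (simp add: H_def norm_mult power_mult_distrib)
      ultimately show ?thesis unfolding sobolev_weight_def by (intro mult_mono) auto
    qed
    have W: "integrable lborel (sobolev_weight \<sigma> H)"
    proof (rule Bochner_Integration.integrable_bound[OF Ws])
      show "sobolev_weight \<sigma> H \<in> borel_measurable lborel" unfolding sobolev_weight_def[abs_def] by measurable
    qed (use le in auto)
    have "(LINT \<xi>|lborel. sobolev_weight \<sigma> H \<xi>) \<le> (LINT \<xi>|lborel. sobolev_weight s G \<xi>)"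
      by (rule integral_mono[OF W Ws le])
    then have wn: "sqrt (LINT \<xi>|lborel. sobolev_weight \<sigma> H \<xi>) \<le> sobolev_norm s F" unfolding norm by simp
    have G1: "integrable lborel G"
      using sobolev_weight_L1(1)[OF _ Ws, of 0] s integrable_norm_iff[of G lborel] by simp
    have FH: "F = fourier_int H"
      using fourier_inversion[OF F G G1] by (simp add: fun_eq_iff H_def c_def)
    note b = bound[THEN spec, THEN mp, OF conjI[OF Hm W], folded FH]
    note e = chebyshev_expansion[OF F conjunct1[OF b]]
    have "(\<Sum>n. (real n + 1) * cmod (cosine_coeff F n)) \<le> C * sobolev_norm s F"
      using conjunct2[OF b] mult_left_mono[OF wn C] by simp
    from order_trans[OF e(2) this] show ?thesis using e(1,3) by (intro exI conjI allI impI)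
  qed
  then show ?thesis using C by (intro exI[of _ C] conjI allI impI) auto
qed

theorem theorem1p3:
  fixes E :: "'v \<Rightarrow> 'v \<Rightarrow> bool" and \<omega> :: "(nat \<Rightarrow> 'v) set" and m :: "'v \<Rightarrow> real" and s :: real
  assumes "flow_tree E \<omega> m" and "s > 3 / 2"
  shows "\<exists>C>0. \<forall>F. continuous_on UNIV F \<and> F \<in> sobolev s \<longrightarrow>
           (\<forall>p::ennreal. 1 \<le> p \<longrightarrow>
              mult_bounded (flow_measure m) (flow_laplacian E \<omega> m) F p \<and>
              mult_norm (flow_measure m) (flow_laplacian E \<omega> m) F p \<le> C * sobolev_norm s F)"
proof -
  interpret rooted_tree E \<omega>
    using assms(1) by unfold_locales (auto simp: flow_tree_def)
  interpret flow m "predecessor E \<omega>" by (rule flow_of_flow_tree[OF assms(1)])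
  obtain C where C: "C \<ge> 0" and expansion: "\<forall>F. continuous_on UNIV F \<and> F \<in> sobolev s \<longrightarrow>
      (\<exists>d. summable (\<lambda>n. (real n + 1) * cmod (d n)) \<and>
        (\<Sum>n. (real n + 1) * cmod (d n)) \<le> C * sobolev_norm s F \<and>
        (\<forall>t. 0 \<le> t \<longrightarrow> t \<le> 2 \<longrightarrow> (\<lambda>n. d n * of_real (cheb_U n (1 - t))) sums F t))"
    using sobolev_chebyshev_expansion[OF assms(2)] by (elim exE conjE) (rule that)
  have "mult_bounded M (flow_laplacian E \<omega> m) F q \<and> mult_norm M (flow_laplacian E \<omega> m) F q \<le> (C + 1) * sobolev_norm s F"
    if F: "continuous_on UNIV F" "F \<in> sobolev s" and q: "1 \<le> q" for F and q :: ennreal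
  proof -
    obtain d where d: "wiener d" and le: "wiener_norm d \<le> C * sobolev_norm s F"
      and exp: "\<And>t. 0 \<le> t \<Longrightarrow> t \<le> 2 \<Longrightarrow> (\<lambda>n. d n * of_real (cheb_U n (1 - t))) sums F t"
      using expansion[THEN spec, THEN mp, OF conjI[OF F]] unfolding wiener_def wiener_norm_def by blast
    have "0 \<le> sobolev_norm s F" by (simp add: sobolev_norm_def)
    \<comment> \<open>C may be 0, whereas the constant has to be positive; the Sobolev norm being
      nonnegative, C + 1 serves.\<close>
    then have "wiener_norm d \<le> (C + 1) * sobolev_norm s F" using le by (simp add: distrib_right)
    from mult_norm_le[OF wiener_mult_bounds[OF d F(1) exp q] this] show ?thesis
      unfolding flow_laplacian_eq[OF assms(1)] by blast
  qed
  then show ?thesis using C by (intro exI[of _ "C + 1"]) auto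
qed

end
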